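(* Let $\Phi$ satisfy Assumption (A), $\omega\in A^{\mathrm{loc}}_{\infty}(\mathbb{R}^n)$, $q_\omega$ its critical index and $\rho(t)=t^{-1}/\Phi^{-1}(t^{-1})$. Then for $q\in[1,\frac{q_\omega}{q_\omega-1})$, $$\mathrm{bmo}^q_{\rho,\omega}(\mathbb{R}^n)=\mathrm{bmo}_{\rho,\omega}(\mathbb{R}^n)$$ with equivalent norms, where $\mathrm{bmo}_{\rho,\omega}(\mathbb{R}^n)\equiv\mathrm{bmo}^1_{\rho,\omega}(\mathbb{R}^n)$.
   Context: Cubes are closed with sides parallel to the axes; $\omega(E)=\int_E\omega\,dx$; $\mathbb{Z}_+=\{0,1,2,\dots\}$; $\lfloor r\rfloor$ is the largest integer not exceeding $r$. Weights. For $p\in(1,\infty)$, $A^{\mathrm{loc}}_p(\mathbb{R}^n)$ is the set of nonnegative locally integrable $\omega$ with $\sup_{|Q|\le1}|Q|^{-p}\int_Q\omega\,dx\,(\int_Q\omega^{-p'/p}dx)^{p/p'}<\infty$ ($1/p+1/p'=1$); $A^{\mathrm{loc}}_1$: $\sup_{|Q|\le1}|Q|^{-1}\int_Q\omega\,dx\cdot\mathrm{ess\,sup}_Q\,\omega^{-1}<\infty$; $A^{\mathrm{loc}}_\infty$: for every $\alpha\in(0,1)$, $\sup_{|Q|\le1}\sup\{\omega(Q)/\omega(F):F\subset Q\text{ measurable},|F|\ge\alpha|Q|\}<\infty$. $q_\omega=\inf\{p\in[1,\infty):\omega\in A^{\mathrm{loc}}_p\}$; if $q_\omega=1$, $\frac{q_\omega}{q_\omega-1}$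 is read as $\infty$. Assumption (A) on $\Phi:(0,\infty)\to(0,\infty)$: $\Phi$ is continuous, strictly increasing, subadditive, concave, and of strictly lower type (for some $p>0$, $\Phi(st)\le t^p\Phi(s)$ for all $t\in(0,1)$, $s>0$), with $p_\Phi=\sup\{p>0:\Phi(st)\le t^p\Phi(s)\ \forall t\in(0,1),s>0\}\in(0,1]$. The bmo space. Fix an integer $s\in\mathbb{Z}_+$ with $s\ge\lfloor n(q_\omega/p_\Phi-1)\rfloor$. For a locally integrable $f$ and a cube $Q$, $P^s_Qf$ is the unique polynomial of degree at most $s$ with $\int_Q[f(x)-P^s_Qf(x)]x^\theta dx=0$ for all $\theta\in\mathbb{Z}_+^n$, $|\theta|\le s$. For $q\in[1,\frac{q_\omega}{q_\omega-1})$, $\mathrm{bmo}^q_{\rho,\omega}(\mathbb{R}^n)$ is the set of locally integrable $f$ with finite norm $$\sup_{|Q|<1}\frac1{\rho(\omega(Q))}\Big\{\frac1{\omega(Q)}\int_Q|f-P^s_Qf|^q\omega^{1-q}dx\Big\}^{1/q}+\sup_{|Q|\ge1}\frac1{\rho(\omega(Q))}\Big\{\frac1{\omega(Q)}\int_Q|f|^q\omega^{1-q}dx\Big\}^{1/q}$$ when $\omega(\mathbb{R}^n)=\infty$; when $\omega(\mathbb{R}^n)<\infty$ the extra term $\frac1{\rho(\omega(\mathbb{R}^n))}\{\frac1{\omega(\mathbb{R}^n)}\int_{\mathbb{R}^n}|f|^q\omega^{1-q}dx\}^{1/q}$ is added to the norm. Suprema are over cubes. *)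

theory Defs
  imports "HOL-Analysis.Analysis" "HOL-Probability.Essential_Supremum"
begin

section \<open>Powers of extended nonnegative numbers\<close>

text \<open>Real powers on \<open>[0,\<infinity>]\<close>. For negative exponents \<open>0\<close> is sent to \<open>\<infinity>\<close> (and \<open>\<infinity>\<close> to \<open>0\<close>),
  unlike for \<^const>\<open>powr\<close>, where \<open>0 powr r = 0\<close> for all \<open>r\<close>; this matters for
  \<open>\<omega>\<^sup>-\<^sup>p\<^sup>'\<^sup>/\<^sup>p\<close> on the zero set of \<open>\<omega>\<close>.\<close>

definition epow :: "ennreal \<Rightarrow> real \<Rightarrow> ennreal" where
  "epow x r =
     (if r = 0 then 1
      else if x = 0 then (if r > 0 then 0 else \<infinity>)
      else if x = \<infinity> then (if r > 0 then \<infinity> else 0)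
      else ennreal (enn2real x powr r))"


section \<open>Cubes and local weights\<close>

definition cubes :: "(real ^ 'n) set set" where
  "cubes = {cbox a (\<chi> i. a $ i + l) | a l. l > 0}"

definition locally_integrable ::
    "(real ^ 'n \<Rightarrow> 'a::{banach, second_countable_topology}) \<Rightarrow> bool" where
  "locally_integrable f \<longleftrightarrow> (\<forall>K. compact K \<longrightarrow> f absolutely_integrable_on K)"

text \<open>The function vanishing almost everywhere is not counted as a weight: it would give
  \<open>0/0\<close> and \<open>0 \<cdot> \<infinity>\<close> in the conditions below and \<open>\<omega>(Q) = 0\<close> in the denominators of the
  bmo norm.\<close>

definition weight :: "(real ^ 'n \<Rightarrow> real) \<Rightarrow> bool" where
  "weight \<omega> \<longleftrightarrow> (\<forall>x. 0 \<le> \<omega> x) \<and> locally_integrable \<omega> \<and> \<not> (AE x in lebesgue. \<omega> x = 0)"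

definition wmeas :: "(real ^ 'n \<Rightarrow> real) \<Rightarrow> (real ^ 'n) set \<Rightarrow> ennreal" where
  "wmeas \<omega> E = (\<integral>\<^sup>+x\<in>E. ennreal (\<omega> x) \<partial>lebesgue)"

definition conj_exp :: "real \<Rightarrow> real" where
  "conj_exp p = p / (p - 1)"

definition A_loc :: "real \<Rightarrow> (real ^ 'n \<Rightarrow> real) set" where
  "A_loc p = {\<omega>. weight \<omega> \<and>
     (if p = 1 then
        (SUP Q \<in> {Q \<in> cubes. emeasure lebesgue Q \<le> 1}.
           wmeas \<omega> Q / emeasure lebesgue Q
           * esssup (lebesgue_on Q) (\<lambda>x. inverse (ennreal (\<omega> x)))) < \<infinity>
      else
        (SUP Q \<in> {Q \<in> cubes. emeasure lebesgue Q \<le> 1}.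
           epow (emeasure lebesgue Q) (- p) * wmeas \<omega> Q
           * epow (\<integral>\<^sup>+x\<in>Q. epow (ennreal (\<omega> x)) (- conj_exp p / p) \<partial>lebesgue) (p / conj_exp p))
        < \<infinity>)}"

definition A_loc_inf :: "(real ^ 'n \<Rightarrow> real) set" where
  "A_loc_inf = {\<omega>. weight \<omega> \<and>
     (\<forall>\<alpha>\<in>{0<..<1}.
        (SUP Q \<in> {Q \<in> cubes. emeasure lebesgue Q \<le> 1}.
           SUP F \<in> {F \<in> sets lebesgue. F \<subseteq> Q \<and> emeasure lebesgue F \<ge> ennreal \<alpha> * emeasure lebesgue Q}.
             wmeas \<omega> Q / wmeas \<omega> F) < \<infinity>)}"

definition crit_index :: "(real ^ 'n \<Rightarrow> real) \<Rightarrow> real" where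
  "crit_index \<omega> = Inf {p. 1 \<le> p \<and> \<omega> \<in> A_loc p}"

definition crit_conj :: "(real ^ 'n \<Rightarrow> real) \<Rightarrow> ereal" where
  "crit_conj \<omega> = (if crit_index \<omega> = 1 then \<infinity> else ereal (crit_index \<omega> / (crit_index \<omega> - 1)))"


section \<open>Orlicz functions\<close>

text \<open>A function \<open>(0,\<infinity>) \<rightarrow> (0,\<infinity>)\<close> is represented by a function on \<^typ>\<open>real\<close> whose values
  outside \<open>{0<..}\<close> are irrelevant.\<close>

definition strictly_lower_type :: "real \<Rightarrow> (real \<Rightarrow> real) \<Rightarrow> bool" where
  "strictly_lower_type p \<Phi> \<longleftrightarrow> (\<forall>t s. 0 < t \<and> t < 1 \<and> 0 < s \<longrightarrow> \<Phi> (s * t) \<le> t powr p * \<Phi> s)"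

definition lower_index :: "(real \<Rightarrow> real) \<Rightarrow> real" where
  "lower_index \<Phi> = Sup {p. 0 < p \<and> strictly_lower_type p \<Phi>}"

definition assumption_A :: "(real \<Rightarrow> real) \<Rightarrow> bool" where
  "assumption_A \<Phi> \<longleftrightarrow>
     (\<forall>t>0. \<Phi> t > 0) \<and>
     continuous_on {0<..} \<Phi> \<and>
     strict_mono_on {0<..} \<Phi> \<and>
     (\<forall>s>0. \<forall>t>0. \<Phi> (s + t) \<le> \<Phi> s + \<Phi> t) \<and>
     concave_on {0<..} \<Phi> \<and>
     (\<exists>p>0. strictly_lower_type p \<Phi>) \<and>
     lower_index \<Phi> \<in> {0<..1}"

definition rho :: "(real \<Rightarrow> real) \<Rightarrow> real \<Rightarrow> real" where
  "rho \<Phi> t = inverse t / the_inv_into {0<..} \<Phi> (inverse t)"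


section \<open>Local polynomial projections and bmo spaces\<close>

text \<open>Multi-indices are functions \<open>'n \<Rightarrow> nat\<close>. The sort \<open>{real_normed_field, euclidean_space}\<close>
  used for function values covers the scalar fields \<^typ>\<open>real\<close> and \<^typ>\<open>complex\<close>
  simultaneously.\<close>

definition multi_indices :: "nat \<Rightarrow> ('n::finite \<Rightarrow> nat) set" where
  "multi_indices s = {\<theta>. (\<Sum>i\<in>UNIV. \<theta> i) \<le> s}"

definition mpow :: "real ^ 'n \<Rightarrow> ('n \<Rightarrow> nat) \<Rightarrow> real" where
  "mpow x \<theta> = (\<Prod>i\<in>UNIV. x $ i ^ \<theta> i)"

definition polys :: "nat \<Rightarrow> (real ^ 'n \<Rightarrow> 'a::{real_normed_field, euclidean_space}) set" where
  "polys s = {\<lambda>x. \<Sum>\<theta>\<in>multi_indices s. mpow x \<theta> *\<^sub>R c \<theta> | c. True}"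

definition poly_proj ::
    "nat \<Rightarrow> (real ^ 'n) set \<Rightarrow> (real ^ 'n \<Rightarrow> 'a::{real_normed_field, euclidean_space})
     \<Rightarrow> real ^ 'n \<Rightarrow> 'a" where
  "poly_proj s Q f = (THE P. P \<in> polys s \<and>
     (\<forall>\<theta>\<in>multi_indices s. (LINT x:Q|lebesgue. mpow x \<theta> *\<^sub>R (f x - P x)) = 0))"

definition wmean ::
    "(real \<Rightarrow> real) \<Rightarrow> (real ^ 'n \<Rightarrow> real) \<Rightarrow> real \<Rightarrow> (real ^ 'n) set
     \<Rightarrow> (real ^ 'n \<Rightarrow> 'a::real_normed_vector) \<Rightarrow> ennreal" where
  "wmean \<rho> \<omega> q E g =
     ennreal (1 / \<rho> (enn2real (wmeas \<omega> E))) *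
     epow (1 / wmeas \<omega> E *
             (\<integral>\<^sup>+x\<in>E. ennreal (norm (g x) powr q) * epow (ennreal (\<omega> x)) (1 - q) \<partial>lebesgue))
          (1 / q)"

definition bmo_norm ::
    "nat \<Rightarrow> (real \<Rightarrow> real) \<Rightarrow> (real ^ 'n \<Rightarrow> real) \<Rightarrow> real
     \<Rightarrow> (real ^ 'n \<Rightarrow> 'a::{real_normed_field, euclidean_space}) \<Rightarrow> ennreal" where
  "bmo_norm s \<rho> \<omega> q f =
     (SUP Q \<in> {Q \<in> cubes. emeasure lebesgue Q < 1}. wmean \<rho> \<omega> q Q (\<lambda>x. f x - poly_proj s Q f x))
     + (SUP Q \<in> {Q \<in> cubes. emeasure lebesgue Q \<ge> 1}. wmean \<rho> \<omega> q Q f)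
     + (if wmeas \<omega> UNIV < \<infinity> then wmean \<rho> \<omega> q UNIV f else 0)"

definition bmo ::
    "nat \<Rightarrow> (real \<Rightarrow> real) \<Rightarrow> (real ^ 'n \<Rightarrow> real) \<Rightarrow> real
     \<Rightarrow> (real ^ 'n \<Rightarrow> 'a::{real_normed_field, euclidean_space}) set" where
  "bmo s \<rho> \<omega> q = {f. locally_integrable f \<and> bmo_norm s \<rho> \<omega> q f < \<infinity>}"

end

theory Submission
  imports Defs
begin

text \<open>The statement is a John-Nirenberg theorem. For \<open>q > 1\<close> the bound of the \<open>bmo\<^sup>1\<close> norm by the \<open>bmo\<^sup>q\<close>
  norm is Hoelder's inequality (\<open>mean_le_dual_mean\<close>). For the converse let \<open>K\<close> be such that
  \<open>\<integral>\<^sub>R |f - P\<^sub>R f| \<le> K \<omega>(R)\<close> for all subcubes \<open>R\<close> of a cube \<open>Q\<close>; for \<open>|Q| < 1\<close> the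
  product of the \<open>bmo\<^sup>1\<close> norm and \<open>\<rho>(\<omega>(Q))\<close> will do, because \<open>\<rho>\<close> is increasing. Stop at the maximal dyadic subcubes \<open>R\<close>
  on which the mean of \<open>|f - P\<^sub>Q f|\<close> exceeds \<open>\<tau> = 2 K \<omega>(Q) / |Q|\<close>. Outside them
  \<open>|f - P\<^sub>Q f| \<le> \<tau>\<close> almost everywhere, inside \<open>R\<close> it differs from \<open>|f - P\<^sub>R f|\<close> by at most a
  constant times \<open>\<tau>\<close>, and they have at most half of the measure of \<open>Q\<close>, hence at most a fraction
  \<open>\<delta> < 1\<close> of its \<open>\<omega>\<close>-mass. Iterating, the contributions of the generations to the integral of
  \<open>|f - P\<^sub>Q f|\<^sup>q \<omega>\<^sup>1\<^sup>-\<^sup>q\<close> form a geometric series (\<open>iterated_stopping\<close>, \<open>john_nirenberg\<close>).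

  Each generation is estimated by the condition \<open>(\<omega>(R) / |R|)\<^sup>q \<integral>\<^sub>R \<omega>\<^sup>1\<^sup>-\<^sup>q \<le> C \<omega>(R)\<close>, which is the
  Muckenhoupt condition for the exponent conjugate to \<open>q\<close>. It follows from membership of \<open>\<omega>\<close> in the
  local class of some \<open>p\<close> below the conjugate exponent, and such a \<open>p\<close> exists because \<open>q\<close> is below the
  exponent conjugate to the critical index. This uses that the critical index is the infimum of a nonempty
  set, i.e. that a local \<open>A\<^sub>\<infinity>\<close> weight lies in some \<open>A\<^sub>p\<close>; the same iteration, applied to \<open>\<omega>\<^sup>-\<^sup>\<epsilon>\<close>
  with cells where the mean of \<open>\<omega>\<close> drops, proves it (\<open>negative_power_bound\<close>, \<open>exists_A_loc\<close>).

  On polynomials the argument needs only that \<open>P\<^sub>Q f\<close> exists and that its supremum over \<open>Q\<close> is at most a constant,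
  independent of \<open>Q\<close>, times the mean of \<open>|f|\<close> (\<open>poly_proj_diff_bound\<close>); Lagrange interpolation at translated
  nodes gives this. Cubes of volume at least \<open>1\<close> are tiled by cells of side less than \<open>1\<close>
  (\<open>large_cube_bound\<close>), and the whole space is exhausted by cubes.\<close>

(* With this rule the measure of a set would be rewritten to the lborel measure of its main part. *)
declare emeasure_completion [simp del]

section \<open>Cubes and dyadic cells\<close>

text \<open>Half-open cubes, unlike closed ones, are disjoint unions of their dyadic subcubes.\<close>

definition hcube :: "real ^ 'n \<Rightarrow> real \<Rightarrow> (real ^ 'n) set" where
  "hcube a l = {x. \<forall>i. a $ i \<le> x $ i \<and> x $ i < a $ i + l}"

definition ccube :: "real ^ 'n \<Rightarrow> real \<Rightarrow> (real ^ 'n) set" where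
  "ccube a l = cbox a (\<chi> i. a $ i + l)"

text \<open>The dyadic subcube of side \<open>l / 2\<^sup>k\<close> containing \<open>x\<close>, for the grid generated by \<open>hcube a l\<close>. Addressing
  the cells by their points makes them equivalence classes, so disjointness and nesting need no indices.\<close>

definition cell :: "real ^ 'n \<Rightarrow> real \<Rightarrow> nat \<Rightarrow> real ^ 'n \<Rightarrow> (real ^ 'n) set" where
  "cell a l k x = {y. \<forall>i. \<lfloor>(y $ i - a $ i) * 2 ^ k / l\<rfloor> = \<lfloor>(x $ i - a $ i) * 2 ^ k / l\<rfloor>}"

lemma mem_ccube: "x \<in> ccube a l \<longleftrightarrow> (\<forall>i. a $ i \<le> x $ i \<and> x $ i \<le> a $ i + l)"
  by (simp add: ccube_def mem_box_cart)

lemma cubes_eq: "cubes = {ccube a l | a l. 0 < l}"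
  by (simp add: cubes_def ccube_def)

lemma ccube_in_cubes: "0 < l \<Longrightarrow> ccube a l \<in> cubes"
  by (auto simp: cubes_eq)

lemma emeasure_ccube:
  fixes a :: "real ^ 'n"
  assumes "0 \<le> l"
  shows "emeasure lebesgue (ccube a l) = ennreal (l ^ CARD('n))"
proof -
  have ne: "cbox a (\<chi> i. a $ i + l) \<noteq> {}"
    using assms by (auto simp: set_eq_iff mem_box_cart intro!: exI[of _ a])
  have "emeasure lborel (ccube a l) = ennreal (measure lborel (ccube a l))"
    unfolding ccube_def by (rule emeasure_eq_ennreal_measure) (use emeasure_lborel_cbox_finite in \<open>auto simp: less_top\<close>)
  also have "measure lborel (ccube a l) = l ^ CARD('n)"
    unfolding ccube_def using content_cbox_cart[OF ne] by simp
  finally show ?thesis by (simp add: ccube_def emeasure_completion)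
qed

lemma hcube_sub_ccube: "hcube a l \<subseteq> ccube a l"
  by (auto simp: hcube_def mem_ccube less_imp_le)

lemma hcube_borel [measurable]: "hcube a l \<in> sets borel"
proof -
  have "hcube a l = (\<Inter>i. {x. a $ i \<le> x $ i} \<inter> {x. x $ i < a $ i + l})"
    by (auto simp: hcube_def)
  moreover have "(\<Inter>i. {x. a $ i \<le> x $ i} \<inter> {x. x $ i < a $ i + l}) \<in> sets borel"
    by (intro sets.finite_INT sets.Int borel_closed borel_open closed_Collect_le open_Collect_less
        continuous_intros) auto
  ultimately show ?thesis by simp
qed

lemma hcube_measurable [measurable, simp]: "hcube a l \<in> sets lebesgue"
  using hcube_borel by (metis sets_completionI_sets sets_lborel)

lemma ccube_measurable [measurable, simp]: "ccube a l \<in> sets lebesgue"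
  by (simp add: ccube_def)

lemma AE_hcube_ccube: "AE x in lebesgue. x \<in> hcube a l \<longleftrightarrow> x \<in> ccube a l"
proof -
  have "negligible (ccube a l - box a (\<chi> i. a $ i + l))"
    unfolding ccube_def by (rule negligible_frontier_interval)
  moreover have "box a (\<chi> i. a $ i + l) \<subseteq> hcube a l"
    by (auto simp: hcube_def mem_box_cart less_imp_le)
  ultimately have "negligible (ccube a l - hcube a l)"
    by (meson Diff_mono negligible_subset order_refl)
  then have "AE x in lebesgue. x \<notin> ccube a l - hcube a l"
    unfolding negligible_iff_null_sets by (rule AE_not_in)
  then show ?thesis by eventually_elim (use hcube_sub_ccube in blast)
qed

lemma nn_integral_hcube_ccube:
  "(\<integral>\<^sup>+x\<in>hcube a l. u x \<partial>lebesgue) = (\<integral>\<^sup>+x\<in>ccube a l. u x \<partial>lebesgue)"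
  by (rule nn_integral_cong_AE) (use AE_hcube_ccube[of a l] in \<open>auto simp: indicator_def\<close>)

lemma emeasure_hcube:
  fixes a :: "real ^ 'n"
  assumes "0 \<le> l"
  shows "emeasure lebesgue (hcube a l) = ennreal (l ^ CARD('n))"
  using nn_integral_hcube_ccube[of "\<lambda>_. 1" a l] by (simp add: emeasure_ccube[OF assms])

lemma mem_hcube_corner: "0 < l \<Longrightarrow> a \<in> hcube a l"
  by (simp add: hcube_def)

lemma hcube_sub_iff:
  assumes "0 < r"
  shows "hcube c r \<subseteq> hcube a l \<longleftrightarrow> (\<forall>i. a $ i \<le> c $ i \<and> c $ i + r \<le> a $ i + l)"
proof
  assume sub: "hcube c r \<subseteq> hcube a l"
  show "\<forall>i. a $ i \<le> c $ i \<and> c $ i + r \<le> a $ i + l"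
  proof
    fix i
    have 1: "a $ i \<le> c $ i" using mem_hcube_corner[OF assms, of c] sub by (auto simp: hcube_def)
    have "t < a $ i + l" if "c $ i < t" "t < c $ i + r" for t
    proof -
      have "(\<chi> j. if j = i then t else c $ j) \<in> hcube c r"
        using that assms by (auto simp: hcube_def)
      then have "(\<chi> j. if j = i then t else c $ j) \<in> hcube a l" using sub by blast
      then show ?thesis by (auto simp: hcube_def split: if_splits dest: spec[of _ i])
    qed
    then have "c $ i + r \<le> a $ i + l"
      using assms by (intro dense_le_bounded[of "c $ i" "c $ i + r"]) (auto intro: less_imp_le)
    with 1 show "a $ i \<le> c $ i \<and> c $ i + r \<le> a $ i + l" by simp
  qed
qed (fastforce simp: hcube_def intro: order_trans less_le_trans)

lemma hcube_side_mono: "0 < r \<Longrightarrow> hcube c r \<subseteq> hcube a l \<Longrightarrow> r \<le> l"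
  by (subst (asm) hcube_sub_iff) (auto dest!: spec[of _ undefined])

lemma mem_cell [simp]: "x \<in> cell a l k x" by (simp add: cell_def)

lemma cell_eq: "y \<in> cell a l k x \<Longrightarrow> cell a l k y = cell a l k x"
  by (auto simp: cell_def)

lemma cell_hcube:
  assumes "0 < l"
  shows "cell a l k x = hcube (\<chi> i. a $ i + l / 2 ^ k * of_int \<lfloor>(x $ i - a $ i) * 2 ^ k / l\<rfloor>) (l / 2 ^ k)"
proof -
  have *: "\<lfloor>(t - b) * 2 ^ k / l\<rfloor> = z \<longleftrightarrow> b + l / 2 ^ k * of_int z \<le> t \<and> t < b + l / 2 ^ k * of_int z + l / 2 ^ k"
    for t b z
  proof -
    have "\<lfloor>(t - b) * 2 ^ k / l\<rfloor> = z \<longleftrightarrow> of_int z \<le> (t - b) * 2 ^ k / l \<and> (t - b) * 2 ^ k / l < of_int z + 1"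
      by (simp add: floor_eq_iff)
    also have "\<dots> \<longleftrightarrow> b + l / 2 ^ k * of_int z \<le> t \<and> t < b + l / 2 ^ k * of_int z + l / 2 ^ k"
      using assms by (simp add: field_simps)
    finally show ?thesis .
  qed
  show ?thesis unfolding cell_def hcube_def using * by auto
qed

lemma cell_Suc_sub: "cell a l (Suc k) x \<subseteq> cell a l k x"
proof
  fix y assume y: "y \<in> cell a l (Suc k) x"
  have *: "\<lfloor>t * 2 ^ k / l\<rfloor> = \<lfloor>t * 2 ^ Suc k / l\<rfloor> div 2" for t :: real
  proof -
    have "\<lfloor>t * 2 ^ k / l\<rfloor> = \<lfloor>(t * 2 ^ Suc k / l) / real_of_int 2\<rfloor>" by simp
    also have "\<dots> = \<lfloor>t * 2 ^ Suc k / l\<rfloor> div 2" by (rule floor_divide_real_eq_div) simp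
    finally show ?thesis .
  qed
  show "y \<in> cell a l k x" using y unfolding cell_def * by auto
qed

lemma cell_antimono: "j \<le> k \<Longrightarrow> cell a l k x \<subseteq> cell a l j x"
  by (induction rule: dec_induct) (use cell_Suc_sub in blast)+

lemma cell_0:
  assumes "0 < l" "x \<in> hcube a l"
  shows "cell a l 0 x = hcube a l"
proof -
  have "\<lfloor>(x $ i - a $ i) / l\<rfloor> = 0" for i
    using assms by (auto simp: floor_eq_iff hcube_def field_simps)
  then show ?thesis using assms(1) by (simp add: cell_hcube vec_lambda_eta)
qed

lemma cell_sub_root:
  assumes "0 < l" "x \<in> hcube a l" shows "cell a l k x \<subseteq> hcube a l"
  using cell_antimono[of 0 k a l x] cell_0[OF assms] by simp

lemma cell_is_hcube: "0 < l \<Longrightarrow> \<exists>c. cell a l k x = hcube c (l / 2 ^ k)"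
  using cell_hcube by blast

lemma cell_measurable [measurable, simp]: "0 < l \<Longrightarrow> cell a l k x \<in> sets lebesgue"
  using cell_is_hcube[of l a k x] by auto

lemma countable_cells:
  fixes a :: "real ^ 'n"
  assumes "0 < l" shows "countable {cell a l k x | k x. P k x}"
proof -
  let ?f = "\<lambda>(k, z :: 'n \<Rightarrow> int). hcube (\<chi> i. a $ i + l / 2 ^ k * of_int (z i)) (l / 2 ^ k)"
  have "{cell a l k x | k x. P k x} \<subseteq> range ?f"
    unfolding cell_hcube[OF assms] by force
  then show ?thesis by (rule countable_subset) simp
qed

section \<open>Maximal cells with a property\<close>

definition stopping_cells ::
    "real ^ 'n \<Rightarrow> real \<Rightarrow> ((real ^ 'n) set \<Rightarrow> bool) \<Rightarrow> (real ^ 'n) set set" where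
  "stopping_cells a l bad = {cell a l k x | k x.
     x \<in> hcube a l \<and> bad (cell a l k x) \<and> (\<forall>j<k. \<not> bad (cell a l j x))}"

lemma stopping_cells_countable: "0 < l \<Longrightarrow> countable (stopping_cells a l bad)"
  unfolding stopping_cells_def by (rule countable_cells)

lemma stopping_cells_disjoint: "disjoint (stopping_cells a l bad)"
proof (rule disjointI)
  fix R S assume "R \<in> stopping_cells a l bad" "S \<in> stopping_cells a l bad" "R \<noteq> S"
  then obtain j x k y where R: "R = cell a l j x" "bad (cell a l j x)" "\<forall>i<j. \<not> bad (cell a l i x)"
    and S: "S = cell a l k y" "bad (cell a l k y)" "\<forall>i<k. \<not> bad (cell a l i y)"
    unfolding stopping_cells_def by blast
  show "R \<inter> S = {}"
  proof (rule ccontr)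
    assume "R \<inter> S \<noteq> {}"
    then obtain z where z: "z \<in> cell a l j x" "z \<in> cell a l k y" using R S by blast
    have eq: "cell a l i z = cell a l i x" if "i \<le> j" for i
      using z(1) cell_antimono[OF that, of a l x] by (intro cell_eq) auto
    have eq': "cell a l i z = cell a l i y" if "i \<le> k" for i
      using z(2) cell_antimono[OF that, of a l y] by (intro cell_eq) auto
    have "j = k"
      using R(2,3) S(2,3) eq eq' by (metis less_imp_le linorder_neqE_nat order_refl)
    then show False using eq[of j] eq'[of k] R S \<open>R \<noteq> S\<close> by simp
  qed
qed

lemma stopping_cellsD:
  assumes "0 < l" "R \<in> stopping_cells a l bad"
  shows "bad R" and "R \<subseteq> hcube a l" and "R \<in> sets lebesgue" and "\<exists>k x. x \<in> hcube a l \<and> R = cell a l k x"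
    and "\<exists>c r. 0 < r \<and> R = hcube c r"
proof -
  from assms(2) obtain k x where *: "x \<in> hcube a l" "R = cell a l k x" "bad (cell a l k x)"
    unfolding stopping_cells_def by blast
  then show "bad R" "R \<subseteq> hcube a l" "R \<in> sets lebesgue" "\<exists>k x. x \<in> hcube a l \<and> R = cell a l k x"
    using cell_sub_root[OF assms(1) *(1), of k] assms(1) by auto
  show "\<exists>c r. 0 < r \<and> R = hcube c r" unfolding *(2) cell_hcube[OF assms(1)]
    using assms(1) by (intro exI conjI, rule_tac[2] refl) simp
qed

text \<open>Maximality is used through the parent cell: quantities averaged over a stopping cell exceed the
  threshold by at most the factor between a cell and its parent.\<close>

lemma stopping_cells_parent:
  assumes "0 < l" "R \<in> stopping_cells a l bad" "\<not> bad (hcube a l)"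
  shows "\<exists>c r c'. 0 < r \<and> R = hcube c r \<and> hcube c r \<subseteq> hcube c' (2 * r) \<and> hcube c' (2 * r) \<subseteq> hcube a l
     \<and> \<not> bad (hcube c' (2 * r))"
proof -
  from assms(2) obtain k x where *: "x \<in> hcube a l" "R = cell a l k x" "bad (cell a l k x)"
    "\<forall>j<k. \<not> bad (cell a l j x)"
    unfolding stopping_cells_def by blast
  have "k \<noteq> 0" using * assms(3) cell_0[OF assms(1) *(1)] by metis
  then obtain m where m: "k = Suc m" by (cases k) auto
  obtain c where c: "cell a l k x = hcube c (l / 2 ^ k)" using cell_is_hcube[OF assms(1)] by blast
  obtain c' where c': "cell a l m x = hcube c' (l / 2 ^ m)" using cell_is_hcube[OF assms(1)] by blast
  have "l / 2 ^ m = 2 * (l / 2 ^ k)" by (simp add: m)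
  then show ?thesis
    using c c' * m cell_Suc_sub[of a l m x] cell_sub_root[OF assms(1) *(1), of m] assms(1)
    by (intro exI[of _ c] exI[of _ "l / 2 ^ k"] exI[of _ c']) auto
qed

lemma not_bad_outside_stopping:
  assumes "x \<in> hcube a l" "x \<notin> \<Union>(stopping_cells a l bad)"
  shows "\<not> bad (cell a l k x)"
proof
  assume "bad (cell a l k x)"
  define m where "m = (LEAST k. bad (cell a l k x))"
  have "bad (cell a l m x)" "\<forall>j<m. \<not> bad (cell a l j x)"
    unfolding m_def using \<open>bad (cell a l k x)\<close> by (rule LeastI) (use not_less_Least in auto)
  then have "cell a l m x \<in> stopping_cells a l bad" unfolding stopping_cells_def using assms(1) by blast
  then show False using assms(2) mem_cell by blast
qed

lemma stopping_cells_family: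
  assumes "0 < l"
  shows "countable (stopping_cells a l bad)" "disjoint (stopping_cells a l bad)"
    "stopping_cells a l bad \<subseteq> sets lebesgue" "\<Union>(stopping_cells a l bad) \<subseteq> hcube a l"
proof -
  show "stopping_cells a l bad \<subseteq> sets lebesgue" by (rule subsetI) (rule stopping_cellsD(3)[OF assms])
  show "\<Union>(stopping_cells a l bad) \<subseteq> hcube a l" by (rule Union_least) (rule stopping_cellsD(2)[OF assms])
qed (rule stopping_cells_countable[OF assms] stopping_cells_disjoint)+

section \<open>Integrals over countable families of sets\<close>

lemma nn_integral_countable_family_le:
  fixes X A :: "'i \<Rightarrow> 'b set"
  assumes "countable I" "disjoint_family_on X I"
    and [measurable]: "\<And>i. i \<in> I \<Longrightarrow> A i \<in> sets M" and "\<And>i. i \<in> I \<Longrightarrow> A i \<subseteq> X i"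
    and [measurable]: "u \<in> borel_measurable M"
    and le: "\<And>i. i \<in> I \<Longrightarrow> (\<integral>\<^sup>+x\<in>A i. u x \<partial>M) \<le> b i"
  shows "(\<integral>\<^sup>+x\<in>(\<Union>i\<in>I. A i). u x \<partial>M) \<le> (\<integral>\<^sup>+i. b i \<partial>count_space I)"
proof -
  have disj: "disjoint_family_on A I"
    using assms(2,4) unfolding disjoint_family_on_def by blast
  have "(\<integral>\<^sup>+x\<in>(\<Union>i\<in>I. A i). u x \<partial>M) = emeasure (density M u) (\<Union>i\<in>I. A i)"
    using assms(1) by (subst emeasure_density) (auto intro!: sets.countable_UN')
  also have "\<dots> = (\<integral>\<^sup>+i. emeasure (density M u) (A i) \<partial>count_space I)"
    using assms(1) disj by (intro emeasure_UN_countable) auto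
  also have "\<dots> \<le> (\<integral>\<^sup>+i. b i \<partial>count_space I)"
    using le by (intro nn_integral_mono) (simp add: emeasure_density)
  finally show ?thesis .
qed

lemma nn_integral_countable_family_eq:
  fixes X :: "'i \<Rightarrow> 'b set"
  assumes "countable I" "disjoint_family_on X I"
    and [measurable]: "\<And>i. i \<in> I \<Longrightarrow> X i \<in> sets M"
    and [measurable]: "u \<in> borel_measurable M"
  shows "(\<integral>\<^sup>+i. (\<integral>\<^sup>+x\<in>X i. u x \<partial>M) \<partial>count_space I) = (\<integral>\<^sup>+x\<in>(\<Union>i\<in>I. X i). u x \<partial>M)"
proof -
  have "(\<integral>\<^sup>+x\<in>(\<Union>i\<in>I. X i). u x \<partial>M) = emeasure (density M u) (\<Union>i\<in>I. X i)"
    using assms(1) by (subst emeasure_density) (auto intro!: sets.countable_UN')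
  also have "\<dots> = (\<integral>\<^sup>+i. emeasure (density M u) (X i) \<partial>count_space I)"
    using assms(1,2) by (intro emeasure_UN_countable) auto
  also have "\<dots> = (\<integral>\<^sup>+i. (\<integral>\<^sup>+x\<in>X i. u x \<partial>M) \<partial>count_space I)"
    by (intro nn_integral_cong) (simp add: emeasure_density)
  finally show ?thesis ..
qed

lemma nn_integral_disjoint_sets_le:
  assumes "countable F" "disjoint F" "F \<subseteq> sets M"
    and "u \<in> borel_measurable M" "v \<in> borel_measurable M"
    and le: "\<And>R. R \<in> F \<Longrightarrow> (\<integral>\<^sup>+x\<in>R. u x \<partial>M) \<le> (\<integral>\<^sup>+x\<in>R. v x \<partial>M)"
  shows "(\<integral>\<^sup>+x\<in>\<Union>F. u x \<partial>M) \<le> (\<integral>\<^sup>+x\<in>\<Union>F. v x \<partial>M)"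
proof -
  have d: "disjoint_family_on (\<lambda>R. R) F"
    using assms(2) by (auto simp: disjoint_family_on_def disjoint_def)
  have "(\<integral>\<^sup>+x\<in>(\<Union>R\<in>F. R). u x \<partial>M) \<le> (\<integral>\<^sup>+R. (\<integral>\<^sup>+x\<in>R. v x \<partial>M) \<partial>count_space F)"
    using assms(1,3,4) d le by (intro nn_integral_countable_family_le[where X = "\<lambda>R. R"]) auto
  also have "\<dots> = (\<integral>\<^sup>+x\<in>(\<Union>R\<in>F. R). v x \<partial>M)"
    using assms(1,3,5) d by (intro nn_integral_countable_family_eq) auto
  finally show ?thesis by simp
qed

lemma nn_set_integral_mono:
  assumes "A \<subseteq> B" shows "(\<integral>\<^sup>+x\<in>A. u x \<partial>M) \<le> (\<integral>\<^sup>+x\<in>B. u x \<partial>M)"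
  using assms by (intro nn_integral_mono) (auto simp: indicator_def)

lemma nn_integral_const_set: "A \<in> sets M \<Longrightarrow> (\<integral>\<^sup>+x\<in>A. c \<partial>M) = c * emeasure M A"
  by (rule nn_integral_cmult_indicator)

lemma nn_set_integral_mono_AE:
  assumes "AE x in M. x \<in> A \<longrightarrow> f x \<le> g x"
  shows "(\<integral>\<^sup>+x\<in>A. f x \<partial>M) \<le> (\<integral>\<^sup>+x\<in>A. g x \<partial>M)"
proof (rule nn_integral_mono_AE)
  show "AE x in M. f x * indicator A x \<le> g x * indicator A x"
    using assms by eventually_elim (simp add: indicator_def)
qed

lemma nn_set_integral_Un_le:
  assumes "A \<subseteq> B \<union> C" "B \<in> sets M" "C \<in> sets M" "u \<in> borel_measurable M"
  shows "(\<integral>\<^sup>+x\<in>A. u x \<partial>M) \<le> (\<integral>\<^sup>+x\<in>B. u x \<partial>M) + (\<integral>\<^sup>+x\<in>C. u x \<partial>M)"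
proof -
  note [measurable] = assms(2-4)
  have "(\<integral>\<^sup>+x\<in>A. u x \<partial>M) \<le> (\<integral>\<^sup>+x. u x * indicator B x + u x * indicator C x \<partial>M)"
    using assms(1) by (intro nn_integral_mono) (auto simp: indicator_def)
  also have "\<dots> = (\<integral>\<^sup>+x\<in>B. u x \<partial>M) + (\<integral>\<^sup>+x\<in>C. u x \<partial>M)"
    by (rule nn_integral_add) simp_all
  finally show ?thesis .
qed

text \<open>Borel-Cantelli for exceptional sets of geometrically decreasing measure.\<close>

lemma AE_eventually_outside:
  assumes "\<And>m. T m \<in> sets M" "\<And>m. emeasure M (T m) \<le> ennreal (c / 2 ^ m)" "0 \<le> c"
  shows "AE x in M. eventually (\<lambda>m. x \<notin> T m) sequentially"
proof -
  have fin: "emeasure M (T m) < \<infinity>" for m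
    using assms(2)[of m] by (simp add: le_less_trans less_top)
  have "measure M (T m) \<le> c * (1 / 2) ^ m" for m
    using enn2real_leI[OF _ assms(2)[of m]] assms(3) by (simp add: measure_def power_one_over)
  then have "\<And>m. norm (measure M (T m)) \<le> c * (1 / 2) ^ m" by simp
  moreover have "summable (\<lambda>m. c * (1 / 2 :: real) ^ m)"
    by (intro summable_mult summable_geometric) simp
  ultimately have "summable (\<lambda>m. measure M (T m))"
    by (rule summable_comparison_test'[where N = 0, rotated])
  from borel_cantelli_AE1[OF assms(1) fin this] show ?thesis
    by eventually_elim (auto elim: eventually_mono)
qed

text \<open>A differentiation theorem for dyadic cells. Let \<open>S\<close> be the part of \<open>Z\<close> where \<open>v < u\<close>. A neighbourhood
  of \<open>S\<close> of small excess contains a disjoint union of cells covering \<open>S\<close>, each of which meets \<open>S\<close>; adding the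
  hypothesis over these cells gives \<open>\<integral>\<^sub>S u \<le> \<integral>\<^sub>S v\<close> in the limit, so \<open>S\<close> is a null set.\<close>

lemma AE_le_of_cells:
  fixes a :: "real ^ 'n"
  assumes l: "0 < l"
    and [measurable]: "u \<in> borel_measurable lebesgue" "v \<in> borel_measurable lebesgue" "Z \<in> sets lebesgue"
    and Z: "Z \<subseteq> hcube a l" and fin: "(\<integral>\<^sup>+x\<in>hcube a l. v x \<partial>lebesgue) < \<infinity>"
    and le: "\<And>x k. x \<in> Z \<Longrightarrow> (\<integral>\<^sup>+y\<in>cell a l k x. u y \<partial>lebesgue) \<le> (\<integral>\<^sup>+y\<in>cell a l k x. v y \<partial>lebesgue)"
  shows "AE x in lebesgue. x \<in> Z \<longrightarrow> u x \<le> v x"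
proof -
  define S where "S = {x \<in> space lebesgue. x \<in> Z \<and> v x < u x}"
  have S[measurable]: "S \<in> sets lebesgue" unfolding S_def by measurable
  have SQ: "S \<subseteq> hcube a l" using Z by (auto simp: S_def)
  have "\<exists>U. open U \<and> S \<subseteq> U \<and> U - S \<in> sets lebesgue \<and> emeasure lebesgue (U - S) \<le> ennreal (1 / 2 ^ m)" for m :: nat
  proof -
    obtain U where "open U" "S \<subseteq> U" "U - S \<in> lmeasurable" "emeasure lebesgue (U - S) < ennreal (1 / 2 ^ m)"
      using sets_lebesgue_outer_open[OF S, of "1 / 2 ^ m"] by auto
    then show ?thesis by (auto intro: less_imp_le)
  qed
  then obtain U where U: "\<And>m. open (U m)" "\<And>m. S \<subseteq> U m"
    "\<And>m::nat. emeasure lebesgue (U m - S) \<le> ennreal (1 / 2 ^ m)" by metis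
  have [measurable]: "U m \<in> sets lebesgue" for m using U(1) by (simp add: borel_open)
  define T where "T m = hcube a l \<inter> (U m - S)" for m
  have [measurable]: "T m \<in> sets lebesgue" for m unfolding T_def by measurable
  have main: "(\<integral>\<^sup>+x\<in>S. u x \<partial>lebesgue) \<le> (\<integral>\<^sup>+x\<in>S. v x \<partial>lebesgue) + (\<integral>\<^sup>+x\<in>T m. v x \<partial>lebesgue)" for m
  proof -
    \<comment> \<open>the maximal cells inside \<open>U m\<close> that meet \<open>S\<close>\<close>
    define F where "F = stopping_cells a l (\<lambda>R. R \<subseteq> U m \<and> R \<inter> S \<noteq> {})"
    have F: "countable F" "disjoint F" "F \<subseteq> sets lebesgue"
      unfolding F_def using stopping_cells_countable stopping_cells_disjoint stopping_cellsD[OF l] l by blast+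
    have sub: "S \<subseteq> \<Union>F"
    proof
      fix x assume x: "x \<in> S"
      obtain e where e: "0 < e" "ball x e \<subseteq> U m" using U x by (meson openE subset_iff)
      obtain k where k: "real CARD('n) * l / e < 2 ^ k" using real_arch_pow[of 2] by auto
      have small: "cell a l k x \<subseteq> ball x e"
      proof
        fix y assume y: "y \<in> cell a l k x"
        obtain c where c: "cell a l k x = hcube c (l / 2 ^ k)" using cell_is_hcube[OF l] by blast
        have *: "\<bar>(x - y) $ i\<bar> \<le> l / 2 ^ k" for i
        proof -
          have "y \<in> hcube c (l / 2 ^ k)" "x \<in> hcube c (l / 2 ^ k)" using y mem_cell[of x a l k] c by auto
          then have "c $ i \<le> x $ i" "x $ i < c $ i + l / 2 ^ k" "c $ i \<le> y $ i" "y $ i < c $ i + l / 2 ^ k"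
            by (auto simp: hcube_def)
          then show ?thesis by simp
        qed
        have "dist x y \<le> (\<Sum>i\<in>UNIV. \<bar>(x - y) $ i\<bar>)" unfolding dist_norm by (rule norm_le_l1_cart)
        also have "\<dots> \<le> (\<Sum>i\<in>(UNIV::'n set). l / 2 ^ k)" by (intro sum_mono *)
        also have "\<dots> = real CARD('n) * l / 2 ^ k" by simp
        also have "\<dots> < e" using k e(1) by (simp add: field_simps)
        finally show "y \<in> ball x e" by simp
      qed
      show "x \<in> \<Union>F"
      proof (rule ccontr)
        assume "x \<notin> \<Union>F"
        from not_bad_outside_stopping[OF _ this[unfolded F_def], of k] x SQ
        have "\<not> (cell a l k x \<subseteq> U m \<and> cell a l k x \<inter> S \<noteq> {})" by auto
        then show False using small e(2) x mem_cell by blast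
      qed
    qed
    have supU: "\<Union>F \<subseteq> S \<union> T m"
      unfolding T_def F_def using stopping_cellsD[OF l] by blast
    have "(\<integral>\<^sup>+x\<in>S. u x \<partial>lebesgue) \<le> (\<integral>\<^sup>+x\<in>\<Union>F. u x \<partial>lebesgue)" by (rule nn_set_integral_mono[OF sub])
    also have "\<dots> \<le> (\<integral>\<^sup>+x\<in>\<Union>F. v x \<partial>lebesgue)"
    proof (rule nn_integral_disjoint_sets_le[OF F])
      fix R assume R: "R \<in> F"
      then have "R \<inter> S \<noteq> {}" using stopping_cellsD(1)[OF l] unfolding F_def by blast
      moreover obtain k z where kz: "R = cell a l k z" using R stopping_cellsD(4)[OF l] unfolding F_def by blast
      ultimately obtain x where "x \<in> S" "x \<in> cell a l k z" by blast
      then have "x \<in> Z" "R = cell a l k x" using cell_eq[of x a l k z] kz by (simp_all add: S_def)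
      then show "(\<integral>\<^sup>+x\<in>R. u x \<partial>lebesgue) \<le> (\<integral>\<^sup>+x\<in>R. v x \<partial>lebesgue)" using le by simp
    qed simp_all
    also have "\<dots> \<le> (\<integral>\<^sup>+x\<in>S. v x \<partial>lebesgue) + (\<integral>\<^sup>+x\<in>T m. v x \<partial>lebesgue)"
      by (rule nn_set_integral_Un_le[OF supU]) simp_all
    finally show ?thesis .
  qed
  have "AE x in lebesgue. eventually (\<lambda>m. x \<notin> T m) sequentially"
  proof (rule AE_eventually_outside[where c = 1])
    show "emeasure lebesgue (T m) \<le> ennreal (1 / 2 ^ m)" for m
      by (rule order_trans[OF emeasure_mono U(3)]) (auto simp: T_def)
  qed simp_all
  then have ev: "AE x in lebesgue. (\<lambda>m. v x * indicator (T m) x) \<longlonglongrightarrow> 0"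
  proof eventually_elim
    fix x assume "eventually (\<lambda>m. x \<notin> T m) sequentially"
    then show "(\<lambda>m. v x * indicator (T m) x) \<longlonglongrightarrow> 0"
      by (intro tendsto_eventually) (erule eventually_mono, simp)
  qed
  have "(\<lambda>m. \<integral>\<^sup>+x\<in>T m. v x \<partial>lebesgue) \<longlonglongrightarrow> (\<integral>\<^sup>+x. 0 \<partial>(lebesgue :: (real ^ 'n) measure))"
  proof (rule nn_integral_dominated_convergence[where u = "\<lambda>m x. v x * indicator (T m) x" and u' = "\<lambda>_. 0" and w = "\<lambda>x. v x * indicator (hcube a l) x"])
    show "AE x in lebesgue. v x * indicator (T m) x \<le> v x * indicator (hcube a l) x" for m
      by (intro AE_I2) (simp add: T_def indicator_def)
  qed (use fin ev in simp_all)
  then have "(\<lambda>m. (\<integral>\<^sup>+x\<in>S. v x \<partial>lebesgue) + (\<integral>\<^sup>+x\<in>T m. v x \<partial>lebesgue)) \<longlonglongrightarrow> (\<integral>\<^sup>+x\<in>S. v x \<partial>lebesgue) + 0"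
    by (intro tendsto_add tendsto_const) simp
  then have uv: "(\<integral>\<^sup>+x\<in>S. u x \<partial>lebesgue) \<le> (\<integral>\<^sup>+x\<in>S. v x \<partial>lebesgue)"
    using main by (intro LIMSEQ_le_const[where X = "\<lambda>m. (\<integral>\<^sup>+x\<in>S. v x \<partial>lebesgue) + (\<integral>\<^sup>+x\<in>T m. v x \<partial>lebesgue)"]) auto
  have finS: "(\<integral>\<^sup>+x\<in>S. v x \<partial>lebesgue) \<noteq> \<infinity>"
    using le_less_trans[OF nn_set_integral_mono[OF SQ, of lebesgue v] fin] by simp
  have vu: "AE x in lebesgue. v x * indicator S x \<le> u x * indicator S x"
    by (intro AE_I2) (simp add: S_def indicator_def less_imp_le)
  have "AE x in lebesgue. u x * indicator S x \<le> v x * indicator S x"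
  proof (rule ccontr)
    assume "\<not> ?thesis"
    then have "(\<integral>\<^sup>+x\<in>S. v x \<partial>lebesgue) < (\<integral>\<^sup>+x\<in>S. u x \<partial>lebesgue)"
      by (intro nn_integral_less finS vu) simp_all
    then show False using uv by simp
  qed
  then show ?thesis
    by eventually_elim (auto simp: S_def indicator_def of_bool_def not_less split: if_splits)
qed

section \<open>Self-improvement\<close>

text \<open>Off the family \<open>F\<close> the function of \<open>Q\<close> is bounded by \<open>h\<close>; on \<open>R \<in> F\<close> it is passed on to the
  function of \<open>R\<close>, at the cost of a factor \<open>\<kappa>\<close> and the same error \<open>h\<close>, while the total bound \<open>\<Sum> \<beta> R\<close> shrinks
  by \<open>\<theta> / \<kappa>\<close>. After \<open>m\<close> rounds only a set of measure \<open>|Q| / 2\<^sup>m\<close> remains untreated. The induction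
  on \<open>m\<close>, for all \<open>Q\<close> at once, carries the exceptional set along, which takes the place of an a priori bound for
  the integral; Fatou's lemma removes it in the limit.\<close>

lemma iterated_stopping:
  fixes G :: "'b set \<Rightarrow> 'b \<Rightarrow> ennreal" and \<beta> :: "'b set \<Rightarrow> ennreal"
  assumes sets: "\<And>Q. Q \<in> \<Q> \<Longrightarrow> Q \<in> sets M" and fin: "\<And>Q. Q \<in> \<Q> \<Longrightarrow> emeasure M Q < \<infinity>"
    and G: "\<And>Q. Q \<in> \<Q> \<Longrightarrow> G Q \<in> borel_measurable M"
    and step: "\<And>Q. Q \<in> \<Q> \<Longrightarrow> \<exists>F h. countable F \<and> disjoint F \<and> F \<subseteq> \<Q> \<and> \<Union>F \<subseteq> Q
        \<and> emeasure M (\<Union>F) \<le> emeasure M Q / 2 \<and> h \<in> borel_measurable M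
        \<and> (AE x in M. x \<in> Q - \<Union>F \<longrightarrow> G Q x \<le> h x)
        \<and> (\<forall>R\<in>F. AE x in M. x \<in> R \<longrightarrow> G Q x \<le> \<kappa> * G R x + h x)
        \<and> (\<integral>\<^sup>+x\<in>Q. h x \<partial>M) \<le> K * \<beta> Q \<and> \<kappa> * (\<integral>\<^sup>+R. \<beta> R \<partial>count_space F) \<le> \<theta> * \<beta> Q"
    and B: "K + \<theta> * B \<le> B"
    and Q: "Q \<in> \<Q>"
  shows "(\<integral>\<^sup>+x\<in>Q. G Q x \<partial>M) \<le> B * \<beta> Q"
proof -
  have claim: "\<exists>E. E \<in> sets M \<and> E \<subseteq> Q \<and> emeasure M E \<le> emeasure M Q / 2 ^ m
      \<and> (\<integral>\<^sup>+x\<in>Q - E. G Q x \<partial>M) \<le> B * \<beta> Q" if "Q \<in> \<Q>" for Q m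
    using that
  proof (induction m arbitrary: Q)
    case 0
    \<comment> \<open>all of \<open>Q\<close> is exceptional\<close>
    then show ?case using sets by (intro exI[of _ Q]) (simp add: divide_ennreal_def)
  next
    case (Suc m)
    note [measurable] = sets[OF Suc.prems] G[OF Suc.prems]
    obtain F h where F: "countable F" "disjoint F" "F \<subseteq> \<Q>" "\<Union>F \<subseteq> Q"
      "emeasure M (\<Union>F) \<le> emeasure M Q / 2" and h[measurable]: "h \<in> borel_measurable M"
      and out: "AE x in M. x \<in> Q - \<Union>F \<longrightarrow> G Q x \<le> h x"
      and ins: "\<And>R. R \<in> F \<Longrightarrow> AE x in M. x \<in> R \<longrightarrow> G Q x \<le> \<kappa> * G R x + h x"
      and hK: "(\<integral>\<^sup>+x\<in>Q. h x \<partial>M) \<le> K * \<beta> Q"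
      and \<beta>: "\<kappa> * (\<integral>\<^sup>+R. \<beta> R \<partial>count_space F) \<le> \<theta> * \<beta> Q"
      using step[OF Suc.prems] by (elim exE conjE) (rule that; (assumption | erule (1) bspec))
    have FM: "R \<in> sets M" if "R \<in> F" for R using that F(3) sets by blast
    have UF[measurable]: "\<Union>F \<in> sets M" using FM F(1) by (intro sets.countable_Union) auto
    have dF: "disjoint_family_on (\<lambda>R. R) F"
      using F(2) by (auto simp: disjoint_family_on_def disjoint_def)
    have "\<forall>R\<in>F. \<exists>E. E \<in> sets M \<and> E \<subseteq> R \<and> emeasure M E \<le> emeasure M R / 2 ^ m
      \<and> (\<integral>\<^sup>+x\<in>R - E. G R x \<partial>M) \<le> B * \<beta> R" using Suc.IH F(3) by blast
    then obtain E where E: "\<And>R. R \<in> F \<Longrightarrow> E R \<in> sets M" "\<And>R. R \<in> F \<Longrightarrow> E R \<subseteq> R"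
      "\<And>R. R \<in> F \<Longrightarrow> emeasure M (E R) \<le> emeasure M R / 2 ^ m"
      "\<And>R. R \<in> F \<Longrightarrow> (\<integral>\<^sup>+x\<in>R - E R. G R x \<partial>M) \<le> B * \<beta> R" by metis
    define E' where "E' = (\<Union>R\<in>F. E R)"
    have E'[measurable]: "E' \<in> sets M" unfolding E'_def using E(1) F(1) by (intro sets.countable_UN') auto
    have "emeasure M E' = (\<integral>\<^sup>+x\<in>(\<Union>R\<in>F. E R). 1 \<partial>M)" using E' by (simp add: E'_def)
    also have "\<dots> \<le> (\<integral>\<^sup>+R. emeasure M R / 2 ^ m \<partial>count_space F)"
      using E(1,2,3) by (intro nn_integral_countable_family_le[OF F(1) dF]) auto
    also have "\<dots> = (\<integral>\<^sup>+R. emeasure M R \<partial>count_space F) / 2 ^ m"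
      by (simp add: nn_integral_divide)
    also have "(\<integral>\<^sup>+R. emeasure M R \<partial>count_space F) = emeasure M (\<Union>F)"
      using emeasure_UN_countable[where X = "\<lambda>R. R", OF FM F(1) dF] by simp
    also have "emeasure M (\<Union>F) / 2 ^ m \<le> emeasure M Q / 2 / 2 ^ m"
      by (rule divide_right_mono_ennreal[OF F(5)])
    also have "\<dots> = emeasure M Q / 2 ^ Suc m"
      by (simp add: divide_ennreal_def ennreal_inverse_mult mult.assoc power_less_top_ennreal)
    finally have "emeasure M E' \<le> emeasure M Q / 2 ^ Suc m" .
    moreover have "E' \<subseteq> Q" using E(2) F(4) unfolding E'_def by blast
    moreover have "(\<integral>\<^sup>+x\<in>Q - E'. G Q x \<partial>M) \<le> B * \<beta> Q"
    proof -
      have "Q - E' \<subseteq> (Q - \<Union>F) \<union> (\<Union>R\<in>F. R - E R)" unfolding E'_def by blast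
      moreover have RE: "(\<Union>R\<in>F. R - E R) \<in> sets M"
        using E(1) FM F(1) by (intro sets.countable_UN') auto
      ultimately have "(\<integral>\<^sup>+x\<in>Q - E'. G Q x \<partial>M)
          \<le> (\<integral>\<^sup>+x\<in>Q - \<Union>F. G Q x \<partial>M) + (\<integral>\<^sup>+x\<in>(\<Union>R\<in>F. R - E R). G Q x \<partial>M)"
        by (intro nn_set_integral_Un_le) simp_all
      also have "(\<integral>\<^sup>+x\<in>Q - \<Union>F. G Q x \<partial>M) \<le> (\<integral>\<^sup>+x\<in>Q - \<Union>F. h x \<partial>M)"
        using out by (intro nn_integral_mono_AE) (auto simp: indicator_def)
      also have "(\<integral>\<^sup>+x\<in>(\<Union>R\<in>F. R - E R). G Q x \<partial>M)
          \<le> (\<integral>\<^sup>+R. \<kappa> * B * \<beta> R + (\<integral>\<^sup>+x\<in>R. h x \<partial>M) \<partial>count_space F)"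
      proof (rule nn_integral_countable_family_le[OF F(1) dF])
        fix R assume R: "R \<in> F"
        note [measurable] = FM[OF R] E(1)[OF R] G[OF subsetD[OF F(3) R]]
        have "(\<integral>\<^sup>+x\<in>R - E R. G Q x \<partial>M)
            \<le> (\<integral>\<^sup>+x. \<kappa> * (G R x * indicator (R - E R) x) + h x * indicator R x \<partial>M)"
          using ins[OF R] by (intro nn_integral_mono_AE) (auto simp: indicator_def)
        also have "\<dots> = \<kappa> * (\<integral>\<^sup>+x\<in>R - E R. G R x \<partial>M) + (\<integral>\<^sup>+x\<in>R. h x \<partial>M)"
          by (simp add: nn_integral_add nn_integral_cmult)
        also have "\<dots> \<le> \<kappa> * (B * \<beta> R) + (\<integral>\<^sup>+x\<in>R. h x \<partial>M)"
          by (intro add_right_mono mult_left_mono E(4)[OF R]) simp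
        finally show "(\<integral>\<^sup>+x\<in>R - E R. G Q x \<partial>M) \<le> \<kappa> * B * \<beta> R + (\<integral>\<^sup>+x\<in>R. h x \<partial>M)"
          by (simp add: mult.assoc)
      qed (use E(1) FM in auto)
      also have "(\<integral>\<^sup>+R. \<kappa> * B * \<beta> R + (\<integral>\<^sup>+x\<in>R. h x \<partial>M) \<partial>count_space F)
          = B * (\<kappa> * (\<integral>\<^sup>+R. \<beta> R \<partial>count_space F)) + (\<integral>\<^sup>+x\<in>\<Union>F. h x \<partial>M)"
        using nn_integral_countable_family_eq[OF F(1) dF FM h]
        by (simp add: nn_integral_add nn_integral_cmult mult_ac)
      also have "(\<integral>\<^sup>+x\<in>Q - \<Union>F. h x \<partial>M) + (B * (\<kappa> * (\<integral>\<^sup>+R. \<beta> R \<partial>count_space F)) + (\<integral>\<^sup>+x\<in>\<Union>F. h x \<partial>M))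
          = (\<integral>\<^sup>+x. h x * indicator (Q - \<Union>F) x + h x * indicator (\<Union>F) x \<partial>M)
            + B * (\<kappa> * (\<integral>\<^sup>+R. \<beta> R \<partial>count_space F))"
        by (simp add: nn_integral_add add_ac)
      also have "(\<integral>\<^sup>+x. h x * indicator (Q - \<Union>F) x + h x * indicator (\<Union>F) x \<partial>M) = (\<integral>\<^sup>+x\<in>Q. h x \<partial>M)"
        using F(4) by (intro nn_integral_cong) (auto simp: indicator_def)
      also have "(\<integral>\<^sup>+x\<in>Q. h x \<partial>M) + B * (\<kappa> * (\<integral>\<^sup>+R. \<beta> R \<partial>count_space F)) \<le> K * \<beta> Q + B * (\<theta> * \<beta> Q)"
        by (intro add_mono mult_left_mono hK \<beta>) simp
      also have "\<dots> = (K + \<theta> * B) * \<beta> Q" by (simp add: algebra_simps)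
      also have "\<dots> \<le> B * \<beta> Q" by (rule mult_right_mono[OF B]) simp
      finally show ?thesis by (simp add: add_right_mono)
    qed
    ultimately show ?case using E' by blast
  qed
  obtain E where E: "\<And>m. E m \<in> sets M" "\<And>m. E m \<subseteq> Q" "\<And>m. emeasure M (E m) \<le> emeasure M Q / 2 ^ m"
      "\<And>m. (\<integral>\<^sup>+x\<in>Q - E m. G Q x \<partial>M) \<le> B * \<beta> Q"
    using claim[OF Q] by metis
  note [measurable] = E(1) sets[OF Q] G[OF Q]
  obtain c where c: "emeasure M Q = ennreal c" "0 \<le> c"
    using fin[OF Q] by (cases "emeasure M Q") auto
  have "AE x in M. eventually (\<lambda>m. x \<notin> E m) sequentially"
  proof (rule AE_eventually_outside[OF E(1) _ c(2)])
    show "emeasure M (E m) \<le> ennreal (c / 2 ^ m)" for m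
      using E(3)[of m] c by (simp add: divide_ennreal[symmetric] ennreal_power[symmetric])
  qed
  then have "AE x in M. G Q x * indicator Q x = liminf (\<lambda>m. G Q x * indicator (Q - E m) x)"
  proof eventually_elim
    fix x assume "eventually (\<lambda>m. x \<notin> E m) sequentially"
    then have "(\<lambda>m. G Q x * indicator (Q - E m) x) \<longlonglongrightarrow> G Q x * indicator Q x"
      by (intro tendsto_eventually) (erule eventually_mono, simp add: indicator_def)
    then show "G Q x * indicator Q x = liminf (\<lambda>m. G Q x * indicator (Q - E m) x)"
      by (simp add: lim_imp_Liminf)
  qed
  then have "(\<integral>\<^sup>+x\<in>Q. G Q x \<partial>M) = (\<integral>\<^sup>+x. liminf (\<lambda>m. G Q x * indicator (Q - E m) x) \<partial>M)"
    by (rule nn_integral_cong_AE)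
  also have "\<dots> \<le> liminf (\<lambda>m. \<integral>\<^sup>+x\<in>Q - E m. G Q x \<partial>M)"
    by (rule nn_integral_liminf) simp
  also have "\<dots> \<le> liminf (\<lambda>m. B * \<beta> Q)"
    by (rule Liminf_mono) (simp add: E(4))
  also have "\<dots> = B * \<beta> Q" by (simp add: Liminf_const)
  finally show ?thesis .
qed

section \<open>Powers in the extended nonnegative reals\<close>

lemma epow_ennreal: "0 < y \<Longrightarrow> epow (ennreal y) r = ennreal (y powr r)"
  by (simp add: epow_def)

lemma ennreal_mult3:
  "0 \<le> a \<Longrightarrow> 0 \<le> b \<Longrightarrow> 0 \<le> c \<Longrightarrow> ennreal a * ennreal b * ennreal c = ennreal (a * b * c)"
  by (simp add: ennreal_mult)

lemma epow_mono:
  assumes "0 < r" "x \<le> y" shows "epow x r \<le> epow y r"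
proof (cases "x = 0 \<or> y = \<infinity>")
  case True
  then show ?thesis using assms by (auto simp: epow_def)
next
  case False
  then obtain x' y' where "x = ennreal x'" "y = ennreal y'" "0 < x'" "x' \<le> y'"
    using assms(2) by (cases x; cases y) (auto simp: less_le ennreal_le_iff top_unique)
  then show ?thesis using assms(1) by (simp add: epow_ennreal powr_mono2 ennreal_leI)
qed

lemma ennreal_le_divideI:
  assumes "ennreal c * y \<le> ennreal M" "0 < c" "0 \<le> M"
  shows "y \<le> ennreal (M / c)"
proof (cases y)
  case (real r)
  then show ?thesis using assms by (simp add: ennreal_mult[symmetric] ennreal_le_iff field_simps)
next
  case top
  then show ?thesis using assms by (simp add: ennreal_mult_top top_unique)
qed

lemma epow_le_imp:
  assumes "epow x r \<le> ennreal y" "0 < r" "0 < y"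
  shows "x \<le> ennreal (y powr (1 / r))"
proof (cases "x = 0 \<or> x = \<infinity>")
  case True
  then show ?thesis using assms by (auto simp: epow_def top_unique)
next
  case False
  then obtain x' where x: "x = ennreal x'" "0 < x'" by (cases x) (auto simp: less_le)
  then have "x' powr r \<le> y" using assms by (simp add: epow_ennreal)
  then have "(x' powr r) powr (1 / r) \<le> y powr (1 / r)" using assms by (intro powr_mono2) simp_all
  then show ?thesis using x assms by (simp add: powr_powr ennreal_leI)
qed

lemma ennreal_mult_le_iff_divide:
  assumes "0 < c" "0 \<le> M"
  shows "ennreal c * y \<le> ennreal M \<longleftrightarrow> y \<le> ennreal (M / c)"
proof
  assume "y \<le> ennreal (M / c)"
  then have "ennreal c * y \<le> ennreal c * ennreal (M / c)" by (intro mult_left_mono) simp_all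
  also have "\<dots> = ennreal M" using assms by (simp add: ennreal_mult[symmetric])
  finally show "ennreal c * y \<le> ennreal M" .
qed (use ennreal_le_divideI assms in blast)

lemma epow_le_iff:
  assumes "0 < r" "0 < y"
  shows "epow x r \<le> ennreal y \<longleftrightarrow> x \<le> ennreal (y powr (1 / r))"
proof
  assume "x \<le> ennreal (y powr (1 / r))"
  then have "epow x r \<le> epow (ennreal (y powr (1 / r))) r" by (rule epow_mono[OF assms(1)])
  also have "\<dots> = ennreal y" using assms by (simp add: epow_ennreal powr_powr)
  finally show "epow x r \<le> ennreal y" .
qed (use epow_le_imp assms in blast)

section \<open>Local A-infinity weights\<close>

lemma locally_integrable_measurable:
  fixes f :: "real ^ 'n \<Rightarrow> 'a::{banach, second_countable_topology}"
  assumes "locally_integrable f"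
  shows "f \<in> borel_measurable lebesgue"
proof (rule borel_measurable_LIMSEQ_metric)
  fix m :: nat
  show "(\<lambda>x. indicator (cball 0 (real m)) x *\<^sub>R f x) \<in> borel_measurable lebesgue"
    using assms compact_cball unfolding locally_integrable_def set_integrable_def
    by (blast intro: borel_measurable_integrable)
next
  fix x :: "real ^ 'n"
  obtain N where "norm x \<le> real N" using real_arch_simple by blast
  then have "indicator (cball 0 (real m)) x *\<^sub>R f x = f x" if "N \<le> m" for m
    using that by (simp add: indicator_def)
  then show "(\<lambda>m. indicator (cball 0 (real m)) x *\<^sub>R f x) \<longlonglongrightarrow> f x"
    by (intro tendsto_eventually eventually_sequentiallyI[of N])
qed

lemma locally_integrable_cube:
  assumes "locally_integrable f"
  shows "set_integrable lebesgue (ccube a l) f"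
  using assms by (simp add: locally_integrable_def ccube_def)

lemma locally_integrable_nn_finite:
  assumes "locally_integrable f"
  shows "(\<integral>\<^sup>+x\<in>ccube a l. ennreal (norm (f x)) \<partial>lebesgue) < \<infinity>"
proof -
  have "integrable lebesgue (\<lambda>x. indicator (ccube a l) x *\<^sub>R f x)"
    using locally_integrable_cube[OF assms] by (simp add: set_integrable_def)
  then have "(\<integral>\<^sup>+x. ennreal (norm (indicator (ccube a l) x *\<^sub>R f x)) \<partial>lebesgue) < \<infinity>"
    by (simp add: integrable_iff_bounded)
  also have "(\<integral>\<^sup>+x. ennreal (norm (indicator (ccube a l) x *\<^sub>R f x)) \<partial>lebesgue)
      = (\<integral>\<^sup>+x\<in>ccube a l. ennreal (norm (f x)) \<partial>lebesgue)"
    by (intro nn_integral_cong) (simp add: indicator_def)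
  finally show ?thesis .
qed

lemma AE_by_unit_cubes:
  fixes P :: "real ^ 'n \<Rightarrow> bool"
  assumes "\<And>a. AE x in lebesgue. x \<in> hcube a 1 \<longrightarrow> P x"
  shows "AE x in lebesgue. P x"
proof -
  have "AE x in lebesgue. \<forall>z::'n \<Rightarrow> int. x \<in> hcube (\<chi> i. of_int (z i)) 1 \<longrightarrow> P x"
    unfolding AE_all_countable using assms by blast
  then show ?thesis
  proof eventually_elim
    fix x assume *: "\<forall>z::'n \<Rightarrow> int. x \<in> hcube (\<chi> i. of_int (z i)) 1 \<longrightarrow> P x"
    have "x \<in> hcube (\<chi> i. of_int \<lfloor>x $ i\<rfloor>) 1" by (simp add: hcube_def)
    with *[rule_format, of "\<lambda>i. \<lfloor>x $ i\<rfloor>"] show "P x" by simp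
  qed
qed

lemma wmeas_ccube: "wmeas \<omega> (ccube a l) = wmeas \<omega> (hcube a l)"
  unfolding wmeas_def by (rule nn_integral_hcube_ccube[symmetric])

lemma wmeas_mono: "A \<subseteq> B \<Longrightarrow> wmeas \<omega> A \<le> wmeas \<omega> B"
  unfolding wmeas_def by (rule nn_set_integral_mono)

lemma side_le_one_of_volume: "0 < l \<Longrightarrow> l ^ CARD('n::finite) \<le> 1 \<Longrightarrow> (l::real) \<le> 1"
  using one_less_power[of l "CARD('n)"] by (meson not_le zero_less_card_finite)

locale A_inf_weight =
  fixes \<omega> :: "real ^ 'n \<Rightarrow> real"
  assumes A_inf: "\<omega> \<in> A_loc_inf"
begin

lemma weight: "weight \<omega>" and nonneg [simp]: "0 \<le> \<omega> x"
  using A_inf by (auto simp: A_loc_inf_def weight_def)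

lemma weight_measurable [measurable]: "\<omega> \<in> borel_measurable lebesgue"
  using weight locally_integrable_measurable unfolding weight_def by blast

lemma wmeas_finite: "wmeas \<omega> (hcube a l) < \<infinity>"
proof -
  have "locally_integrable \<omega>" using weight by (simp add: weight_def)
  from locally_integrable_nn_finite[OF this, of a l] show ?thesis
    unfolding wmeas_ccube[symmetric] by (simp add: wmeas_def)
qed

lemma wmeas_sub_finite: "F \<subseteq> hcube a l \<Longrightarrow> wmeas \<omega> F < \<infinity>"
  by (rule le_less_trans[OF wmeas_mono wmeas_finite])

text \<open>The defining quotients in product form. When \<open>\<omega>(F) = 0\<close> the quotient is infinite unless
  \<open>\<omega>(Q) = 0\<close>, so the product form holds in this case too.\<close>

lemma A_inf_const:
  assumes "0 < \<alpha>" "\<alpha> < 1"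
  obtains C :: real where "1 < C"
    "\<And>a l F. 0 < l \<Longrightarrow> l \<le> 1 \<Longrightarrow> F \<in> sets lebesgue \<Longrightarrow> F \<subseteq> hcube a l \<Longrightarrow>
       ennreal (\<alpha> * l ^ CARD('n)) \<le> emeasure lebesgue F \<Longrightarrow> wmeas \<omega> (hcube a l) \<le> ennreal C * wmeas \<omega> F"
proof -
  define S where "S = (SUP Q \<in> {Q \<in> cubes. emeasure lebesgue Q \<le> 1}.
           SUP F \<in> {F \<in> sets lebesgue. F \<subseteq> Q \<and> emeasure lebesgue F \<ge> ennreal \<alpha> * emeasure lebesgue Q}.
             wmeas \<omega> Q / wmeas \<omega> F)"
  have S: "S < \<infinity>" unfolding S_def using A_inf assms by (auto simp: A_loc_inf_def)
  define C where "C = enn2real S + 2"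
  have C: "1 < C" "S \<le> ennreal C"
  proof -
    have "0 \<le> enn2real S" by simp
    then show "1 < C" unfolding C_def by linarith
    have "S = ennreal (enn2real S)" using S by simp
    also have "\<dots> \<le> ennreal C" unfolding C_def by (intro ennreal_leI) simp
    finally show "S \<le> ennreal C" .
  qed
  show thesis
  proof (rule that[OF C(1)])
    fix a :: "real ^ 'n" and l F
    assume l: "0 < l" "l \<le> 1" and F: "F \<in> sets lebesgue" "F \<subseteq> hcube a l"
      "ennreal (\<alpha> * l ^ CARD('n)) \<le> emeasure lebesgue F"
    have Q: "ccube a l \<in> {Q \<in> cubes. emeasure lebesgue Q \<le> 1}"
      using l ccube_in_cubes[OF l(1)] by (simp add: emeasure_ccube power_le_one)
    have F': "F \<in> {F \<in> sets lebesgue. F \<subseteq> ccube a l \<and> emeasure lebesgue F \<ge> ennreal \<alpha> * emeasure lebesgue (ccube a l)}"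
      using F hcube_sub_ccube l assms by (auto simp: emeasure_ccube ennreal_mult)
    have "wmeas \<omega> (ccube a l) / wmeas \<omega> F \<le> S"
      unfolding S_def by (rule SUP_upper2[OF Q], rule SUP_upper[OF F'])
    then have le: "wmeas \<omega> (hcube a l) / wmeas \<omega> F \<le> ennreal C"
      using C(2) by (simp add: wmeas_ccube)
    show "wmeas \<omega> (hcube a l) \<le> ennreal C * wmeas \<omega> F"
    proof (cases "wmeas \<omega> F = 0")
      case True
      then have "wmeas \<omega> (hcube a l) = 0"
        using le by (cases "wmeas \<omega> (hcube a l) = 0") (auto simp: ennreal_divide_zero top_unique)
      then show ?thesis by simp
    next
      case False
      then have "wmeas \<omega> (hcube a l) = wmeas \<omega> (hcube a l) / wmeas \<omega> F * wmeas \<omega> F"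
        using wmeas_sub_finite[OF F(2)] by (simp add: ennreal_divide_times ennreal_mult_divide_eq)
      also have "\<dots> \<le> ennreal C * wmeas \<omega> F" by (rule mult_right_mono[OF le]) simp
      finally show ?thesis .
    qed
  qed
qed

text \<open>If one unit cube has \<open>\<omega>\<close>-mass \<open>0\<close>, so have all unit cubes overlapping it in a cube of side \<open>1/2\<close>, hence,
  moving in steps of length at most \<open>1/2\<close> in each coordinate, all unit cubes; but \<open>\<omega>\<close> is not almost everywhere \<open>0\<close>.\<close>

lemma wmeas_pos_unit: "wmeas \<omega> (hcube a 1) \<noteq> 0"
proof
  assume a: "wmeas \<omega> (hcube a 1) = 0"
  have near: "wmeas \<omega> (hcube c 1) = 0" if b: "wmeas \<omega> (hcube b 1) = 0" and bc: "\<And>i. \<bar>b $ i - c $ i\<bar> \<le> 1 / 2"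
    for b c
  proof -
    define d :: "real ^ 'n" where "d = (\<chi> i. max (b $ i) (c $ i))"
    have sub: "hcube d (1 / 2) \<subseteq> hcube b 1" "hcube d (1 / 2) \<subseteq> hcube c 1"
      using bc by (auto simp: hcube_sub_iff d_def max_def abs_le_iff) (smt (verit) field_sum_of_halves)+
    obtain C :: real where "1 < C" "\<And>a l F. 0 < l \<Longrightarrow> l \<le> 1 \<Longrightarrow> F \<in> sets lebesgue \<Longrightarrow> F \<subseteq> hcube a l \<Longrightarrow>
       ennreal ((1/2) ^ CARD('n) * l ^ CARD('n)) \<le> emeasure lebesgue F \<Longrightarrow> wmeas \<omega> (hcube a l) \<le> ennreal C * wmeas \<omega> F"
      using A_inf_const[of "(1/2) ^ CARD('n)"] by (auto simp: power_less_one_iff)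
    from this(2)[of 1 "hcube d (1/2)" c] have "wmeas \<omega> (hcube c 1) \<le> ennreal C * wmeas \<omega> (hcube d (1/2))"
      using sub by (simp add: emeasure_hcube)
    also have "wmeas \<omega> (hcube d (1/2)) = 0" using wmeas_mono[OF sub(1), of \<omega>] b by simp
    finally show ?thesis by simp
  qed
  have all: "wmeas \<omega> (hcube (a + t) 1) = 0" if "\<And>i. \<bar>t $ i\<bar> \<le> real m / 2" for m t
    using that
  proof (induction m arbitrary: t)
    case 0
    then have "t = 0" by (simp add: vec_eq_iff)
    then show ?case using a by simp
  next
    case (Suc m)
    let ?t = "(real m / real (Suc m)) *\<^sub>R t"
    have "\<bar>?t $ i\<bar> \<le> real m / 2" for i
      using mult_left_mono[OF Suc.prems[of i], of "real m / real (Suc m)"]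
      by (simp add: abs_mult divide_simps mult_ac)
    from Suc.IH[OF this] have "wmeas \<omega> (hcube (a + ?t) 1) = 0" .
    moreover have "\<bar>(a + ?t) $ i - (a + t) $ i\<bar> \<le> 1 / 2" for i
    proof -
      have "(a + ?t) $ i - (a + t) $ i = - (t $ i / real (Suc m))"
        by (simp add: field_simps)
      then have "\<bar>(a + ?t) $ i - (a + t) $ i\<bar> = \<bar>t $ i\<bar> / real (Suc m)" by (simp add: abs_divide)
      also have "\<dots> \<le> (real (Suc m) / 2) / real (Suc m)"
        by (intro divide_right_mono Suc.prems) simp
      also have "\<dots> = 1 / 2" by simp
      finally show ?thesis .
    qed
    ultimately show ?case by (rule near)
  qed
  have "AE x in lebesgue. \<omega> x = 0"
  proof (rule AE_by_unit_cubes)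
    fix b :: "real ^ 'n"
    obtain m where "norm (b - a) \<le> real m / 2" using real_arch_simple[of "2 * norm (b - a)"] by (auto simp: field_simps)
    then have "\<bar>(b - a) $ i\<bar> \<le> real m / 2" for i using component_le_norm_cart[of "b - a" i] by linarith
    from all[OF this] have "wmeas \<omega> (hcube b 1) = 0" by simp
    then have "AE x in lebesgue. ennreal (\<omega> x) * indicator (hcube b 1) x = 0"
      unfolding wmeas_def by (subst (asm) nn_integral_0_iff_AE) simp_all
    then show "AE x in lebesgue. x \<in> hcube b 1 \<longrightarrow> \<omega> x = 0"
      by eventually_elim (auto simp: indicator_def antisym)
  qed
  then show False using weight by (simp add: weight_def)
qed

lemma wmeas_pos:
  assumes "0 < l" shows "0 < wmeas \<omega> (hcube a l)"
proof (cases "l \<le> 1")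
  case True
  have "0 < l ^ CARD('n) / 2" "l ^ CARD('n) / 2 < 1"
    using assms power_le_one[of l "CARD('n)"] True by auto
  then obtain C :: real where "\<And>a b F. 0 < b \<Longrightarrow> b \<le> 1 \<Longrightarrow> F \<in> sets lebesgue \<Longrightarrow> F \<subseteq> hcube a b \<Longrightarrow>
     ennreal (l ^ CARD('n) / 2 * b ^ CARD('n)) \<le> emeasure lebesgue F \<Longrightarrow> wmeas \<omega> (hcube a b) \<le> ennreal C * wmeas \<omega> F"
    using A_inf_const by metis
  from this[of 1 "hcube a l" a] have "wmeas \<omega> (hcube a 1) \<le> ennreal C * wmeas \<omega> (hcube a l)"
    using assms True by (simp add: emeasure_hcube hcube_sub_iff ennreal_leI)
  then show ?thesis using wmeas_pos_unit[of a] by (auto simp: zero_less_iff_neq_zero)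
next
  case False
  then have "wmeas \<omega> (hcube a 1) \<le> wmeas \<omega> (hcube a l)"
    by (intro wmeas_mono) (simp add: hcube_sub_iff)
  then show ?thesis using wmeas_pos_unit[of a] by (auto simp: zero_less_iff_neq_zero)
qed

text \<open>The zero set of \<open>\<omega>\<close> in a unit cube has \<open>\<omega>\<close>-mass \<open>0\<close>. If it had positive measure, it would be
  an admissible \<open>F\<close> in the defining condition and force the cube to have \<open>\<omega>\<close>-mass \<open>0\<close>.\<close>

lemma AE_pos: "AE x in lebesgue. 0 < \<omega> x"
proof (rule AE_by_unit_cubes)
  fix b :: "real ^ 'n"
  define S where "S = {x \<in> space lebesgue. x \<in> hcube b 1 \<and> \<omega> x = 0}"
  have S[measurable]: "S \<in> sets lebesgue" unfolding S_def by measurable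
  have sub: "S \<subseteq> hcube b 1" by (auto simp: S_def)
  have S0: "wmeas \<omega> S = 0" unfolding wmeas_def
    by (subst nn_integral_0_iff_AE) (auto simp: S_def indicator_def)
  have "emeasure lebesgue S \<le> emeasure lebesgue (hcube b 1)" by (rule emeasure_mono[OF sub]) simp
  then have le: "emeasure lebesgue S \<le> 1" by (simp add: emeasure_hcube)
  then obtain v where v: "emeasure lebesgue S = ennreal v" "0 \<le> v" "v \<le> 1"
    by (cases "emeasure lebesgue S") (auto simp: top_unique)
  have "v = 0"
  proof (rule ccontr)
    assume "v \<noteq> 0"
    \<comment> \<open>halved because \<open>v\<close> may be \<open>1\<close>, and the proportion must be less than \<open>1\<close>\<close>
    then have "0 < v / 2" "v / 2 < 1" using v by auto
    then obtain C :: real where "\<And>a b F. 0 < b \<Longrightarrow> b \<le> 1 \<Longrightarrow> F \<in> sets lebesgue \<Longrightarrow> F \<subseteq> hcube a b \<Longrightarrow>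
       ennreal (v / 2 * b ^ CARD('n)) \<le> emeasure lebesgue F \<Longrightarrow> wmeas \<omega> (hcube a b) \<le> ennreal C * wmeas \<omega> F"
      using A_inf_const by metis
    from this[of 1 S b] have "wmeas \<omega> (hcube b 1) \<le> ennreal C * wmeas \<omega> S"
      using v sub by (simp add: ennreal_leI)
    then show False using wmeas_pos_unit[of b] S0 by simp
  qed
  then have "S \<in> null_sets lebesgue" using v S by (auto simp: null_sets_def)
  from AE_not_in[OF this] show "AE x in lebesgue. x \<in> hcube b 1 \<longrightarrow> 0 < \<omega> x"
    by eventually_elim (auto simp: S_def less_le)
qed

definition w :: "(real ^ 'n) set \<Rightarrow> real" where "w R = enn2real (wmeas \<omega> R)"

lemma wmeas_eq_w: "R \<subseteq> hcube a l \<Longrightarrow> wmeas \<omega> R = ennreal (w R)"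
  using wmeas_sub_finite[of R a l] by (simp add: w_def)

lemma wmeas_hcube: "wmeas \<omega> (hcube a l) = ennreal (w (hcube a l))"
  by (rule wmeas_eq_w) (rule order_refl)

lemma w_pos: "0 < l \<Longrightarrow> 0 < w (hcube a l)"
  using wmeas_pos[of l a] wmeas_finite[of a l] by (simp add: w_def enn2real_positive_iff)

lemma w_mono: "A \<subseteq> B \<Longrightarrow> B \<subseteq> hcube a l \<Longrightarrow> w A \<le> w B"
  unfolding w_def by (intro enn2real_mono wmeas_mono) (use wmeas_sub_finite in auto)

lemma doubling:
  obtains D :: real where "1 < D"
    "\<And>c r c' r'. 0 < r \<Longrightarrow> hcube c r \<subseteq> hcube c' r' \<Longrightarrow> r' \<le> 2 * r \<Longrightarrow> r' \<le> 1 \<Longrightarrow>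
       w (hcube c' r') \<le> D * w (hcube c r)"
proof -
  obtain D :: real where D: "1 < D" "\<And>a l F. 0 < l \<Longrightarrow> l \<le> 1 \<Longrightarrow> F \<in> sets lebesgue \<Longrightarrow> F \<subseteq> hcube a l \<Longrightarrow>
       ennreal ((1/2) ^ CARD('n) * l ^ CARD('n)) \<le> emeasure lebesgue F \<Longrightarrow> wmeas \<omega> (hcube a l) \<le> ennreal D * wmeas \<omega> F"
    using A_inf_const[of "(1/2) ^ CARD('n)"] by (auto simp: power_less_one_iff)
  show thesis
  proof (rule that[OF D(1)])
    fix c c' :: "real ^ 'n" and r r' assume r: "0 < r" "hcube c r \<subseteq> hcube c' r'" "r' \<le> 2 * r" "r' \<le> 1"
    have r': "0 < r'" using hcube_side_mono[OF r(1,2)] r(1) by simp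
    have "(1/2) ^ CARD('n) * r' ^ CARD('n) = (r' / 2) ^ CARD('n)" by (simp add: power_divide)
    also have "\<dots> \<le> r ^ CARD('n)" by (intro power_mono) (use r r' in auto)
    finally have "wmeas \<omega> (hcube c' r') \<le> ennreal D * wmeas \<omega> (hcube c r)"
      using r r' by (intro D(2)) (auto simp: emeasure_hcube intro: ennreal_leI)
    then have "ennreal (w (hcube c' r')) \<le> ennreal D * ennreal (w (hcube c r))"
      by (simp only: wmeas_hcube)
    also have "\<dots> = ennreal (D * w (hcube c r))" using D(1) by (simp add: ennreal_mult')
    finally show "w (hcube c' r') \<le> D * w (hcube c r)"
      using D(1) w_pos[OF r(1), of c] by (subst (asm) ennreal_le_iff) simp_all
  qed
qed

lemma half_const:
  obtains C :: real where "1 < C"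
    "\<And>a l F. 0 < l \<Longrightarrow> l \<le> 1 \<Longrightarrow> F \<in> sets lebesgue \<Longrightarrow> F \<subseteq> hcube a l \<Longrightarrow>
       ennreal (l ^ CARD('n) / 2) \<le> emeasure lebesgue F \<Longrightarrow> w (hcube a l) \<le> C * w F"
proof -
  obtain C :: real where C: "1 < C" "\<And>a l F. 0 < l \<Longrightarrow> l \<le> 1 \<Longrightarrow> F \<in> sets lebesgue \<Longrightarrow> F \<subseteq> hcube a l \<Longrightarrow>
       ennreal ((1/2) * l ^ CARD('n)) \<le> emeasure lebesgue F \<Longrightarrow> wmeas \<omega> (hcube a l) \<le> ennreal C * wmeas \<omega> F"
    using A_inf_const[of "1/2"] by auto
  show thesis
  proof (rule that[OF C(1)])
    fix a :: "real ^ 'n" and l F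
    assume *: "0 < l" "l \<le> 1" "F \<in> sets lebesgue" "F \<subseteq> hcube a l" "ennreal (l ^ CARD('n) / 2) \<le> emeasure lebesgue F"
    then have "wmeas \<omega> (hcube a l) \<le> ennreal C * wmeas \<omega> F" by (intro C(2)) simp_all
    then have "ennreal (w (hcube a l)) \<le> ennreal C * ennreal (w F)"
      by (simp only: wmeas_hcube wmeas_eq_w[OF *(4)])
    also have "\<dots> = ennreal (C * w F)" using C(1) by (simp add: ennreal_mult')
    finally show "w (hcube a l) \<le> C * w F"
      using C(1) by (subst (asm) ennreal_le_iff) (simp_all add: w_def)
  qed
qed

section \<open>Negative powers of a weight\<close>

text \<open>For \<open>r = 1 / (p - 1)\<close> this is the local \<open>A\<^sub>p\<close> condition, solved for the integral of \<open>\<omega>\<^sup>-\<^sup>r\<close>.\<close>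

definition power_bound :: "real \<Rightarrow> real \<Rightarrow> bool" where
  "power_bound r C \<longleftrightarrow> (\<forall>a l. 0 < l \<longrightarrow> l \<le> 1 \<longrightarrow> (\<integral>\<^sup>+x\<in>hcube a l. ennreal (\<omega> x powr - r) \<partial>lebesgue)
     \<le> ennreal (C * l ^ CARD('n) * (l ^ CARD('n) / w (hcube a l)) powr r))"

lemma power_boundD:
  "power_bound r C \<Longrightarrow> 0 < l \<Longrightarrow> l \<le> 1 \<Longrightarrow> (\<integral>\<^sup>+x\<in>hcube a l. ennreal (\<omega> x powr - r) \<partial>lebesgue)
     \<le> ennreal (C * l ^ CARD('n) * (l ^ CARD('n) / w (hcube a l)) powr r)"
  by (simp add: power_bound_def)

text \<open>Stop at the cells where the average of \<open>\<omega>\<close> has dropped by a factor \<open>A\<close>. They carry little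
  \<open>\<omega>\<close>-mass, hence occupy at most half of the cube, and by doubling the average cannot drop by more
  than \<open>D A\<close> in one step. So \<open>\<omega>\<^sup>-\<^sup>\<epsilon>\<close> may grow by the factor \<open>(D A)\<^sup>\<epsilon>\<close> on half of the measure; for
  small \<open>\<epsilon>\<close> the resulting geometric series converges.\<close>

lemma negative_power_bound:
  obtains \<epsilon> B :: real where "0 < \<epsilon>" "0 < B" "power_bound \<epsilon> B"
proof -
  obtain C where C: "1 < C" "\<And>a l F. 0 < l \<Longrightarrow> l \<le> 1 \<Longrightarrow> F \<in> sets lebesgue \<Longrightarrow> F \<subseteq> hcube a l \<Longrightarrow>
       ennreal (l ^ CARD('n) / 2) \<le> emeasure lebesgue F \<Longrightarrow> w (hcube a l) \<le> C * w F"
    using half_const by metis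
  obtain D where D: "1 < D" "\<And>c r c' r'. 0 < r \<Longrightarrow> hcube c r \<subseteq> hcube c' r' \<Longrightarrow> r' \<le> 2 * r \<Longrightarrow> r' \<le> 1 \<Longrightarrow>
       w (hcube c' r') \<le> D * w (hcube c r)"
    using doubling by metis
  \<comment> \<open>\<open>A > C\<close> makes the stopping cells too light to fill half of the cube\<close>
  define A where "A = 2 * C"
  have A: "1 < A" "C < A" using C by (auto simp: A_def)
  \<comment> \<open>chosen so that \<open>(D A)\<^sup>\<epsilon> = 3/2\<close>; half of this is the ratio \<open>3/4\<close> of the geometric series\<close>
  define \<epsilon> where "\<epsilon> = ln (3 / 2) / ln (D * A)"
  have DA: "1 < D * A" using D(1) A(1) by (simp add: less_1_mult)
  have \<epsilon>: "0 < \<epsilon>" using DA by (simp add: \<epsilon>_def)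
  have DA\<epsilon>: "(D * A) powr \<epsilon> = 3 / 2" using DA D(1) A(1) by (simp add: powr_def \<epsilon>_def)
  define v :: "(real ^ 'n) set \<Rightarrow> real" where "v R = measure lebesgue R" for R
  have v_hcube: "v (hcube a l) = l ^ CARD('n)" if "0 < l" for a l
    using that by (simp add: v_def measure_def emeasure_hcube)
  define \<Q> :: "(real ^ 'n) set set" where "\<Q> = {hcube a l | a l. 0 < l \<and> l \<le> 1}"
  have \<Q>D: "0 < v R \<and> 0 < w R \<and> R \<in> sets lebesgue \<and> emeasure lebesgue R = ennreal (v R) \<and> wmeas \<omega> R = ennreal (w R)"
    if "R \<in> \<Q>" for R
    using that by (auto simp: \<Q>_def v_hcube w_pos emeasure_hcube wmeas_hcube)
  define \<beta> where "\<beta> R = ennreal ((v R / w R) powr \<epsilon>) * emeasure lebesgue R" for R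
  have main: "(\<integral>\<^sup>+x\<in>Q. ennreal (\<omega> x powr - \<epsilon>) \<partial>lebesgue) \<le> ennreal (4 * A powr \<epsilon>) * \<beta> Q" if "Q \<in> \<Q>" for Q
  proof (rule iterated_stopping[where G = "\<lambda>_ x. ennreal (\<omega> x powr - \<epsilon>)" and \<Q> = \<Q> and \<kappa> = 1
        and K = "ennreal (A powr \<epsilon>)" and \<theta> = "ennreal (3 / 4)"])
    fix Q assume "Q \<in> \<Q>"
    then obtain a l where Q: "Q = hcube a l" and l: "0 < l" "l \<le> 1" unfolding \<Q>_def by blast
    note QD = \<Q>D[OF \<open>Q \<in> \<Q>\<close>]
    define bad where "bad R \<longleftrightarrow> A * w R * v Q < w Q * v R" for R
    define F where "F = stopping_cells a l bad"
    have F: "countable F" "disjoint F" "F \<subseteq> sets lebesgue" "\<Union>F \<subseteq> Q"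
      unfolding F_def Q by (rule stopping_cells_family[OF l(1)])+
    have [measurable]: "\<Union>F \<in> sets lebesgue" using F(1,3) by (intro sets.countable_Union)
    have Q_sets[measurable]: "Q \<in> sets lebesgue" by (simp add: Q)
    have dF: "disjoint_family_on (\<lambda>R. R) F"
      using F(2) by (auto simp: disjoint_family_on_def disjoint_def)
    have F\<Q>: "F \<subseteq> \<Q>"
    proof
      fix R assume R: "R \<in> F"
      then obtain c r where cr: "0 < r" "R = hcube c r" using stopping_cellsD(5)[OF l(1)] F_def by blast
      moreover have "R \<subseteq> hcube a l" using R stopping_cellsD(2)[OF l(1)] F_def by blast
      ultimately have "r \<le> l" using hcube_side_mono by blast
      then show "R \<in> \<Q>" using cr l unfolding \<Q>_def by force
    qed
    define t where "t = w Q / (A * v Q)"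
    have t: "0 < t" using QD A by (simp add: t_def)
    have vQ: "emeasure lebesgue Q = ennreal (v Q)" using QD by simp
    have badF: "w R \<le> t * v R" if "R \<in> F" for R
    proof -
      have "bad R" using that stopping_cellsD(1)[OF l(1)] F_def by blast
      then show ?thesis using QD A by (simp add: bad_def t_def field_simps)
    qed
    have small: "emeasure lebesgue (\<Union>F) \<le> emeasure lebesgue Q / 2"
    proof (rule ccontr)
      assume "\<not> ?thesis"
      then have "ennreal (l ^ CARD('n) / 2) \<le> emeasure lebesgue (\<Union>F)"
        using l by (simp add: Q emeasure_hcube divide_ennreal[symmetric] del: ennreal_divide_numeral)
      then have 1: "w Q \<le> C * w (\<Union>F)" unfolding Q using F(4) l by (intro C(2)) (auto simp: Q)
      have "wmeas \<omega> (\<Union>F) \<le> (\<integral>\<^sup>+x\<in>\<Union>F. ennreal t \<partial>lebesgue)"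
        unfolding wmeas_def
      proof (rule nn_integral_disjoint_sets_le[OF F(1-3)])
        fix R assume R: "R \<in> F"
        note RD = \<Q>D[OF subsetD[OF F\<Q> R]]
        have "wmeas \<omega> R \<le> ennreal (t * v R)" using RD badF[OF R] by (simp add: ennreal_leI)
        also have "\<dots> = (\<integral>\<^sup>+x\<in>R. ennreal t \<partial>lebesgue)"
          using RD t by (simp add: nn_integral_const_set ennreal_mult)
        finally show "(\<integral>\<^sup>+x\<in>R. ennreal (\<omega> x) \<partial>lebesgue) \<le> (\<integral>\<^sup>+x\<in>R. ennreal t \<partial>lebesgue)"
          by (simp add: wmeas_def)
      qed simp_all
      also have "\<dots> \<le> (\<integral>\<^sup>+x\<in>Q. ennreal t \<partial>lebesgue)" by (rule nn_set_integral_mono[OF F(4)])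
      also have "\<dots> = ennreal (t * v Q)"
        using QD t by (simp add: nn_integral_const_set ennreal_mult)
      finally have "w (\<Union>F) \<le> t * v Q"
        using t QD unfolding w_def by (intro enn2real_leI) simp_all
      also have "t * v Q = w Q / A" using QD by (simp add: t_def)
      finally have "C * w (\<Union>F) \<le> C * (w Q / A)" using C(1) by (intro mult_left_mono) simp_all
      also have "\<dots> < w Q" using QD A C(1) by (simp add: field_simps)
      finally show False using 1 by simp
    qed
    have not_bad_Q: "\<not> bad (hcube a l)" using A QD by (simp add: bad_def Q[symmetric])
    have out: "AE x in lebesgue. x \<in> Q - \<Union>F \<longrightarrow> ennreal t \<le> ennreal (\<omega> x)"
    proof (rule AE_le_of_cells[OF l(1)])
      show "Q - \<Union>F \<subseteq> hcube a l" by (auto simp: Q)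
      show "(\<integral>\<^sup>+x\<in>hcube a l. ennreal (\<omega> x) \<partial>lebesgue) < \<infinity>" using wmeas_finite[of a l] by (simp add: wmeas_def)
      fix x k assume x: "x \<in> Q - \<Union>F"
      then have nb: "\<not> bad (cell a l k x)" using not_bad_outside_stopping[of x a l bad k] unfolding F_def Q by simp
      obtain c where c: "cell a l k x = hcube c (l / 2 ^ k)" using cell_is_hcube[OF l(1)] by blast
      have "l / 2 ^ k \<le> 1" using l(2) by (simp add: divide_le_eq) (meson le_trans one_le_power order_trans one_le_numeral)
      then have "cell a l k x \<in> \<Q>" unfolding c \<Q>_def using l(1)
        by (intro CollectI exI[of _ c] exI[of _ "l / 2 ^ k"]) simp
      note RD = \<Q>D[OF this]
      have "t * v (cell a l k x) \<le> w (cell a l k x)"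
        using nb QD A by (simp add: bad_def t_def field_simps)
      then have "ennreal (t * v (cell a l k x)) \<le> wmeas \<omega> (cell a l k x)" using RD by (simp add: ennreal_leI)
      then show "(\<integral>\<^sup>+y\<in>cell a l k x. ennreal t \<partial>lebesgue) \<le> (\<integral>\<^sup>+y\<in>cell a l k x. ennreal (\<omega> y) \<partial>lebesgue)"
        using RD t by (simp add: nn_integral_const_set ennreal_mult wmeas_def)
    qed simp_all
    define h :: "real ^ 'n \<Rightarrow> ennreal" where "h = (\<lambda>_. ennreal (t powr - \<epsilon>))"
    have tQ: "t powr - \<epsilon> = A powr \<epsilon> * (v Q / w Q) powr \<epsilon>"
      using QD A by (simp add: t_def powr_minus powr_divide powr_mult field_simps)
    show "\<exists>F h. countable F \<and> disjoint F \<and> F \<subseteq> \<Q> \<and> \<Union>F \<subseteq> Q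
        \<and> emeasure lebesgue (\<Union>F) \<le> emeasure lebesgue Q / 2 \<and> h \<in> borel_measurable lebesgue
        \<and> (AE x in lebesgue. x \<in> Q - \<Union>F \<longrightarrow> ennreal (\<omega> x powr - \<epsilon>) \<le> h x)
        \<and> (\<forall>R\<in>F. AE x in lebesgue. x \<in> R \<longrightarrow> ennreal (\<omega> x powr - \<epsilon>) \<le> 1 * ennreal (\<omega> x powr - \<epsilon>) + h x)
        \<and> (\<integral>\<^sup>+x\<in>Q. h x \<partial>lebesgue) \<le> ennreal (A powr \<epsilon>) * \<beta> Q
        \<and> 1 * (\<integral>\<^sup>+R. \<beta> R \<partial>count_space F) \<le> ennreal (3 / 4) * \<beta> Q"
    proof (intro exI[of _ F] exI[of _ h] conjI F(1,2,4) F\<Q> small ballI)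
      show "AE x in lebesgue. x \<in> Q - \<Union>F \<longrightarrow> ennreal (\<omega> x powr - \<epsilon>) \<le> h x"
        using out
      proof eventually_elim
        fix x assume *: "x \<in> Q - \<Union>F \<longrightarrow> ennreal t \<le> ennreal (\<omega> x)"
        show "x \<in> Q - \<Union>F \<longrightarrow> ennreal (\<omega> x powr - \<epsilon>) \<le> h x"
        proof
          assume "x \<in> Q - \<Union>F"
          then have "t \<le> \<omega> x" using * by simp
          then show "ennreal (\<omega> x powr - \<epsilon>) \<le> h x"
            using t \<epsilon> unfolding h_def by (intro ennreal_leI powr_mono2') auto
        qed
      qed
      show "(\<integral>\<^sup>+x\<in>Q. h x \<partial>lebesgue) \<le> ennreal (A powr \<epsilon>) * \<beta> Q"
        unfolding h_def tQ \<beta>_def using Q_sets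
        by (subst nn_integral_const_set) (simp_all add: ennreal_mult mult.assoc)
      have "(\<integral>\<^sup>+R. \<beta> R \<partial>count_space F)
          \<le> (\<integral>\<^sup>+R. ennreal ((D * A * v Q / w Q) powr \<epsilon>) * emeasure lebesgue R \<partial>count_space F)"
      proof (rule nn_integral_mono)
        fix R assume "R \<in> space (count_space F)"
        then have R: "R \<in> F" by simp
        note RD = \<Q>D[OF subsetD[OF F\<Q> R]]
        obtain c r c' where P: "0 < r" "R = hcube c r" "hcube c r \<subseteq> hcube c' (2 * r)" "hcube c' (2 * r) \<subseteq> hcube a l"
          "\<not> bad (hcube c' (2 * r))"
          using stopping_cells_parent[OF l(1) R[unfolded F_def] not_bad_Q] by blast
        have "2 * r \<le> l" using hcube_side_mono[OF _ P(4)] P(1) by simp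
        then have "w (hcube c' (2 * r)) \<le> D * w R" using P l by (auto intro: D(2))
        moreover have "v R \<le> v (hcube c' (2 * r))" using P by (simp add: v_hcube power_mono)
        moreover have "w Q * v (hcube c' (2 * r)) \<le> A * w (hcube c' (2 * r)) * v Q"
          using P(5) by (simp add: bad_def)
        ultimately have "w Q * v R \<le> A * (D * w R) * v Q"
          using A QD by (smt (verit) mult_left_mono mult_right_mono)
        then have "v R / w R \<le> D * A * v Q / w Q" using QD RD by (simp add: field_simps)
        then show "\<beta> R \<le> ennreal ((D * A * v Q / w Q) powr \<epsilon>) * emeasure lebesgue R"
          unfolding \<beta>_def using \<epsilon> RD by (intro mult_right_mono ennreal_leI powr_mono2) auto
      qed
      also have "\<dots> = ennreal ((D * A * v Q / w Q) powr \<epsilon>) * emeasure lebesgue (\<Union>F)"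
        using emeasure_UN_countable[where X = "\<lambda>R. R" and M = lebesgue, OF _ F(1) dF] F(3)
        by (simp add: nn_integral_cmult subset_iff)
      also have "\<dots> \<le> ennreal ((D * A * v Q / w Q) powr \<epsilon>) * (emeasure lebesgue Q / 2)"
        by (intro mult_left_mono small) simp
      also have "(D * A * v Q / w Q) powr \<epsilon> = (D * A) powr \<epsilon> * (v Q / w Q) powr \<epsilon>"
        using D(1) A(1) QD powr_mult[of "D * A" "v Q / w Q" \<epsilon>] by simp
      also have "ennreal ((D * A) powr \<epsilon> * (v Q / w Q) powr \<epsilon>) * (emeasure lebesgue Q / 2) = ennreal (3 / 4) * \<beta> Q"
      proof -
        define X where "X = (v Q / w Q) powr \<epsilon>"
        have X: "0 \<le> X" "0 \<le> v Q" using QD by (simp_all add: X_def)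
        have "emeasure lebesgue Q / 2 = ennreal (v Q / 2)" using X by (simp add: vQ ennreal_divide_numeral)
        then have "ennreal (3 / 2 * X) * (emeasure lebesgue Q / 2) = ennreal (3 / 2 * X * (v Q / 2))"
          using ennreal_mult[of "3 / 2 * X" "v Q / 2"] X by simp
        also have "3 / 2 * X * (v Q / 2) = 3 / 4 * (X * v Q)" by simp
        also have "ennreal (3 / 4 * (X * v Q)) = ennreal (3 / 4) * (ennreal X * ennreal (v Q))"
          using ennreal_mult[of "3 / 4" "X * v Q"] ennreal_mult[of X "v Q"] X by simp
        finally show ?thesis unfolding DA\<epsilon> \<beta>_def vQ X_def by simp
      qed
      finally show "1 * (\<integral>\<^sup>+R. \<beta> R \<partial>count_space F) \<le> ennreal (3 / 4) * \<beta> Q" by simp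
    qed (auto simp: h_def)
  next
    have "A powr \<epsilon> + 3 / 4 * (4 * A powr \<epsilon>) \<le> 4 * A powr \<epsilon>" by simp
    then show "ennreal (A powr \<epsilon>) + ennreal (3 / 4) * ennreal (4 * A powr \<epsilon>) \<le> ennreal (4 * A powr \<epsilon>)"
      by (simp add: ennreal_mult[symmetric] ennreal_plus[symmetric] del: ennreal_plus)
  qed (use \<Q>D that in auto)
  show thesis
  proof (rule that[of \<epsilon> "4 * A powr \<epsilon>"])
    show "power_bound \<epsilon> (4 * A powr \<epsilon>)"
      unfolding power_bound_def
    proof (intro allI impI)
      fix a :: "real ^ 'n" and l :: real assume l: "0 < l" "l \<le> 1"
      then have Q: "hcube a l \<in> \<Q>" unfolding \<Q>_def by blast
      show "(\<integral>\<^sup>+x\<in>hcube a l. ennreal (\<omega> x powr - \<epsilon>) \<partial>lebesgue)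
         \<le> ennreal (4 * A powr \<epsilon> * l ^ CARD('n) * (l ^ CARD('n) / w (hcube a l)) powr \<epsilon>)"
        using main[OF Q] l by (simp add: \<beta>_def v_hcube emeasure_hcube ennreal_mult mult_ac)
    qed
  qed (use \<epsilon> A in auto)
qed

section \<open>The Muckenhoupt conditions\<close>

lemma AE_epow_weight: "AE x in lebesgue. epow (ennreal (\<omega> x)) r = ennreal (\<omega> x powr r)"
  using AE_pos by eventually_elim (simp add: epow_ennreal)

lemma epow_weight_set_integral:
  "(\<integral>\<^sup>+x\<in>E. epow (ennreal (\<omega> x)) r \<partial>lebesgue) = (\<integral>\<^sup>+x\<in>E. ennreal (\<omega> x powr r) \<partial>lebesgue)"
proof (rule nn_integral_cong_AE)
  show "AE x in lebesgue. epow (ennreal (\<omega> x)) r * indicator E x = ennreal (\<omega> x powr r) * indicator E x"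
    using AE_epow_weight[of r] by eventually_elim (simp only:)
qed

text \<open>Thus the critical index is the infimum of a nonempty set. The exponent is determined by
  \<open>1 / (p - 1) = \<epsilon>\<close>.\<close>

lemma exists_A_loc: "\<exists>p\<ge>1. \<omega> \<in> A_loc p"
proof -
  obtain \<epsilon> B :: real where \<epsilon>: "0 < \<epsilon>" "0 < B" and bound: "power_bound \<epsilon> B"
    using negative_power_bound by metis
  define p where "p = 1 + 1 / \<epsilon>"
  have p1: "1 < p" "p - 1 = 1 / \<epsilon>" using \<epsilon> by (simp_all add: p_def)
  then have p: "p > 1" "p \<noteq> 1" "- conj_exp p / p = - \<epsilon>" "p / conj_exp p = 1 / \<epsilon>"
    using \<epsilon> unfolding conj_exp_def p1(2) by simp_all
  have "(SUP Q \<in> {Q \<in> cubes. emeasure lebesgue Q \<le> 1}.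
           epow (emeasure lebesgue Q) (- p) * wmeas \<omega> Q
           * epow (\<integral>\<^sup>+x\<in>Q. epow (ennreal (\<omega> x)) (- conj_exp p / p) \<partial>lebesgue) (p / conj_exp p))
     \<le> ennreal (B powr (1 / \<epsilon>))"
  proof (rule SUP_least)
    fix Q :: "(real ^ 'n) set" assume "Q \<in> {Q \<in> cubes. emeasure lebesgue Q \<le> 1}"
    then obtain a l where Q: "Q = ccube a l" "0 < l" and le: "emeasure lebesgue Q \<le> 1"
      by (auto simp: cubes_eq)
    define v where "v = l ^ CARD('n)"
    define y where "y = w (hcube a l)"
    have vy: "0 < v" "0 < y" using Q(2) w_pos[OF Q(2)] by (simp_all add: v_def y_def)
    have eQ: "emeasure lebesgue Q = ennreal v" using Q by (simp add: emeasure_ccube v_def)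
    have l1: "l \<le> 1" using le Q(2) side_le_one_of_volume[OF Q(2), where 'n = 'n] by (simp add: eQ v_def)
    have "(\<integral>\<^sup>+x\<in>Q. epow (ennreal (\<omega> x)) (- \<epsilon>) \<partial>lebesgue) \<le> ennreal (B * v * (v / y) powr \<epsilon>)"
      unfolding epow_weight_set_integral Q(1) nn_integral_hcube_ccube[symmetric] v_def y_def
      by (rule power_boundD[OF bound Q(2) l1])
    from epow_mono[OF _ this, of "1 / \<epsilon>"]
    have "epow (\<integral>\<^sup>+x\<in>Q. epow (ennreal (\<omega> x)) (- \<epsilon>) \<partial>lebesgue) (1 / \<epsilon>) \<le> ennreal ((B * v * (v / y) powr \<epsilon>) powr (1 / \<epsilon>))"
      using \<epsilon> vy by (simp add: epow_ennreal)
    also have "(B * v * (v / y) powr \<epsilon>) powr (1 / \<epsilon>) = B powr (1 / \<epsilon>) * v powr (1 / \<epsilon>) * (v / y)"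
      using \<epsilon> vy by (simp add: powr_mult powr_powr)
    finally have "epow (emeasure lebesgue Q) (- p) * wmeas \<omega> Q * epow (\<integral>\<^sup>+x\<in>Q. epow (ennreal (\<omega> x)) (- \<epsilon>) \<partial>lebesgue) (1 / \<epsilon>)
       \<le> ennreal (v powr (- p)) * ennreal y * ennreal (B powr (1 / \<epsilon>) * v powr (1 / \<epsilon>) * (v / y))"
      using vy unfolding eQ by (intro mult_mono) (simp_all add: epow_ennreal Q(1) wmeas_ccube wmeas_hcube y_def)
    also have "\<dots> = ennreal (v powr (- p) * y * (B powr (1 / \<epsilon>) * v powr (1 / \<epsilon>) * (v / y)))"
      using vy by (intro ennreal_mult3) simp_all
    also have "v powr (- p) * y * (B powr (1 / \<epsilon>) * v powr (1 / \<epsilon>) * (v / y))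
        = B powr (1 / \<epsilon>) * (v powr (- p) * v powr (1 / \<epsilon>) * v powr 1)"
      using vy by simp
    also have "v powr (- p) * v powr (1 / \<epsilon>) * v powr 1 = 1"
      using vy by (simp add: powr_add[symmetric] p_def)
    finally show "epow (emeasure lebesgue Q) (- p) * wmeas \<omega> Q
           * epow (\<integral>\<^sup>+x\<in>Q. epow (ennreal (\<omega> x)) (- conj_exp p / p) \<partial>lebesgue) (p / conj_exp p)
        \<le> ennreal (B powr (1 / \<epsilon>))" unfolding p by simp
  qed
  also have "\<dots> < \<infinity>" by simp
  finally have "\<omega> \<in> A_loc p" unfolding A_loc_def using p(2) weight by simp
  then show ?thesis using p(1) by (intro exI[of _ p]) simp
qed

text \<open>With \<open>b\<close> the bound \<open>M |Q| / \<omega>(Q)\<close> that the \<open>A\<^sub>p\<close> condition puts on the \<open>r\<close>-mean of \<open>\<omega>\<^sup>-\<^sup>1\<close>, the exponent is lowered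
  from \<open>r = 1 / (p - 1)\<close> to \<open>q - 1 < r\<close> by \<open>z\<^sup>q\<^sup>-\<^sup>1 \<le> 1 + z\<^sup>r\<close> for \<open>z = 1 / (b \<omega>)\<close>. For \<open>p = 1\<close> the bound
  on \<open>\<omega>\<^sup>-\<^sup>1\<close> is pointwise.\<close>

lemma dual_weight_bound:
  assumes q: "1 < q" and p: "1 \<le> p" "p < q / (q - 1)" and A: "\<omega> \<in> A_loc p"
  obtains C :: real where "0 < C" "power_bound (q - 1) C"
proof (cases "p = 1")
  case True
  define S where "S = (SUP Q \<in> {Q \<in> cubes. emeasure lebesgue Q \<le> 1}.
           wmeas \<omega> Q / emeasure lebesgue Q
           * esssup (lebesgue_on Q) (\<lambda>x. inverse (ennreal (\<omega> x))))"
  have S: "S < \<infinity>" using A True unfolding A_loc_def S_def by simp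
  define M where "M = enn2real S + 1"
  have M: "0 < M" "S \<le> ennreal M"
    using S by (auto simp: M_def add_nonneg_pos ennreal_plus simp del: ennreal_plus_if)
  show thesis
  proof (rule that[of "M powr (q - 1)"])
    show "power_bound (q - 1) (M powr (q - 1))"
      unfolding power_bound_def minus_diff_eq
    proof (intro allI impI)
    fix a :: "real ^ 'n" and l :: real assume l: "0 < l" "l \<le> 1"
    define v where "v = l ^ CARD('n)"
    define y where "y = w (hcube a l)"
    have vy: "0 < v" "0 < y" using l(1) w_pos[OF l(1)] by (simp_all add: v_def y_def)
    have eQ: "emeasure lebesgue (ccube a l) = ennreal v" using l by (simp add: emeasure_ccube v_def)
    have Q: "ccube a l \<in> {Q \<in> cubes. emeasure lebesgue Q \<le> 1}"
      using l ccube_in_cubes[OF l(1)] by (simp add: emeasure_ccube power_le_one)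
    define e where "e = esssup (lebesgue_on (ccube a l)) (\<lambda>x. inverse (ennreal (\<omega> x)))"
    have "wmeas \<omega> (ccube a l) / emeasure lebesgue (ccube a l) * e \<le> S"
      unfolding S_def e_def by (rule SUP_upper[OF Q])
    then have "ennreal (y / v) * e \<le> ennreal M"
      using M(2) vy by (simp add: wmeas_ccube wmeas_hcube eQ y_def[symmetric] divide_ennreal)
    then have e: "e \<le> ennreal (M / (y / v))" using M vy by (intro ennreal_le_divideI) simp_all
    have "AE x in lebesgue_on (ccube a l). inverse (ennreal (\<omega> x)) \<le> e"
      unfolding e_def by (rule esssup_AE)
    then have "AE x in lebesgue. x \<in> ccube a l \<longrightarrow> inverse (ennreal (\<omega> x)) \<le> e"
      by (subst (asm) AE_restrict_space_iff) simp_all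
    then have "AE x in lebesgue. x \<in> hcube a l \<longrightarrow> ennreal (\<omega> x powr (1 - q)) \<le> ennreal ((M * (v / y)) powr (q - 1))"
      using AE_pos
    proof eventually_elim
      fix x assume *: "x \<in> ccube a l \<longrightarrow> inverse (ennreal (\<omega> x)) \<le> e" "0 < \<omega> x"
      show "x \<in> hcube a l \<longrightarrow> ennreal (\<omega> x powr (1 - q)) \<le> ennreal ((M * (v / y)) powr (q - 1))"
      proof
        assume "x \<in> hcube a l"
        then have "inverse (ennreal (\<omega> x)) \<le> ennreal (M / (y / v))"
          using *(1) e hcube_sub_ccube by (meson order_trans subsetD)
        then have "inverse (\<omega> x) \<le> M * (v / y)" using *(2) M vy by (simp add: inverse_ennreal)
        then have "inverse (\<omega> x) powr (q - 1) \<le> (M * (v / y)) powr (q - 1)"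
          using *(2) q by (intro powr_mono2) simp_all
        also have "inverse (\<omega> x) powr (q - 1) = \<omega> x powr (1 - q)"
          using *(2) by (simp add: powr_minus[symmetric] inverse_powr)
        finally show "ennreal (\<omega> x powr (1 - q)) \<le> ennreal ((M * (v / y)) powr (q - 1))" by (rule ennreal_leI)
      qed
    qed
    then have "(\<integral>\<^sup>+x\<in>hcube a l. ennreal (\<omega> x powr (1 - q)) \<partial>lebesgue)
        \<le> (\<integral>\<^sup>+x\<in>hcube a l. ennreal ((M * (v / y)) powr (q - 1)) \<partial>lebesgue)"
      by (rule nn_set_integral_mono_AE)
    also have "\<dots> = ennreal (M powr (q - 1) * v * (v / y) powr (q - 1))"
      using l vy M powr_mult[of M "v / y" "q - 1"]
      by (subst nn_integral_const_set) (simp_all add: emeasure_hcube v_def[symmetric] ennreal_mult[symmetric] mult_ac)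
    finally show "(\<integral>\<^sup>+x\<in>hcube a l. ennreal (\<omega> x powr (1 - q)) \<partial>lebesgue)
       \<le> ennreal (M powr (q - 1) * l ^ CARD('n) * (l ^ CARD('n) / w (hcube a l)) powr (q - 1))"
      by (simp only: v_def y_def)
    qed
  qed (use M in simp)
next
  case False
  then have p1: "1 < p" using p by simp
  define r where "r = 1 / (p - 1)"
  have r: "0 < r" "- conj_exp p / p = - r" "p / conj_exp p = p - 1" "1 / (p - 1) = r" "p * r = 1 + r"
    using p1 by (auto simp: r_def conj_exp_def field_simps)
  have rq: "q - 1 < r" using p(2) p1 q by (simp add: r_def field_simps)
  define S where "S = (SUP Q \<in> {Q \<in> cubes. emeasure lebesgue Q \<le> 1}.
           epow (emeasure lebesgue Q) (- p) * wmeas \<omega> Q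
           * epow (\<integral>\<^sup>+x\<in>Q. epow (ennreal (\<omega> x)) (- conj_exp p / p) \<partial>lebesgue) (p / conj_exp p))"
  have S: "S < \<infinity>" using A False unfolding A_loc_def S_def by simp
  define M where "M = enn2real S + 1"
  have M: "0 < M" "S \<le> ennreal M"
    using S by (auto simp: M_def add_nonneg_pos ennreal_plus simp del: ennreal_plus_if)
  show thesis
  proof (rule that[of "2 * M powr (q - 1)"])
    show "power_bound (q - 1) (2 * M powr (q - 1))"
      unfolding power_bound_def minus_diff_eq
    proof (intro allI impI)
    fix a :: "real ^ 'n" and l :: real assume l: "0 < l" "l \<le> 1"
    define v where "v = l ^ CARD('n)"
    define y where "y = w (hcube a l)"
    have vy: "0 < v" "0 < y" using l(1) w_pos[OF l(1)] by (simp_all add: v_def y_def)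
    have eQ: "emeasure lebesgue (ccube a l) = ennreal v" using l by (simp add: emeasure_ccube v_def)
    have Q: "ccube a l \<in> {Q \<in> cubes. emeasure lebesgue Q \<le> 1}"
      using l ccube_in_cubes[OF l(1)] by (simp add: emeasure_ccube power_le_one)
    define X where "X = (\<integral>\<^sup>+x\<in>hcube a l. ennreal (\<omega> x powr - r) \<partial>lebesgue)"
    have "epow (emeasure lebesgue (ccube a l)) (- p) * wmeas \<omega> (ccube a l)
           * epow (\<integral>\<^sup>+x\<in>ccube a l. epow (ennreal (\<omega> x)) (- conj_exp p / p) \<partial>lebesgue) (p / conj_exp p) \<le> S"
      unfolding S_def by (rule SUP_upper[OF Q])
    then have "ennreal (v powr - p * y) * epow X (p - 1) \<le> ennreal M"
      using M(2) vy unfolding r eQ epow_weight_set_integral nn_integral_hcube_ccube[symmetric] X_def[symmetric]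
      by (simp add: wmeas_ccube wmeas_hcube y_def[symmetric] epow_ennreal ennreal_mult)
    then have "epow X (p - 1) \<le> ennreal (M / (v powr - p * y))" using M vy by (intro ennreal_le_divideI) simp_all
    then have "X \<le> ennreal ((M / (v powr - p * y)) powr r)"
      using epow_le_imp[of X "p - 1"] p1 M vy r(4) by simp
    also have "(M / (v powr - p * y)) powr r = (M / y) powr r * v powr (1 + r)"
      using M vy by (simp add: r(5)[symmetric] powr_divide powr_mult powr_powr powr_minus field_simps)
    also have "\<dots> = v * (M * (v / y)) powr r"
      using M vy by (simp add: powr_add powr_divide powr_mult)
    finally have X: "X \<le> ennreal (v * (M * (v / y)) powr r)" .
    define b where "b = M * (v / y)"
    have b: "0 < b" using M vy by (simp add: b_def)
    have pt: "\<omega> x powr (1 - q) \<le> b powr (q - 1) + b powr (q - 1) * b powr - r * \<omega> x powr - r" if "0 < \<omega> x" for x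
    proof (cases "1 \<le> \<omega> x * b")
      case True
      then have "inverse (\<omega> x) \<le> b" using that by (simp add: field_simps)
      then have "inverse (\<omega> x) powr (q - 1) \<le> b powr (q - 1)" using that q by (intro powr_mono2) simp_all
      then have "\<omega> x powr (1 - q) \<le> b powr (q - 1)" using that by (simp add: powr_minus[symmetric] inverse_powr)
      then show ?thesis by (smt (verit) mult_nonneg_nonneg powr_ge_zero)
    next
      case False
      have "\<omega> x powr (1 - q) = b powr (q - 1) * (\<omega> x * b) powr (1 - q)"
        using that b by (simp add: powr_mult powr_add[symmetric])
      also have "\<dots> \<le> b powr (q - 1) * (\<omega> x * b) powr - r"
        using False that b rq by (intro mult_left_mono powr_mono') auto
      also have "\<dots> = b powr (q - 1) * b powr - r * \<omega> x powr - r" using that b by (simp add: powr_mult)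
      finally show ?thesis by (smt (verit) powr_ge_zero)
    qed
    have "(\<integral>\<^sup>+x\<in>hcube a l. ennreal (\<omega> x powr (1 - q)) \<partial>lebesgue)
        \<le> (\<integral>\<^sup>+x. ennreal (b powr (q - 1)) * indicator (hcube a l) x
             + ennreal (b powr (q - 1) * b powr - r) * (ennreal (\<omega> x powr - r) * indicator (hcube a l) x) \<partial>lebesgue)"
    proof (rule nn_integral_mono_AE)
      show "AE x in lebesgue. ennreal (\<omega> x powr (1 - q)) * indicator (hcube a l) x
         \<le> ennreal (b powr (q - 1)) * indicator (hcube a l) x
             + ennreal (b powr (q - 1) * b powr - r) * (ennreal (\<omega> x powr - r) * indicator (hcube a l) x)"
        using AE_pos
      proof eventually_elim
        fix x assume "0 < \<omega> x"
        from ennreal_leI[OF pt[OF this]]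
        show "ennreal (\<omega> x powr (1 - q)) * indicator (hcube a l) x
         \<le> ennreal (b powr (q - 1)) * indicator (hcube a l) x
             + ennreal (b powr (q - 1) * b powr - r) * (ennreal (\<omega> x powr - r) * indicator (hcube a l) x)"
          by (simp add: indicator_def ennreal_mult ennreal_plus)
      qed
    qed
    also have "\<dots> = ennreal (b powr (q - 1)) * ennreal v + ennreal (b powr (q - 1) * b powr - r) * X"
      using l by (simp add: nn_integral_add nn_integral_cmult X_def emeasure_hcube v_def[symmetric])
    also have "\<dots> \<le> ennreal (b powr (q - 1)) * ennreal v + ennreal (b powr (q - 1) * b powr - r) * ennreal (v * b powr r)"
      unfolding b_def by (intro add_left_mono mult_left_mono X) simp
    also have "\<dots> = ennreal (b powr (q - 1) * v + b powr (q - 1) * b powr - r * (v * b powr r))"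
      using vy by (simp add: ennreal_mult[symmetric] ennreal_plus[symmetric] del: ennreal_plus)
    also have "b powr (q - 1) * v + b powr (q - 1) * b powr - r * (v * b powr r) = 2 * M powr (q - 1) * v * (v / y) powr (q - 1)"
    proof -
      have "b powr - r * b powr r = 1" using b by (simp add: powr_add[symmetric])
      then have "b powr (q - 1) * b powr - r * (v * b powr r) = b powr (q - 1) * v" by (simp add: mult_ac)
      then show ?thesis using M vy by (simp add: b_def powr_mult powr_divide)
    qed
    finally show "(\<integral>\<^sup>+x\<in>hcube a l. ennreal (\<omega> x powr (1 - q)) \<partial>lebesgue)
       \<le> ennreal (2 * M powr (q - 1) * l ^ CARD('n) * (l ^ CARD('n) / w (hcube a l)) powr (q - 1))"
      by (simp only: v_def y_def)
    qed
  qed (use M in simp)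
qed

text \<open>\<open>q\<close> is below the exponent conjugate to the critical index iff the critical index is below
  \<open>q / (q - 1)\<close>, so some \<open>p < q / (q - 1)\<close> is available.\<close>

lemma dual_weight_bound_below_crit:
  assumes q: "1 < q" "ereal q < crit_conj \<omega>"
  obtains C :: real where "0 < C" "power_bound (q - 1) C"
proof -
  define S where "S = {p. 1 \<le> p \<and> \<omega> \<in> A_loc p}"
  have S: "S \<noteq> {}" "bdd_below S" using exists_A_loc by (auto simp: S_def bdd_below_def)
  have c1: "1 \<le> crit_index \<omega>" unfolding crit_index_def S_def[symmetric]
    by (rule cInf_greatest[OF S(1)]) (simp add: S_def)
  have "crit_index \<omega> < q / (q - 1)"
  proof (cases "crit_index \<omega> = 1")
    case False
    then have "q < crit_index \<omega> / (crit_index \<omega> - 1)" using q(2) by (simp add: crit_conj_def)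
    then show ?thesis using False c1 q(1) by (simp add: field_simps)
  qed (use q in \<open>simp add: field_simps\<close>)
  then obtain p where "p \<in> S" "p < q / (q - 1)"
    unfolding crit_index_def S_def[symmetric] using cInf_less_iff[OF S] by blast
  then show thesis using dual_weight_bound[OF q(1)] that unfolding S_def by (metis mem_Collect_eq)
qed

end

section \<open>Polynomials on cubes\<close>

lemma finite_multi_indices [simp]: "finite (multi_indices s :: ('n::finite \<Rightarrow> nat) set)"
proof (rule finite_subset)
  show "multi_indices s \<subseteq> (PiE UNIV (\<lambda>_. {..s}) :: ('n \<Rightarrow> nat) set)"
  proof
    fix \<theta> :: "'n \<Rightarrow> nat" assume "\<theta> \<in> multi_indices s"
    then have "\<theta> i \<le> s" for i
      using member_le_sum[of i UNIV \<theta>] by (simp add: multi_indices_def)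
    then show "\<theta> \<in> PiE UNIV (\<lambda>_. {..s})" by (simp add: PiE_def Pi_def)
  qed
qed (simp add: finite_PiE)

lemma continuous_mpow [continuous_intros]: "continuous_on A (\<lambda>x::real ^ 'n. mpow x \<theta>)"
  unfolding mpow_def by (intro continuous_intros)

lemma polys_continuous: "P \<in> polys s \<Longrightarrow> continuous_on A P"
  unfolding polys_def by (auto intro!: continuous_intros)

lemma polys_diff: "P \<in> polys s \<Longrightarrow> R \<in> polys s \<Longrightarrow> (\<lambda>x. P x - R x) \<in> polys s"
proof -
  assume "P \<in> polys s" "R \<in> polys s"
  then obtain c d where "P = (\<lambda>x. \<Sum>\<theta>\<in>multi_indices s. mpow x \<theta> *\<^sub>R c \<theta>)"
    "R = (\<lambda>x. \<Sum>\<theta>\<in>multi_indices s. mpow x \<theta> *\<^sub>R d \<theta>)" unfolding polys_def by blast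
  then have "(\<lambda>x. P x - R x) = (\<lambda>x. \<Sum>\<theta>\<in>multi_indices s. mpow x \<theta> *\<^sub>R (c \<theta> - d \<theta>))"
    by (simp add: sum_subtractf scaleR_diff_right)
  then show ?thesis unfolding polys_def by (intro CollectI exI[of _ "\<lambda>\<theta>. c \<theta> - d \<theta>"]) simp
qed

lemma polys_zero: "(\<lambda>x. 0) \<in> polys s"
  unfolding polys_def by (intro CollectI exI[of _ "\<lambda>_. 0"]) simp

subsection \<open>Interpolation\<close>

definition lagrange_basis :: "nat \<Rightarrow> (nat \<Rightarrow> real) \<Rightarrow> nat \<Rightarrow> real \<Rightarrow> real" where
  "lagrange_basis s y j x = (\<Prod>m\<in>{..s} - {j}. (x - y m) / (y j - y m))"

text \<open>The interpolating polynomial and \<open>x\<^sup>t\<close> have degree at most \<open>s\<close> and agree at \<open>s + 1\<close> points.\<close>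

lemma lagrange_monomial:
  assumes inj: "inj_on y {..s}" and t: "t \<le> s"
  shows "(\<Sum>j\<le>s. lagrange_basis s y j x * y j ^ t) = x ^ t"
proof -
  define L where "L j = (\<Prod>m\<in>{..s} - {j}. [:- y m / (y j - y m), 1 / (y j - y m):])" for j
  have poly_L: "poly (L j) z = lagrange_basis s y j z" for j z
    by (simp add: L_def lagrange_basis_def poly_prod diff_divide_distrib add_divide_distrib)
  have deg_L: "degree (L j) \<le> s" if "j \<le> s" for j
  proof -
    have "degree (L j) \<le> (\<Sum>m\<in>{..s} - {j}. degree [:- y m / (y j - y m), 1 / (y j - y m):])"
      unfolding L_def by (rule degree_prod_sum_le[unfolded o_def]) simp
    also have "\<dots> \<le> (\<Sum>m\<in>{..s} - {j}. 1)" by (intro sum_mono) simp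
    also have "\<dots> = s" using that by simp
    finally show ?thesis .
  qed
  have L_node: "lagrange_basis s y j (y k) = (if j = k then 1 else 0)" if "j \<le> s" "k \<le> s" for j k
  proof (cases "j = k")
    case True
    then have "(y k - y m) / (y j - y m) = 1" if "m \<in> {..s} - {j}" for m
      using that \<open>j \<le> s\<close> inj by (auto simp: inj_on_def)
    then show ?thesis unfolding lagrange_basis_def using True by simp
  next
    case False
    then have "k \<in> {..s} - {j}" using that by auto
    then have "lagrange_basis s y j (y k) = 0" unfolding lagrange_basis_def by (intro prod_zero) auto
    then show ?thesis using False by simp
  qed
  define p where "p = (\<Sum>j\<le>s. smult (y j ^ t) (L j))"
  have "p = monom 1 t"
  proof (rule poly_eqI_degree)
    show "poly p z = poly (monom 1 t) z" if z: "z \<in> y ` {..s}" for z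
    proof -
      obtain k where k: "k \<le> s" "z = y k" using z by auto
      have "poly p z = (\<Sum>j\<le>s. y j ^ t * (if j = k then 1 else 0))"
        unfolding p_def poly_sum poly_smult poly_L k(2) using L_node[OF _ k(1)] by (intro sum.cong) auto
      also have "\<dots> = y k ^ t" using k(1) by (simp add: if_distrib[of "(*) _"] cong: if_cong)
      finally show ?thesis by (simp add: k(2) poly_monom)
    qed
    have card: "card (y ` {..s}) = Suc s" using inj by (simp add: card_image)
    have "degree p \<le> s" unfolding p_def
    proof (rule degree_sum_le)
      show "degree (smult (y j ^ t) (L j)) \<le> s" if "j \<in> {..s}" for j
        using that by (intro order_trans[OF degree_smult_le deg_L]) simp
    qed simp
    then show "degree p < card (y ` {..s})" by (simp add: card)
    show "degree (monom 1 t :: real poly) < card (y ` {..s})" using t by (simp add: card degree_monom_eq)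
  qed
  then have "poly p x = x ^ t" by (simp add: poly_monom)
  then show ?thesis by (simp add: p_def poly_sum poly_L mult.commute)
qed

text \<open>A polynomial of total degree at most \<open>s\<close> has degree at most \<open>s\<close> in each variable, so it is recovered
  from its values on a grid by tensor products of one-dimensional Lagrange polynomials.\<close>

lemma polys_interpolation:
  fixes P :: "real ^ 'n \<Rightarrow> 'a::{real_normed_field, euclidean_space}"
  assumes inj: "\<And>i. inj_on (y i) {..s}" and P: "P \<in> polys s"
  shows "P x = (\<Sum>g\<in>PiE UNIV (\<lambda>_. {..s}). (\<Prod>i\<in>UNIV. lagrange_basis s (y i) (g i) (x $ i)) *\<^sub>R P (\<chi> i. y i (g i)))"
proof -
  obtain c where P: "P = (\<lambda>x. \<Sum>\<theta>\<in>multi_indices s. mpow x \<theta> *\<^sub>R c \<theta>)" using P unfolding polys_def by blast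
  have mono: "mpow x \<theta> = (\<Sum>g\<in>PiE UNIV (\<lambda>_. {..s}). (\<Prod>i\<in>UNIV. lagrange_basis s (y i) (g i) (x $ i)) * mpow (\<chi> i. y i (g i)) \<theta>)"
    if "\<theta> \<in> multi_indices s" for \<theta>
  proof -
    have \<theta>: "\<theta> i \<le> s" for i
      using member_le_sum[of i UNIV \<theta>] that by (simp add: multi_indices_def)
    have "mpow x \<theta> = (\<Prod>i\<in>UNIV. \<Sum>j\<in>{..s}. lagrange_basis s (y i) j (x $ i) * y i j ^ \<theta> i)"
      unfolding mpow_def lagrange_monomial[OF inj \<theta>] ..
    also have "\<dots> = (\<Sum>g\<in>PiE UNIV (\<lambda>_. {..s}). \<Prod>i\<in>UNIV. lagrange_basis s (y i) (g i) (x $ i) * y i (g i) ^ \<theta> i)"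
      by (rule prod_sum_PiE) simp_all
    finally show ?thesis by (simp add: prod.distrib mpow_def)
  qed
  have "P x = (\<Sum>\<theta>\<in>multi_indices s. (\<Sum>g\<in>PiE UNIV (\<lambda>_. {..s}).
      (\<Prod>i\<in>UNIV. lagrange_basis s (y i) (g i) (x $ i)) * mpow (\<chi> i. y i (g i)) \<theta>) *\<^sub>R c \<theta>)"
    unfolding P using mono by (intro sum.cong) auto
  also have "\<dots> = (\<Sum>g\<in>PiE UNIV (\<lambda>_. {..s}). (\<Prod>i\<in>UNIV. lagrange_basis s (y i) (g i) (x $ i)) *\<^sub>R P (\<chi> i. y i (g i)))"
    unfolding P scaleR_sum_left scaleR_sum_right by (subst sum.swap) simp
  finally show ?thesis .
qed

text \<open>Interpolate at the nodes \<open>z + h g\<close>, \<open>g \<in> {0..s}\<^sup>n\<close>, with \<open>h = l / (s + 1)\<close>, and average over all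
  positions of \<open>z\<close> in the corner subcube of side \<open>h\<close>. The constant does not depend on the cube.\<close>

lemma polys_sup_le_mean:
  fixes P :: "real ^ 'n \<Rightarrow> 'a::{real_normed_field, euclidean_space}"
  assumes P: "P \<in> polys s" and l: "0 < l" and x: "x \<in> ccube a l"
  shows "ennreal (norm (P x)) * ennreal (l ^ CARD('n))
    \<le> ennreal (real (s + 1) ^ (s * CARD('n) + 2 * CARD('n))) * (\<integral>\<^sup>+z\<in>hcube a l. ennreal (norm (P z)) \<partial>lebesgue)"
proof -
  define h where "h = l / real (s + 1)"
  have h: "0 < h" "real (s + 1) * h = l" using l by (simp_all add: h_def)
  define G where "G = (PiE UNIV (\<lambda>_. {..s}) :: ('n \<Rightarrow> nat) set)"
  have card_G: "card G = (s + 1) ^ CARD('n)" by (simp add: G_def card_PiE)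
  have fin_G: "finite G" by (simp add: G_def finite_PiE)
  define b :: "('n \<Rightarrow> nat) \<Rightarrow> real ^ 'n" where "b g = (\<chi> i. h * real (g i))" for g
  define K where "K = real (s + 1) ^ (s * CARD('n))"
  have pointwise: "norm (P x) \<le> K * (\<Sum>g\<in>G. norm (P (b g + z)))" if z: "z \<in> hcube a h" for z
  proof -
    define y where "y i j = h * real j + z $ i" for i j
    have inj: "inj_on (y i) {..s}" for i using h by (auto simp: inj_on_def y_def)
    have L: "\<bar>lagrange_basis s (y i) j (x $ i)\<bar> \<le> real (s + 1) ^ s" if "j \<le> s" for i j
    proof -
      have "\<bar>lagrange_basis s (y i) j (x $ i)\<bar> = (\<Prod>m\<in>{..s} - {j}. \<bar>(x $ i - y i m) / (y i j - y i m)\<bar>)"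
        by (simp add: lagrange_basis_def abs_prod)
      also have "\<dots> \<le> (\<Prod>m\<in>{..s} - {j}. real (s + 1))"
      proof (intro prod_mono conjI)
        fix m assume m: "m \<in> {..s} - {j}"
        have "z $ i < a $ i + h" "a $ i \<le> z $ i" using z by (auto simp: hcube_def)
        moreover have "0 \<le> h * real m" "h * real m \<le> h * real s"
          using h(1) m by (simp_all add: mult_left_mono)
        moreover have "h * real s + h = l" using h(2) by (simp add: algebra_simps)
        moreover have "a $ i \<le> x $ i" "x $ i \<le> a $ i + l" using x by (auto simp: mem_ccube)
        ultimately have num: "\<bar>x $ i - y i m\<bar> \<le> l" unfolding y_def by linarith
        have "1 \<le> \<bar>real j - real m\<bar>" using m by auto
        then have den: "h \<le> \<bar>y i j - y i m\<bar>"
          using h(1) mult_left_mono[of 1 "\<bar>real j - real m\<bar>" h]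
          by (simp add: y_def right_diff_distrib[symmetric] abs_mult)
        have "\<bar>x $ i - y i m\<bar> / \<bar>y i j - y i m\<bar> \<le> l / h"
          using num den h l by (intro frac_le) auto
        then show "\<bar>(x $ i - y i m) / (y i j - y i m)\<bar> \<le> real (s + 1)"
          using l by (simp add: abs_divide h_def)
      qed simp
      also have "\<dots> = real (s + 1) ^ s" using that by simp
      finally show ?thesis .
    qed
    have bz: "(\<chi> i. y i (g i)) = b g + z" for g by (simp add: vec_eq_iff y_def b_def)
    have "norm (P x) \<le> (\<Sum>g\<in>G. norm ((\<Prod>i\<in>UNIV. lagrange_basis s (y i) (g i) (x $ i)) *\<^sub>R P (b g + z)))"
    proof -
      have eq: "P x = (\<Sum>g\<in>G. (\<Prod>i\<in>UNIV. lagrange_basis s (y i) (g i) (x $ i)) *\<^sub>R P (b g + z))"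
        using polys_interpolation[of y s P x] inj P by (simp add: bz G_def)
      show ?thesis unfolding eq by (rule norm_sum)
    qed
    also have "\<dots> \<le> (\<Sum>g\<in>G. K * norm (P (b g + z)))"
    proof (rule sum_mono)
      fix g assume "g \<in> G"
      then have g: "g i \<le> s" for i by (auto simp: G_def PiE_def Pi_def)
      have "\<bar>\<Prod>i\<in>UNIV. lagrange_basis s (y i) (g i) (x $ i)\<bar> = (\<Prod>i\<in>UNIV. \<bar>lagrange_basis s (y i) (g i) (x $ i)\<bar>)"
        by (simp add: abs_prod)
      also have "\<dots> \<le> (\<Prod>i\<in>(UNIV::'n set). real (s + 1) ^ s)"
        by (intro prod_mono conjI L g) simp
      also have "\<dots> = K" by (simp add: K_def power_mult)
      finally show "norm ((\<Prod>i\<in>UNIV. lagrange_basis s (y i) (g i) (x $ i)) *\<^sub>R P (b g + z)) \<le> K * norm (P (b g + z))"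
        by (simp add: mult_right_mono)
    qed
    finally show ?thesis by (simp add: sum_distrib_left)
  qed
  have contP: "continuous_on UNIV P" using P by (rule polys_continuous)
  have [measurable]: "P \<in> borel_measurable borel"
    by (rule borel_measurable_continuous_onI[OF contP])
  have shift: "(\<integral>\<^sup>+z\<in>hcube a h. ennreal (norm (P (b g + z))) \<partial>lborel) \<le> (\<integral>\<^sup>+z\<in>hcube a l. ennreal (norm (P z)) \<partial>lborel)"
    if "g \<in> G" for g
  proof -
    have g: "g i \<le> s" for i using that by (auto simp: G_def PiE_def Pi_def)
    have sub: "b g + z \<in> hcube a l" if "z \<in> hcube a h" for z
    proof -
      have "a $ i \<le> b g $ i + z $ i \<and> b g $ i + z $ i < a $ i + l" for i
      proof -
        have "0 \<le> h * real (g i)" "h * real (g i) \<le> h * real s" using h g by (auto intro!: mult_left_mono)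
        moreover have "h * real s + h = l" using h(2) by (simp add: algebra_simps)
        moreover have "a $ i \<le> z $ i" "z $ i < a $ i + h" using that by (auto simp: hcube_def)
        moreover have "b g $ i = h * real (g i)" by (simp add: b_def)
        ultimately show ?thesis by linarith
      qed
      then show ?thesis by (simp add: hcube_def)
    qed
    have "(\<integral>\<^sup>+z\<in>hcube a h. ennreal (norm (P (b g + z))) \<partial>lborel)
        \<le> (\<integral>\<^sup>+z. ennreal (norm (P (b g + z))) * indicator (hcube a l) (b g + z) \<partial>lborel)"
      using sub by (intro nn_integral_mono) (auto simp: indicator_def)
    also have "\<dots> = (\<integral>\<^sup>+z. ennreal (norm (P z)) * indicator (hcube a l) z \<partial>distr lborel borel ((+) (b g)))"
      by (subst nn_integral_distr) simp_all
    also have "\<dots> = (\<integral>\<^sup>+z\<in>hcube a l. ennreal (norm (P z)) \<partial>lborel)" by (simp add: lborel_distr_plus)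
    finally show ?thesis .
  qed
  have "ennreal (norm (P x)) * ennreal (h ^ CARD('n)) = (\<integral>\<^sup>+z\<in>hcube a h. ennreal (norm (P x)) \<partial>lborel)"
    unfolding nn_integral_completion[of lborel, symmetric] using h(1)
    by (subst nn_integral_const_set) (simp_all add: emeasure_hcube)
  also have "\<dots> \<le> (\<integral>\<^sup>+z. ennreal K * (\<Sum>g\<in>G. ennreal (norm (P (b g + z))) * indicator (hcube a h) z) \<partial>lborel)"
  proof (rule nn_integral_mono)
    fix z
    show "ennreal (norm (P x)) * indicator (hcube a h) z
        \<le> ennreal K * (\<Sum>g\<in>G. ennreal (norm (P (b g + z))) * indicator (hcube a h) z)"
    proof (cases "z \<in> hcube a h")
      case True
      from ennreal_leI[OF pointwise[OF True]] show ?thesis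
        using True by (simp add: K_def ennreal_mult sum_nonneg sum_ennreal)
    qed simp
  qed
  also have "\<dots> = ennreal K * (\<Sum>g\<in>G. \<integral>\<^sup>+z\<in>hcube a h. ennreal (norm (P (b g + z))) \<partial>lborel)"
    by (simp add: nn_integral_cmult nn_integral_sum)
  also have "\<dots> \<le> ennreal K * (\<Sum>g\<in>G. \<integral>\<^sup>+z\<in>hcube a l. ennreal (norm (P z)) \<partial>lborel)"
    by (intro mult_left_mono sum_mono shift) simp_all
  also have "\<dots> = ennreal (K * real (s + 1) ^ CARD('n)) * (\<integral>\<^sup>+z\<in>hcube a l. ennreal (norm (P z)) \<partial>lebesgue)"
    by (simp add: card_G nn_integral_completion K_def ennreal_mult mult.assoc ennreal_of_nat_eq_real_of_nat
        ennreal_power[symmetric])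
  finally have "ennreal (real (s + 1) ^ CARD('n)) * (ennreal (norm (P x)) * ennreal (h ^ CARD('n)))
      \<le> ennreal (real (s + 1) ^ CARD('n)) * (ennreal (K * real (s + 1) ^ CARD('n)) * (\<integral>\<^sup>+z\<in>hcube a l. ennreal (norm (P z)) \<partial>lebesgue))"
    by (intro mult_left_mono) simp_all
  moreover have "ennreal (real (s + 1) ^ CARD('n)) * (ennreal (norm (P x)) * ennreal (h ^ CARD('n)))
      = ennreal (norm (P x)) * ennreal (l ^ CARD('n))"
    using h(1) by (simp add: ennreal_mult[symmetric] h(2)[symmetric] power_mult_distrib mult_ac del: h(2))
  moreover have "real (s + 1) ^ CARD('n) * (K * real (s + 1) ^ CARD('n)) = real (s + 1) ^ (s * CARD('n) + 2 * CARD('n))"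
    by (simp add: K_def power_add mult_2_right mult_ac)
  then have "ennreal (real (s + 1) ^ CARD('n)) * (ennreal (K * real (s + 1) ^ CARD('n)) * X)
      = ennreal (real (s + 1) ^ (s * CARD('n) + 2 * CARD('n))) * X" for X
    by (simp add: ennreal_mult[symmetric] mult.assoc[symmetric] K_def)
  ultimately show ?thesis by simp
qed

subsection \<open>The projection onto polynomials\<close>

lemma set_integrable_continuous_scaleR:
  fixes f :: "real ^ 'n \<Rightarrow> 'b::euclidean_space"
  assumes "continuous_on UNIV u" "set_integrable lebesgue (ccube a l) f"
  shows "set_integrable lebesgue (ccube a l) (\<lambda>x. u x *\<^sub>R f x)"
proof -
  have c: "continuous_on (ccube a l) u" using assms(1) continuous_on_subset by blast
  have bil: "bilinear ((*\<^sub>R) :: real \<Rightarrow> 'b \<Rightarrow> 'b)"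
    by (simp add: bilinear_conv_bounded_bilinear bounded_bilinear_scaleR)
  have meas: "u \<in> borel_measurable (lebesgue_on (ccube a l))"
    by (rule continuous_imp_measurable_on_sets_lebesgue[OF c ccube_measurable])
  have bdd: "bounded (u ` ccube a l)"
    by (rule compact_imp_bounded, rule compact_continuous_image[OF c]) (simp add: ccube_def)
  show ?thesis
    by (rule absolutely_integrable_bounded_measurable_product[OF bil meas ccube_measurable bdd assms(2)])
qed

lemma set_integrable_continuous:
  fixes u :: "real ^ 'n \<Rightarrow> 'b::euclidean_space"
  assumes "continuous_on UNIV u" shows "set_integrable lebesgue (ccube a l) u"
  unfolding ccube_def by (rule absolutely_integrable_continuous) (rule continuous_on_subset[OF assms], simp)

lemma set_integral_sum_all:
  assumes "\<And>i. i \<in> I \<Longrightarrow> set_integrable M A (f i)"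
  shows "set_integrable M A (\<lambda>x. \<Sum>i\<in>I. f i x)" "(LINT x:A|M. (\<Sum>i\<in>I. f i x)) = (\<Sum>i\<in>I. LINT x:A|M. f i x)"
  using assms unfolding set_integrable_def set_lebesgue_integral_def
  by (simp_all add: scaleR_sum_right)

text \<open>Gram-Schmidt: the new function \<open>U i\<close> is made orthogonal to the previous ones. If the remainder
  \<open>v\<close> has norm \<open>0\<close>, the coefficient \<open>\<integral> v g / \<integral> v\<^sup>2\<close> is \<open>0\<close> by the convention for division, which is right
  since then \<open>v = 0\<close> almost everywhere.\<close>

lemma exists_orthogonal_projection_real:
  fixes U :: "'i \<Rightarrow> real ^ 'n \<Rightarrow> real" and f :: "real ^ 'n \<Rightarrow> real"
  assumes "finite B" and U: "\<And>j. continuous_on UNIV (U j)" and "set_integrable lebesgue (ccube a l) f"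
  shows "\<exists>c. \<forall>j\<in>B. (LINT x:ccube a l|lebesgue. U j x * (f x - (\<Sum>k\<in>B. c k * U k x))) = 0"
  using assms(1,3)
proof (induction B arbitrary: f)
  case (insert i B)
  let ?Q = "ccube a l"
  have intU: "set_integrable lebesgue ?Q (U i)" by (rule set_integrable_continuous[OF U])
  from insert.IH[OF intU] obtain d
    where d: "\<forall>j\<in>B. (LINT x:?Q|lebesgue. U j x * (U i x - (\<Sum>k\<in>B. d k * U k x))) = 0" ..
  from insert.IH[OF insert.prems] obtain c
    where c: "\<forall>j\<in>B. (LINT x:?Q|lebesgue. U j x * (f x - (\<Sum>k\<in>B. c k * U k x))) = 0" ..
  define v where "v x = U i x - (\<Sum>k\<in>B. d k * U k x)" for x
  define g where "g x = f x - (\<Sum>k\<in>B. c k * U k x)" for x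
  have contv: "continuous_on UNIV v" unfolding v_def by (intro continuous_intros U)
  have intg: "set_integrable lebesgue ?Q g" unfolding g_def
    by (intro set_integral_diff(1) insert.prems set_integrable_continuous continuous_intros U)
  have int_mult: "set_integrable lebesgue ?Q (\<lambda>x. u x * p x)"
    if "continuous_on UNIV u" "set_integrable lebesgue ?Q p" for u p :: "real ^ 'n \<Rightarrow> real"
    using set_integrable_continuous_scaleR[OF that] by simp
  have intv: "set_integrable lebesgue ?Q v" by (rule set_integrable_continuous[OF contv])
  define t where "t = (LINT x:?Q|lebesgue. v x * g x) / (LINT x:?Q|lebesgue. v x * v x)"
  have t: "(LINT x:?Q|lebesgue. v x * g x) = t * (LINT x:?Q|lebesgue. v x * v x)"
  proof (cases "(LINT x:?Q|lebesgue. v x * v x) = 0")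
    case True
    have "AE x in lebesgue. indicator ?Q x *\<^sub>R (v x * v x) = 0"
      using True int_mult[OF contv intv] unfolding set_lebesgue_integral_def set_integrable_def
      by (subst (asm) integral_nonneg_eq_0_iff_AE) simp_all
    then have "AE x in lebesgue. indicator ?Q x *\<^sub>R (v x * g x) = 0"
      by eventually_elim auto
    then have "(LINT x:?Q|lebesgue. v x * g x) = 0"
      unfolding set_lebesgue_integral_def by (rule integral_eq_zero_AE)
    then show ?thesis using True by simp
  qed (simp add: t_def)
  have intd: "set_integrable lebesgue ?Q (\<lambda>x. g x - t * v x)"
    by (intro set_integral_diff(1) intg set_integrable_mult_right intv)
  have lin: "(LINT x:?Q|lebesgue. u x * (g x - t * v x))
      = (LINT x:?Q|lebesgue. u x * g x) - t * (LINT x:?Q|lebesgue. u x * v x)" if u: "continuous_on UNIV u" for u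
  proof -
    have "(LINT x:?Q|lebesgue. u x * (g x - t * v x)) = (LINT x:?Q|lebesgue. u x * g x - t * (u x * v x))"
      by (simp add: algebra_simps)
    also have "\<dots> = (LINT x:?Q|lebesgue. u x * g x) - (LINT x:?Q|lebesgue. t * (u x * v x))"
      by (intro set_integral_diff(2) set_integrable_mult_right int_mult u intg intv)
    finally show ?thesis by simp
  qed
  have B0: "(LINT x:?Q|lebesgue. U j x * (g x - t * v x)) = 0" if "j \<in> B" for j
    using lin[OF U, of j] bspec[OF c that] bspec[OF d that] by (simp add: g_def v_def)
  have v0: "(LINT x:?Q|lebesgue. v x * (g x - t * v x)) = 0"
    using lin[OF contv] t by simp
  have i0: "(LINT x:?Q|lebesgue. U i x * (g x - t * v x)) = 0"
  proof -
    have "(LINT x:?Q|lebesgue. U i x * (g x - t * v x))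
        = (LINT x:?Q|lebesgue. v x * (g x - t * v x) + (\<Sum>k\<in>B. d k * (U k x * (g x - t * v x))))"
    proof -
      have split: "U i x * y = v x * y + (\<Sum>k\<in>B. d k * (U k x * y))" for x y
      proof -
        have "U i x = v x + (\<Sum>k\<in>B. d k * U k x)" by (simp add: v_def)
        then have "U i x * y = v x * y + (\<Sum>k\<in>B. d k * U k x) * y" by (simp only: distrib_right)
        then show ?thesis by (simp add: sum_distrib_right mult.assoc)
      qed
      show ?thesis by (simp only: split)
    qed
    also have "\<dots> = (LINT x:?Q|lebesgue. v x * (g x - t * v x))
        + (LINT x:?Q|lebesgue. (\<Sum>k\<in>B. d k * (U k x * (g x - t * v x))))"
      by (intro set_integral_add(2) int_mult contv intd set_integral_sum_all(1) set_integrable_mult_right U)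
    also have "(LINT x:?Q|lebesgue. (\<Sum>k\<in>B. d k * (U k x * (g x - t * v x))))
        = (\<Sum>k\<in>B. LINT x:?Q|lebesgue. d k * (U k x * (g x - t * v x)))"
      by (intro set_integral_sum_all(2) set_integrable_mult_right int_mult U intd)
    also have "\<dots> = 0" using B0 by (intro sum.neutral) simp
    finally show ?thesis using v0 by simp
  qed
  define e where "e k = (if k = i then t else c k - t * d k)" for k
  have "f x - (\<Sum>k\<in>insert i B. e k * U k x) = g x - t * v x" for x
  proof -
    have "(\<Sum>k\<in>B. e k * U k x) = (\<Sum>k\<in>B. c k * U k x) - t * (\<Sum>k\<in>B. d k * U k x)"
      using insert.hyps(2) unfolding sum_distrib_left sum_subtractf[symmetric]
      by (intro sum.cong) (auto simp: e_def algebra_simps)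
    then show ?thesis using insert.hyps by (simp add: g_def v_def e_def algebra_simps)
  qed
  then show ?case using B0 i0 by (intro exI[of _ e]) auto
qed simp

definition is_proj ::
    "nat \<Rightarrow> (real ^ 'n) set \<Rightarrow> (real ^ 'n \<Rightarrow> 'a::{real_normed_field, euclidean_space}) \<Rightarrow> (real ^ 'n \<Rightarrow> 'a) \<Rightarrow> bool"
  where "is_proj s Q f P \<longleftrightarrow> P \<in> polys s \<and>
     (\<forall>\<theta>\<in>multi_indices s. (LINT x:Q|lebesgue. mpow x \<theta> *\<^sub>R (f x - P x)) = 0)"

text \<open>Apply the real case to each coordinate of \<open>f\<close>.\<close>

lemma exists_proj:
  fixes f :: "real ^ 'n \<Rightarrow> 'a::{real_normed_field, euclidean_space}"
  assumes f: "set_integrable lebesgue (ccube a l) f"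
  shows "\<exists>P. is_proj s (ccube a l) f P"
proof -
  let ?Q = "ccube a l" and ?I = "multi_indices s :: ('n \<Rightarrow> nat) set"
  have "\<exists>c. \<forall>\<theta>\<in>?I. (LINT x:?Q|lebesgue. mpow x \<theta> * (f x \<bullet> b - (\<Sum>\<theta>\<in>?I. c \<theta> * mpow x \<theta>))) = 0" for b
    using f unfolding set_integrable_def
    by (intro exists_orthogonal_projection_real continuous_mpow)
       (simp_all add: set_integrable_def inner_scaleR_left[symmetric] del: inner_scaleR_left)
  then have "\<exists>c. \<forall>b. \<forall>\<theta>\<in>?I. (LINT x:?Q|lebesgue. mpow x \<theta> * (f x \<bullet> b - (\<Sum>\<theta>\<in>?I. c b \<theta> * mpow x \<theta>))) = 0"
    by (intro choice allI)
  then obtain c where c: "\<forall>b. \<forall>\<theta>\<in>?I.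
      (LINT x:?Q|lebesgue. mpow x \<theta> * (f x \<bullet> b - (\<Sum>\<theta>\<in>?I. c b \<theta> * mpow x \<theta>))) = 0" ..
  define C where "C \<theta> = (\<Sum>b\<in>Basis. c b \<theta> *\<^sub>R (b :: 'a))" for \<theta>
  define P where "P x = (\<Sum>\<theta>\<in>?I. mpow x \<theta> *\<^sub>R C \<theta>)" for x :: "real ^ 'n"
  have PB: "P x \<bullet> b = (\<Sum>\<theta>\<in>?I. c b \<theta> * mpow x \<theta>)" if "b \<in> Basis" for x b
    using that by (simp add: P_def C_def inner_sum_left mult.commute)
  have contP: "continuous_on UNIV P" unfolding P_def by (intro continuous_intros)
  have "(LINT x:?Q|lebesgue. mpow x \<theta> *\<^sub>R (f x - P x)) = 0" if \<theta>: "\<theta> \<in> ?I" for \<theta>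
  proof (rule euclidean_eqI)
    fix b :: 'a assume b: "b \<in> Basis"
    have "set_integrable lebesgue ?Q (\<lambda>x. mpow x \<theta> *\<^sub>R (f x - P x))"
      by (intro set_integrable_continuous_scaleR continuous_mpow set_integral_diff(1) f set_integrable_continuous contP)
    then have "(LINT x:?Q|lebesgue. mpow x \<theta> *\<^sub>R (f x - P x)) \<bullet> b
        = (LINT x|lebesgue. (indicator ?Q x *\<^sub>R (mpow x \<theta> *\<^sub>R (f x - P x))) \<bullet> b)"
      unfolding set_lebesgue_integral_def set_integrable_def by (rule integral_inner_left[symmetric])
    also have "\<dots> = (LINT x:?Q|lebesgue. mpow x \<theta> * (f x \<bullet> b - (\<Sum>\<theta>\<in>?I. c b \<theta> * mpow x \<theta>)))"
      unfolding set_lebesgue_integral_def by (simp add: inner_diff_left PB[OF b] mult.assoc)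
    finally show "(LINT x:?Q|lebesgue. mpow x \<theta> *\<^sub>R (f x - P x)) \<bullet> b = 0 \<bullet> b" using bspec[OF spec[OF c] \<theta>] by simp
  qed
  moreover have "P \<in> polys s" unfolding polys_def P_def by blast
  ultimately show ?thesis unfolding is_proj_def by blast
qed

lemma nn_integral_norm_hcube:
  fixes f :: "real ^ 'n \<Rightarrow> 'b::euclidean_space"
  assumes "set_integrable lebesgue (ccube a l) f"
  shows "(\<integral>\<^sup>+z\<in>hcube a l. ennreal (norm (f z)) \<partial>lebesgue) = ennreal (LINT z:ccube a l|lebesgue. norm (f z))"
proof -
  have "(\<integral>\<^sup>+z. ennreal (indicator (ccube a l) z *\<^sub>R norm (f z)) \<partial>lebesgue) = ennreal (LINT z:ccube a l|lebesgue. norm (f z))"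
    using set_integrable_norm[OF assms]
    unfolding set_integrable_def set_lebesgue_integral_def by (intro nn_integral_eq_integral) simp_all
  also have "(\<integral>\<^sup>+z. ennreal (indicator (ccube a l) z *\<^sub>R norm (f z)) \<partial>lebesgue) = (\<integral>\<^sup>+z\<in>ccube a l. ennreal (norm (f z)) \<partial>lebesgue)"
    by (intro nn_integral_cong) (simp add: indicator_def)
  finally show ?thesis by (simp add: nn_integral_hcube_ccube)
qed

lemma polys_sup_le_mean_real:
  fixes P :: "real ^ 'n \<Rightarrow> 'a::{real_normed_field, euclidean_space}"
  assumes P: "P \<in> polys s" and l: "0 < l" and x: "x \<in> ccube a l"
  shows "norm (P x) * l ^ CARD('n)
    \<le> real (s + 1) ^ (s * CARD('n) + 2 * CARD('n)) * (LINT z:ccube a l|lebesgue. norm (P z))"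
proof -
  have eq: "(\<integral>\<^sup>+z\<in>hcube a l. ennreal (norm (P z)) \<partial>lebesgue) = ennreal (LINT z:ccube a l|lebesgue. norm (P z))"
    by (intro nn_integral_norm_hcube set_integrable_continuous polys_continuous[OF P])
  have nn: "0 \<le> (LINT z:ccube a l|lebesgue. norm (P z))"
    unfolding set_lebesgue_integral_def by (rule Bochner_Integration.integral_nonneg) simp
  have "ennreal (norm (P x) * l ^ CARD('n))
      \<le> ennreal (real (s + 1) ^ (s * CARD('n) + 2 * CARD('n)) * (LINT z:ccube a l|lebesgue. norm (P z)))"
    using polys_sup_le_mean[OF P l x] l nn unfolding eq
    by (subst ennreal_mult, simp, simp, subst ennreal_mult) simp_all
  then show ?thesis using nn by (subst (asm) ennreal_le_iff) simp_all
qed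

text \<open>Testing the orthogonality relation against \<open>P\<close> itself gives \<open>\<integral> |P|\<^sup>2 \<le> sup |P| \<integral> |h|\<close>, and
  \<open>sup |P|\<close> is at most a constant times the mean of \<open>|P|\<close>, which is at most its quadratic mean.\<close>

lemma is_proj_bound:
  fixes P h :: "real ^ 'n \<Rightarrow> 'a::{real_normed_field, euclidean_space}"
  assumes proj: "is_proj s (ccube a l) h P" and l: "0 < l" and x: "x \<in> ccube a l"
    and h: "set_integrable lebesgue (ccube a l) h"
  shows "norm (P x) * l ^ CARD('n)
    \<le> (real (s + 1) ^ (s * CARD('n) + 2 * CARD('n)))\<^sup>2 * (LINT z:ccube a l|lebesgue. norm (h z))"
proof -
  let ?Q = "ccube a l"
  define K where "K = real (s + 1) ^ (s * CARD('n) + 2 * CARD('n))"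
  define V where "V = l ^ CARD('n)"
  have K: "0 < K" and V: "0 < V" using l by (simp_all add: K_def V_def)
  have P: "P \<in> polys s" using proj by (simp add: is_proj_def)
  obtain c where c: "P = (\<lambda>x. \<Sum>\<theta>\<in>multi_indices s. mpow x \<theta> *\<^sub>R c \<theta>)" using P unfolding polys_def by blast
  have contP: "continuous_on A P" for A by (rule polys_continuous[OF P])
  have intn: "set_integrable lebesgue ?Q (\<lambda>z. norm (P z))"
    by (intro set_integrable_continuous continuous_intros contP)
  have inthn: "set_integrable lebesgue ?Q (\<lambda>z. norm (h z))"
    using h by (rule set_integrable_norm)
  have hP: "set_integrable lebesgue ?Q (\<lambda>x. h x - P x)"
    by (intro set_integral_diff(1) h set_integrable_continuous contP)
  have \<theta>int: "set_integrable lebesgue ?Q (\<lambda>x. mpow x \<theta> *\<^sub>R (h x - P x))" for \<theta>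
    by (intro set_integrable_continuous_scaleR hP continuous_mpow)
  define m where "m = (LINT z:?Q|lebesgue. norm (P z)) / V"
  have m0: "0 \<le> m" unfolding m_def set_lebesgue_integral_def
    using V by (intro divide_nonneg_pos Bochner_Integration.integral_nonneg) simp_all
  have Im: "(LINT z:?Q|lebesgue. norm (P z)) = m * V" using V by (simp add: m_def)
  have sup: "norm (P z) \<le> K * m" if "z \<in> ?Q" for z
    using polys_sup_le_mean_real[OF P l that] V unfolding Im K_def[symmetric] V_def[symmetric] by simp
  have orth_int: "set_integrable lebesgue ?Q (\<lambda>x. (h x - P x) \<bullet> P x)"
    "(LINT x:?Q|lebesgue. (h x - P x) \<bullet> P x) = 0"
  proof -
    have eq: "(h x - P x) \<bullet> P x = (\<Sum>\<theta>\<in>multi_indices s. (mpow x \<theta> *\<^sub>R (h x - P x)) \<bullet> c \<theta>)" for x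
      unfolding c by (simp add: inner_sum_right)
    have int1: "set_integrable lebesgue ?Q (\<lambda>x. (mpow x \<theta> *\<^sub>R (h x - P x)) \<bullet> c \<theta>)"
      and val: "(LINT x:?Q|lebesgue. (mpow x \<theta> *\<^sub>R (h x - P x)) \<bullet> c \<theta>) = (LINT x:?Q|lebesgue. mpow x \<theta> *\<^sub>R (h x - P x)) \<bullet> c \<theta>" for \<theta>
    proof -
      have i: "integrable lebesgue (\<lambda>x. indicator ?Q x *\<^sub>R (mpow x \<theta> *\<^sub>R (h x - P x)))"
        using \<theta>int[of \<theta>] by (simp only: set_integrable_def)
      have r: "indicator ?Q x *\<^sub>R ((mpow x \<theta> *\<^sub>R (h x - P x)) \<bullet> c \<theta>) = (indicator ?Q x *\<^sub>R (mpow x \<theta> *\<^sub>R (h x - P x))) \<bullet> c \<theta>" for x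
        by simp
      show "set_integrable lebesgue ?Q (\<lambda>x. (mpow x \<theta> *\<^sub>R (h x - P x)) \<bullet> c \<theta>)"
        unfolding set_integrable_def r by (rule integrable_inner_left) (rule i)
      show "(LINT x:?Q|lebesgue. (mpow x \<theta> *\<^sub>R (h x - P x)) \<bullet> c \<theta>) = (LINT x:?Q|lebesgue. mpow x \<theta> *\<^sub>R (h x - P x)) \<bullet> c \<theta>"
        unfolding set_lebesgue_integral_def r by (rule integral_inner_left) (rule i)
    qed
    show "set_integrable lebesgue ?Q (\<lambda>x. (h x - P x) \<bullet> P x)" unfolding eq by (rule set_integral_sum_all(1)[OF int1])
    show "(LINT x:?Q|lebesgue. (h x - P x) \<bullet> P x) = 0"
      unfolding eq set_integral_sum_all(2)[OF int1] val using proj unfolding is_proj_def by (intro sum.neutral) simp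
  qed
  have int2: "set_integrable lebesgue ?Q (\<lambda>x. (norm (P x))\<^sup>2)"
    by (intro set_integrable_continuous continuous_intros contP)
  have "(LINT x:?Q|lebesgue. (norm (P x))\<^sup>2) \<le> (LINT x:?Q|lebesgue. (K * m) * norm (h x) - (h x - P x) \<bullet> P x)"
  proof (rule set_integral_mono[OF int2 set_integral_diff(1)[OF set_integrable_mult_right[OF inthn] orth_int(1)]])
    fix x assume x: "x \<in> ?Q"
    have "(norm (P x))\<^sup>2 = h x \<bullet> P x - (h x - P x) \<bullet> P x" by (simp add: inner_diff_left power2_norm_eq_inner)
    also have "h x \<bullet> P x \<le> norm (h x) * norm (P x)" by (rule norm_cauchy_schwarz)
    also have "\<dots> \<le> norm (h x) * (K * m)" by (intro mult_left_mono sup x) simp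
    finally show "(norm (P x))\<^sup>2 \<le> (K * m) * norm (h x) - (h x - P x) \<bullet> P x" by (simp add: mult.commute)
  qed
  also have "\<dots> = (LINT x:?Q|lebesgue. (K * m) * norm (h x)) - (LINT x:?Q|lebesgue. (h x - P x) \<bullet> P x)"
    by (rule set_integral_diff(2)[OF set_integrable_mult_right[OF inthn] orth_int(1)])
  finally have upper: "(LINT x:?Q|lebesgue. (norm (P x))\<^sup>2) \<le> K * m * (LINT x:?Q|lebesgue. norm (h x))"
    using orth_int(2) by simp
  have cint: "set_integrable lebesgue ?Q (\<lambda>x. m\<^sup>2 :: real)" by (intro set_integrable_continuous continuous_intros)
  have "(LINT x:?Q|lebesgue. 2 * m * norm (P x) - m\<^sup>2) \<le> (LINT x:?Q|lebesgue. (norm (P x))\<^sup>2)"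
  proof (rule set_integral_mono[OF set_integral_diff(1)[OF set_integrable_mult_right[OF intn] cint] int2])
    show "2 * m * norm (P x) - m\<^sup>2 \<le> (norm (P x))\<^sup>2" for x
      using zero_le_power2[of "norm (P x) - m"] by (simp add: power2_diff mult_ac)
  qed
  moreover have "(LINT x:?Q|lebesgue. 2 * m * norm (P x) - m\<^sup>2) = 2 * m * (m * V) - m\<^sup>2 * V"
  proof -
    have "measure lebesgue ?Q = V" using l by (simp add: measure_def emeasure_ccube V_def)
    then have "(LINT x:?Q|lebesgue. m\<^sup>2) = m\<^sup>2 * V"
      using l unfolding set_lebesgue_integral_def by simp
    then show ?thesis
      unfolding set_integral_diff(2)[OF set_integrable_mult_right[OF intn] cint] by (simp add: Im)
  qed
  ultimately have lower: "m * (m * V) \<le> (LINT x:?Q|lebesgue. (norm (P x))\<^sup>2)"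
    by (simp add: power2_eq_square mult_ac)
  have mV: "m * V \<le> K * (LINT x:?Q|lebesgue. norm (h x))"
  proof (cases "m = 0")
    case True
    have "0 \<le> (LINT x:?Q|lebesgue. norm (h x))"
      unfolding set_lebesgue_integral_def by (rule Bochner_Integration.integral_nonneg) simp
    then show ?thesis using True K by simp
  next
    case False
    have "m * (m * V) \<le> m * (K * (LINT x:?Q|lebesgue. norm (h x)))"
      using order_trans[OF lower upper] by (simp add: mult_ac)
    then show ?thesis using False m0 by simp
  qed
  have "norm (P x) * V \<le> K * (m * V)" using mult_right_mono[OF sup[OF x], of V] V by simp
  also have "\<dots> \<le> K * (K * (LINT x:?Q|lebesgue. norm (h x)))" using mV K by simp
  finally show ?thesis by (simp add: K_def V_def power2_eq_square mult.assoc)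
qed

lemma is_proj_diff:
  assumes "is_proj s (ccube a l) f P" "is_proj s (ccube a l) g R"
    and "set_integrable lebesgue (ccube a l) f" "set_integrable lebesgue (ccube a l) g"
  shows "is_proj s (ccube a l) (\<lambda>x. f x - g x) (\<lambda>x. P x - R x)"
proof -
  have PR: "P \<in> polys s" "R \<in> polys s" using assms by (simp_all add: is_proj_def)
  have "(LINT x:ccube a l|lebesgue. mpow x \<theta> *\<^sub>R (f x - g x - (P x - R x))) = 0" if \<theta>: "\<theta> \<in> multi_indices s" for \<theta>
  proof -
    have "(LINT x:ccube a l|lebesgue. mpow x \<theta> *\<^sub>R (f x - g x - (P x - R x)))
        = (LINT x:ccube a l|lebesgue. mpow x \<theta> *\<^sub>R (f x - P x) - mpow x \<theta> *\<^sub>R (g x - R x))"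
      by (simp add: scaleR_diff_right algebra_simps)
    also have "\<dots> = (LINT x:ccube a l|lebesgue. mpow x \<theta> *\<^sub>R (f x - P x))
        - (LINT x:ccube a l|lebesgue. mpow x \<theta> *\<^sub>R (g x - R x))"
      by (intro set_integral_diff set_integrable_continuous_scaleR continuous_mpow
          assms(3,4) set_integrable_continuous polys_continuous[OF PR(1)] polys_continuous[OF PR(2)])
    finally show ?thesis using assms(1,2) \<theta> by (simp add: is_proj_def)
  qed
  then show ?thesis using polys_diff[OF PR] by (simp add: is_proj_def)
qed

lemma is_proj_self:
  assumes "P \<in> polys s" shows "is_proj s Q P P"
  using assms by (simp add: is_proj_def set_lebesgue_integral_def)

text \<open>The difference of two projections is a projection of \<open>0\<close>, so it vanishes on the cube; interpolation at nodes
  inside the cube extends this to the whole space.\<close>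

lemma is_proj_unique:
  fixes f :: "real ^ 'n \<Rightarrow> 'a::{real_normed_field, euclidean_space}"
  assumes P: "is_proj s (ccube a l) f P" and R: "is_proj s (ccube a l) f R" and l: "0 < l"
    and f: "set_integrable lebesgue (ccube a l) f"
  shows "P = R"
proof
  fix x
  let ?D = "\<lambda>x. P x - R x"
  have D: "is_proj s (ccube a l) (\<lambda>x. f x - f x) ?D" by (rule is_proj_diff[OF P R f f])
  have zero: "?D z = 0" if "z \<in> ccube a l" for z
    using is_proj_bound[OF D l that set_integral_diff(1)[OF f f]] zero_less_power[OF l, of "CARD('n)"]
    by (auto simp: set_lebesgue_integral_def mult_le_0_iff)
  define y where "y i j = a $ i + l / real (s + 1) * real j" for i j
  have inj: "inj_on (y i) {..s}" for i using l by (auto simp: inj_on_def y_def)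
  have nodes: "(\<chi> i. y i (g i)) \<in> ccube a l" if "g \<in> PiE UNIV (\<lambda>_. {..s})" for g
  proof -
    have "g i \<le> s" for i using that by (simp add: PiE_def Pi_def)
    then have "real (g i) \<le> real (s + 1)" for i using le_SucI[of "g i" s] by (simp add: le_SucI del: of_nat_Suc of_nat_add)
    then have "l * real (g i) \<le> l * real (s + 1)" for i using l by (intro mult_left_mono) simp_all
    then show ?thesis using l by (simp add: mem_ccube y_def divide_le_eq)
  qed
  have "?D \<in> polys s" using D by (simp add: is_proj_def)
  from polys_interpolation[of y s ?D x, OF inj this] have "?D x = 0"
    using zero[OF nodes] by simp
  then show "P x = R x" by simp
qed

lemma poly_proj_is_proj:
  fixes f :: "real ^ 'n \<Rightarrow> 'a::{real_normed_field, euclidean_space}"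
  assumes l: "0 < l" and f: "set_integrable lebesgue (ccube a l) f"
  shows "is_proj s (ccube a l) f (poly_proj s (ccube a l) f)"
proof -
  obtain P where P: "is_proj s (ccube a l) f P" using exists_proj[OF f] ..
  have "poly_proj s (ccube a l) f = P"
    unfolding poly_proj_def
  proof (rule the_equality)
    show "P \<in> polys s \<and> (\<forall>\<theta>\<in>multi_indices s. (LINT x:ccube a l|lebesgue. mpow x \<theta> *\<^sub>R (f x - P x)) = 0)"
      using P by (simp add: is_proj_def)
    fix R assume "R \<in> polys s \<and> (\<forall>\<theta>\<in>multi_indices s. (LINT x:ccube a l|lebesgue. mpow x \<theta> *\<^sub>R (f x - R x)) = 0)"
    then have "is_proj s (ccube a l) f R" by (simp add: is_proj_def)
    then show "R = P" using is_proj_unique[OF _ P l f] by blast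
  qed
  then show ?thesis using P by simp
qed

lemma poly_proj_polys:
  fixes f :: "real ^ 'n \<Rightarrow> 'a::{real_normed_field, euclidean_space}"
  assumes "0 < l" "locally_integrable f"
  shows "poly_proj s (ccube a l) f \<in> polys s"
  using poly_proj_is_proj[OF assms(1) locally_integrable_cube[OF assms(2)]] by (simp add: is_proj_def)

text \<open>Because polynomials are their own projections, \<open>P\<^sub>Q f - p\<close> is the projection of \<open>f - p\<close>. The lemma
  is used both with \<open>p\<close> the projection for a larger cube and with \<open>p = 0\<close>.\<close>

lemma poly_proj_diff_bound:
  fixes f p :: "real ^ 'n \<Rightarrow> 'a::{real_normed_field, euclidean_space}"
  assumes l: "0 < l" and f: "locally_integrable f" and p: "p \<in> polys s" and x: "x \<in> ccube a l"
  shows "ennreal (norm (poly_proj s (ccube a l) f x - p x)) * ennreal (l ^ CARD('n))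
    \<le> ennreal ((real (s + 1) ^ (s * CARD('n) + 2 * CARD('n)))\<^sup>2) * (\<integral>\<^sup>+z\<in>hcube a l. ennreal (norm (f z - p z)) \<partial>lebesgue)"
proof -
  let ?Q = "ccube a l" and ?K = "(real (s + 1) ^ (s * CARD('n) + 2 * CARD('n)))\<^sup>2"
  have fi: "set_integrable lebesgue ?Q f" by (rule locally_integrable_cube[OF f])
  have pi: "set_integrable lebesgue ?Q p" by (intro set_integrable_continuous polys_continuous[OF p])
  have fp: "set_integrable lebesgue ?Q (\<lambda>x. f x - p x)" by (rule set_integral_diff(1)[OF fi pi])
  have proj: "is_proj s ?Q (\<lambda>x. f x - p x) (\<lambda>x. poly_proj s ?Q f x - p x)"
    by (rule is_proj_diff[OF poly_proj_is_proj[OF l fi] is_proj_self[OF p] fi pi])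
  have "ennreal (norm (poly_proj s ?Q f x - p x)) * ennreal (l ^ CARD('n))
      = ennreal (norm (poly_proj s ?Q f x - p x) * l ^ CARD('n))"
    using l by (simp add: ennreal_mult)
  also have "\<dots> \<le> ennreal (?K * (LINT z:?Q|lebesgue. norm (f z - p z)))"
    by (rule ennreal_leI[OF is_proj_bound[OF proj l x fp]])
  also have "\<dots> = ennreal ?K * ennreal (LINT z:?Q|lebesgue. norm (f z - p z))"
    by (rule ennreal_mult') simp
  finally show ?thesis unfolding nn_integral_norm_hcube[OF fp] .
qed

section \<open>The John-Nirenberg estimate\<close>

lemma closure_hcube:
  assumes "0 < l" shows "closure (hcube a l) = ccube a l"
proof -
  have ne: "box a (\<chi> i. a $ i + l) \<noteq> {}"
  proof -
    have "(\<chi> i. a $ i + l / 2) \<in> box a (\<chi> i. a $ i + l)" using assms by (simp add: mem_box_cart)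
    then show ?thesis by blast
  qed
  have "box a (\<chi> i. a $ i + l) \<subseteq> hcube a l" by (auto simp: hcube_def mem_box_cart less_imp_le)
  from closure_mono[OF this] have "ccube a l \<subseteq> closure (hcube a l)"
    unfolding closure_box[OF ne] ccube_def .
  moreover have "closure (hcube a l) \<subseteq> ccube a l"
    by (rule closure_minimal[OF hcube_sub_ccube]) (unfold ccube_def, rule closed_cbox)
  ultimately show ?thesis by blast
qed

text \<open>The triangle inequality for \<open>q\<close>-th powers, with a factor on \<open>b\<close> as close to \<open>1\<close> as desired.\<close>

lemma powr_add_le:
  fixes a b :: real
  assumes "0 \<le> a" "0 \<le> b" "0 < \<eta>" "0 < q"
  shows "(a + b) powr q \<le> (1 + 1 / \<eta>) powr q * a powr q + (1 + \<eta>) powr q * b powr q"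
proof (cases "a \<le> \<eta> * b")
  case True
  then have "(a + b) powr q \<le> ((1 + \<eta>) * b) powr q" using assms by (intro powr_mono2) (simp_all add: algebra_simps)
  also have "\<dots> = (1 + \<eta>) powr q * b powr q" using assms by (simp add: powr_mult)
  finally show ?thesis by (simp add: add_increasing)
next
  case False
  then have "b \<le> a / \<eta>" using assms by (simp add: field_simps)
  then have "(a + b) powr q \<le> ((1 + 1 / \<eta>) * a) powr q" using assms by (intro powr_mono2) (simp_all add: algebra_simps)
  also have "\<dots> = (1 + 1 / \<eta>) powr q * a powr q" using assms by (simp add: powr_mult)
  finally show ?thesis by (simp add: add_increasing2)
qed

text \<open>The closure turns a half-open cube into the closed cube for which the projection is taken.\<close>

definition osc :: "nat \<Rightarrow> (real ^ 'n \<Rightarrow> 'a::{real_normed_field, euclidean_space}) \<Rightarrow> (real ^ 'n) set \<Rightarrow> real ^ 'n \<Rightarrow> real" where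
  "osc s f R x = norm (f x - poly_proj s (closure R) f x)"

lemma osc_hcube: "0 < r \<Longrightarrow> osc s f (hcube c r) x = norm (f x - poly_proj s (ccube c r) f x)"
  by (simp add: osc_def closure_hcube)

lemma osc_measurable:
  fixes f :: "real ^ 'n \<Rightarrow> 'a::{real_normed_field, euclidean_space}"
  assumes "0 < r" "locally_integrable f"
  shows "osc s f (hcube c r) \<in> borel_measurable lebesgue"
proof -
  have "poly_proj s (ccube c r) f \<in> borel_measurable borel"
    by (rule borel_measurable_continuous_onI[OF polys_continuous[OF poly_proj_polys[OF assms]]])
  then have [measurable]: "poly_proj s (ccube c r) f \<in> borel_measurable lebesgue"
    by (simp add: measurable_completion)
  note [measurable] = locally_integrable_measurable[OF assms(2)]
  show ?thesis unfolding osc_hcube[OF assms(1), abs_def] by measurable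
qed

lemma osc_nonneg [simp]: "0 \<le> osc s f R x" by (simp add: osc_def)

context A_inf_weight begin

definition osc_bound ::
    "nat \<Rightarrow> (real ^ 'n \<Rightarrow> 'a::{real_normed_field, euclidean_space}) \<Rightarrow> real \<Rightarrow> (real ^ 'n) set \<Rightarrow> bool" where
  "osc_bound s f K Q \<longleftrightarrow> (\<forall>c r. 0 < r \<longrightarrow> hcube c r \<subseteq> Q \<longrightarrow>
     (\<integral>\<^sup>+x\<in>hcube c r. ennreal (osc s f (hcube c r) x) \<partial>lebesgue) \<le> ennreal (K * w (hcube c r)))"

lemma osc_boundD:
  "osc_bound s f K Q \<Longrightarrow> 0 < r \<Longrightarrow> hcube c r \<subseteq> Q \<Longrightarrow>
     (\<integral>\<^sup>+x\<in>hcube c r. ennreal (osc s f (hcube c r) x) \<partial>lebesgue) \<le> ennreal (K * w (hcube c r))"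
  by (simp add: osc_bound_def)

lemma w_nonneg [simp]: "0 \<le> w R" by (simp add: w_def)

text \<open>The form in which the bound on \<open>\<omega>\<^sup>1\<^sup>-\<^sup>q\<close> is used: a function that is at most \<open>k\<close> times the mean of
  \<open>\<omega>\<close> on a cube \<open>R\<close> has, with respect to \<open>\<omega>\<^sup>1\<^sup>-\<^sup>q\<close>, a \<open>q\<close>-th power integral of at most
  \<open>C0 k\<^sup>q \<omega>(R)\<close>, because the powers of the mean cancel.\<close>

lemma power_bound_mean:
  assumes "power_bound (q - 1) C0" "0 < r" "r \<le> 1" "0 \<le> C0" "0 \<le> k"
  shows "ennreal ((k * (w (hcube c r) / r ^ CARD('n))) powr q)
      * (\<integral>\<^sup>+x\<in>hcube c r. ennreal (\<omega> x powr (1 - q)) \<partial>lebesgue) \<le> ennreal (C0 * k powr q * w (hcube c r))"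
proof -
  define v where "v = r ^ CARD('n)"
  define y where "y = w (hcube c r)"
  have vy: "0 < v" "0 < y" using assms(2) w_pos[OF assms(2)] by (simp_all add: v_def y_def)
  have "ennreal ((k * (y / v)) powr q) * (\<integral>\<^sup>+x\<in>hcube c r. ennreal (\<omega> x powr (1 - q)) \<partial>lebesgue)
      \<le> ennreal ((k * (y / v)) powr q) * ennreal (C0 * v * (v / y) powr (q - 1))"
    using power_boundD[OF assms(1-3), of c] by (intro mult_left_mono) (simp_all add: v_def y_def)
  also have "\<dots> = ennreal ((k * (y / v)) powr q * (C0 * v * (v / y) powr (q - 1)))"
    by (simp add: ennreal_mult')
  also have "(k * (y / v)) powr q * (C0 * v * (v / y) powr (q - 1)) = C0 * k powr q * y"
  proof -
    have "(v / y) powr (q - 1) = (y / v) powr (1 - q)"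
      using vy by (simp add: powr_divide powr_diff field_simps)
    then have "(y / v) powr q * (v * (v / y) powr (q - 1)) = v * ((y / v) powr q * (y / v) powr (1 - q))" by simp
    also have "(y / v) powr q * (y / v) powr (1 - q) = y / v" using vy by (simp add: powr_add[symmetric])
    finally have "(y / v) powr q * (v * (v / y) powr (q - 1)) = y" using vy by simp
    moreover have "(k * (y / v)) powr q = k powr q * (y / v) powr q"
      by (rule powr_mult)
    ultimately show ?thesis by (simp add: mult_ac)
  qed
  finally show ?thesis by (simp only: v_def y_def)
qed

lemma wmeas_split:
  assumes "A \<in> sets lebesgue" "B \<in> sets lebesgue" "A \<subseteq> B"
  shows "wmeas \<omega> B = wmeas \<omega> A + wmeas \<omega> (B - A)"
proof -
  note [measurable] = assms(1,2)
  have "wmeas \<omega> B = (\<integral>\<^sup>+x. ennreal (\<omega> x) * indicator A x + ennreal (\<omega> x) * indicator (B - A) x \<partial>lebesgue)"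
    unfolding wmeas_def using assms(3) by (intro nn_integral_cong) (auto simp: indicator_def)
  also have "\<dots> = wmeas \<omega> A + wmeas \<omega> (B - A)" unfolding wmeas_def by (rule nn_integral_add) simp_all
  finally show ?thesis .
qed

text \<open>If \<open>E\<close> fills at most half of the cube, its complement fills at least half and so carries at least the
  fraction \<open>1 / C\<close> of the \<open>\<omega>\<close>-mass.\<close>

lemma half_decay:
  obtains \<delta> :: real where "0 < \<delta>" "\<delta> < 1"
    "\<And>a l E. 0 < l \<Longrightarrow> l \<le> 1 \<Longrightarrow> E \<in> sets lebesgue \<Longrightarrow> E \<subseteq> hcube a l \<Longrightarrow>
       emeasure lebesgue E \<le> emeasure lebesgue (hcube a l) / 2 \<Longrightarrow> w E \<le> \<delta> * w (hcube a l)"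
proof -
  obtain C where C: "1 < C" "\<And>a l F. 0 < l \<Longrightarrow> l \<le> 1 \<Longrightarrow> F \<in> sets lebesgue \<Longrightarrow> F \<subseteq> hcube a l \<Longrightarrow>
       ennreal (l ^ CARD('n) / 2) \<le> emeasure lebesgue F \<Longrightarrow> w (hcube a l) \<le> C * w F"
    using half_const by metis
  show thesis
  proof (rule that[of "1 - 1 / C"])
    fix a :: "real ^ 'n" and l E
    assume l: "0 < l" "l \<le> 1" and E: "E \<in> sets lebesgue" "E \<subseteq> hcube a l"
      "emeasure lebesgue E \<le> emeasure lebesgue (hcube a l) / 2"
    let ?Q = "hcube a l"
    obtain e where e: "emeasure lebesgue E = ennreal e" "0 \<le> e"
      using E(3) l by (cases "emeasure lebesgue E") (auto simp: emeasure_hcube top_unique divide_ennreal[symmetric] ennreal_divide_eq_top_iff)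
    have "ennreal e \<le> ennreal (l ^ CARD('n) / 2)"
      using E(3) l by (simp add: e emeasure_hcube ennreal_divide_numeral)
    then have e2: "e \<le> l ^ CARD('n) / 2" using l by (subst (asm) ennreal_le_iff) simp_all
    have "emeasure lebesgue (?Q - E) = emeasure lebesgue ?Q - emeasure lebesgue E"
      using E e by (intro emeasure_Diff) simp_all
    also have "\<dots> = ennreal (l ^ CARD('n) - e)" using l e by (simp add: emeasure_hcube ennreal_minus)
    finally have "ennreal (l ^ CARD('n) / 2) \<le> emeasure lebesgue (?Q - E)" using e2 by (simp add: ennreal_leI)
    then have 1: "w ?Q \<le> C * w (?Q - E)" using l E by (intro C(2)) auto
    have "ennreal (w ?Q) = ennreal (w E) + ennreal (w (?Q - E))"
      using wmeas_split[OF E(1) _ E(2)] wmeas_eq_w[OF E(2)] wmeas_eq_w[of "?Q - E" a l] by (simp add: wmeas_hcube)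
    then have "w ?Q = w E + w (?Q - E)"
      by (simp add: ennreal_plus[symmetric] del: ennreal_plus)
    then have "w ?Q \<le> C * (w ?Q - w E)" using 1 by simp
    then show "w E \<le> (1 - 1 / C) * w ?Q" using C(1) by (simp add: field_simps)
  qed (use C(1) in simp_all)
qed

text \<open>Stop at the cells where the mean of the oscillation over \<open>Q\<close> exceeds \<open>\<tau> = 2 K \<omega>(Q) / |Q|\<close>, twice the
  bound that is known for its mean over \<open>Q\<close>. On such a cell \<open>R\<close> the projections for \<open>R\<close> and \<open>Q\<close> differ by at
  most \<open>T \<tau>\<close>, so the oscillation over \<open>Q\<close> is that over \<open>R\<close> up to a bounded error, and the
  stopped cells carry at most a fraction \<open>\<delta> < 1\<close> of the \<open>\<omega>\<close>-mass. The factor \<open>\<kappa> = (1 + \<eta>)\<^sup>q\<close> lost in the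
  triangle inequality is taken as \<open>1 / sqrt \<delta>\<close>, so that \<open>\<kappa> \<delta> = sqrt \<delta>\<close> is still less than \<open>1\<close>.\<close>

lemma john_nirenberg:
  assumes q: "1 < q" and C0: "0 < C0" "power_bound (q - 1) C0"
  shows "\<exists>B>0. \<forall>(f :: real ^ 'n \<Rightarrow> 'a::{real_normed_field, euclidean_space}) K a l.
    locally_integrable f \<longrightarrow> 0 < K \<longrightarrow> 0 < l \<longrightarrow> l \<le> 1 \<longrightarrow> osc_bound s f K (hcube a l) \<longrightarrow>
    (\<integral>\<^sup>+x\<in>hcube a l. ennreal (osc s f (hcube a l) x powr q * \<omega> x powr (1 - q)) \<partial>lebesgue)
      \<le> ennreal (B * K powr q * w (hcube a l))"
proof -
  obtain \<delta> where \<delta>: "0 < \<delta>" "\<delta> < 1"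
    "\<And>a l E. 0 < l \<Longrightarrow> l \<le> 1 \<Longrightarrow> E \<in> sets lebesgue \<Longrightarrow> E \<subseteq> hcube a l \<Longrightarrow>
       emeasure lebesgue E \<le> emeasure lebesgue (hcube a l) / 2 \<Longrightarrow> w E \<le> \<delta> * w (hcube a l)"
    using half_decay by metis
  define \<kappa> where "\<kappa> = 1 / sqrt \<delta>"
  have \<kappa>: "1 < \<kappa>" "\<kappa> * \<delta> = sqrt \<delta>" "sqrt \<delta> < 1"
    using \<delta>(1,2) real_div_sqrt[of \<delta>] by (simp_all add: \<kappa>_def)
  define \<eta> where "\<eta> = \<kappa> powr (1 / q) - 1"
  have \<eta>: "0 < \<eta>" "(1 + \<eta>) powr q = \<kappa>"
    using \<kappa>(1) q by (simp_all add: \<eta>_def powr_powr gr_one_powr)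
  define \<kappa>' where "\<kappa>' = (1 + 1 / \<eta>) powr q"
  have \<kappa>': "1 \<le> \<kappa>'" unfolding \<kappa>'_def using \<eta> q by (intro ge_one_powr_ge_zero) simp_all
  define KP where "KP = (real (s + 1) ^ (s * CARD('n) + 2 * CARD('n)))\<^sup>2"
  have KP: "1 \<le> KP" unfolding KP_def by (simp add: one_le_power del: of_nat_add of_nat_Suc)
  define T where "T = KP * 2 ^ CARD('n)"
  have T: "1 \<le> T" unfolding T_def using KP by (simp add: mult_ge1_I)
  define M where "M = \<kappa>' * T powr q * 2 powr q * C0"
  have M: "0 < M" unfolding M_def using \<kappa>' T C0 by simp
  \<comment> \<open>the sum of the geometric series, i.e. the solution of \<open>M + sqrt \<delta> B = B\<close>\<close>
  define B where "B = M / (1 - sqrt \<delta>)"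
  have B: "0 < B" "M + sqrt \<delta> * B = B"
    using M \<kappa>(3) by (simp_all add: B_def field_simps)
  have main: "(\<integral>\<^sup>+x\<in>hcube a l. ennreal (osc s f (hcube a l) x powr q * \<omega> x powr (1 - q)) \<partial>lebesgue)
      \<le> ennreal B * ennreal (K powr q * w (hcube a l))"
    if f: "locally_integrable f" and K: "0 < K" and l0: "0 < l" "l \<le> 1" and ob: "osc_bound s f K (hcube a l)"
    for f :: "real ^ 'n \<Rightarrow> 'a" and K a l
  proof (rule iterated_stopping[where G = "\<lambda>Q x. ennreal (osc s f Q x powr q * \<omega> x powr (1 - q))"
        and \<beta> = "\<lambda>Q. ennreal (K powr q * w Q)"
        and \<Q> = "{hcube c r | c r. 0 < r \<and> hcube c r \<subseteq> hcube a l}" and \<kappa> = "ennreal \<kappa>" and K = "ennreal M"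
        and \<theta> = "ennreal (sqrt \<delta>)"])
    fix Q assume "Q \<in> {hcube c r | c r. 0 < r \<and> hcube c r \<subseteq> hcube a l}"
    then obtain c0 r0 where Q: "Q = hcube c0 r0" and r0: "0 < r0" and Qsub: "Q \<subseteq> hcube a l" by blast
    have r1: "r0 \<le> 1" using hcube_side_mono[OF r0] Qsub l0(2) Q by (metis order_trans)
    define v where "v = r0 ^ CARD('n)"
    have v: "0 < v" "emeasure lebesgue Q = ennreal v" using r0 by (simp_all add: v_def Q emeasure_hcube)
    have wQ: "0 < w Q" using w_pos[OF r0] Q by simp
    define \<tau> where "\<tau> = 2 * K * w Q / v"
    have \<tau>: "0 < \<tau>" "K * w Q = \<tau> * v / 2" using K v wQ by (simp_all add: \<tau>_def)
    have [measurable]: "osc s f Q \<in> borel_measurable lebesgue" unfolding Q by (rule osc_measurable[OF r0 f])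
    have IQ: "(\<integral>\<^sup>+x\<in>Q. ennreal (osc s f Q x) \<partial>lebesgue) \<le> ennreal (\<tau> * v / 2)"
      using osc_boundD[OF ob r0, of c0] Qsub unfolding \<tau>(2)[symmetric] by (simp add: Q)
    define bad where "bad R \<longleftrightarrow> (\<integral>\<^sup>+x\<in>R. ennreal \<tau> \<partial>lebesgue) < (\<integral>\<^sup>+x\<in>R. ennreal (osc s f Q x) \<partial>lebesgue)" for R
    define F where "F = stopping_cells c0 r0 bad"
    have F: "countable F" "disjoint F" "F \<subseteq> sets lebesgue" "\<Union>F \<subseteq> Q"
      unfolding F_def Q by (rule stopping_cells_family[OF r0])+
    have UF[measurable]: "\<Union>F \<in> sets lebesgue" using F(1,3) by (intro sets.countable_Union)
    have Qm[measurable]: "Q \<in> sets lebesgue" by (simp add: Q)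
    have dF: "disjoint_family_on (\<lambda>R. R) F"
      using F(2) by (auto simp: disjoint_family_on_def disjoint_def)
    have Q\<tau>: "(\<integral>\<^sup>+x\<in>Q. ennreal \<tau> \<partial>lebesgue) = ennreal (\<tau> * v)"
      using v \<tau> by (simp add: nn_integral_const_set ennreal_mult Q)
    have not_bad_Q: "\<not> bad (hcube c0 r0)"
    proof -
      have "ennreal (\<tau> * v / 2) \<le> ennreal (\<tau> * v)" using \<tau>(1) v(1) by (intro ennreal_leI) simp
      then show ?thesis unfolding bad_def Q[symmetric] Q\<tau> using IQ by (simp add: not_less order_trans)
    qed
    have F\<Q>: "F \<subseteq> {hcube c r | c r. 0 < r \<and> hcube c r \<subseteq> hcube a l}"
    proof
      fix R assume R: "R \<in> F"
      then obtain c r where cr: "0 < r" "R = hcube c r" using stopping_cellsD(5)[OF r0] F_def by blast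
      have "R \<subseteq> hcube a l" using R F(4) Qsub by blast
      then show "R \<in> {hcube c r | c r. 0 < r \<and> hcube c r \<subseteq> hcube a l}" using cr by blast
    qed
    have small: "emeasure lebesgue (\<Union>F) \<le> emeasure lebesgue Q / 2"
    proof -
      have "ennreal \<tau> * emeasure lebesgue (\<Union>F) = (\<integral>\<^sup>+x\<in>\<Union>F. ennreal \<tau> \<partial>lebesgue)"
        by (rule nn_integral_const_set[symmetric]) (rule UF)
      also have "\<dots> \<le> (\<integral>\<^sup>+x\<in>\<Union>F. ennreal (osc s f Q x) \<partial>lebesgue)"
      proof (rule nn_integral_disjoint_sets_le[OF F(1-3)])
        fix R assume "R \<in> F"
        then have "bad R" using stopping_cellsD(1)[OF r0] F_def by blast
        then show "(\<integral>\<^sup>+x\<in>R. ennreal \<tau> \<partial>lebesgue) \<le> (\<integral>\<^sup>+x\<in>R. ennreal (osc s f Q x) \<partial>lebesgue)"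
          unfolding bad_def by (rule less_imp_le)
      qed simp_all
      also have "\<dots> \<le> (\<integral>\<^sup>+x\<in>Q. ennreal (osc s f Q x) \<partial>lebesgue)" by (rule nn_set_integral_mono[OF F(4)])
      also have "\<dots> \<le> ennreal (\<tau> * v / 2)" by (rule IQ)
      finally have "emeasure lebesgue (\<Union>F) \<le> ennreal (\<tau> * v / 2 / \<tau>)"
        by (rule ennreal_le_divideI) (use \<tau>(1) v(1) in simp_all)
      also have "\<dots> = emeasure lebesgue Q / 2" using \<tau> v by (simp add: ennreal_divide_numeral)
      finally show ?thesis .
    qed
    have out: "AE x in lebesgue. x \<in> Q - \<Union>F \<longrightarrow> ennreal (osc s f Q x) \<le> ennreal \<tau>"
    proof (rule AE_le_of_cells[OF r0])
      show "Q - \<Union>F \<subseteq> hcube c0 r0" by (auto simp: Q)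
      show "(\<integral>\<^sup>+x\<in>hcube c0 r0. ennreal \<tau> \<partial>lebesgue) < \<infinity>" using Q\<tau> by (simp add: Q)
      fix x k assume "x \<in> Q - \<Union>F"
      then have "\<not> bad (cell c0 r0 k x)" using not_bad_outside_stopping[of x c0 r0 bad k] unfolding F_def Q by simp
      then show "(\<integral>\<^sup>+y\<in>cell c0 r0 k x. ennreal (osc s f Q y) \<partial>lebesgue) \<le> (\<integral>\<^sup>+y\<in>cell c0 r0 k x. ennreal \<tau> \<partial>lebesgue)"
        unfolding bad_def not_less .
    qed simp_all
    have diff: "norm (poly_proj s (closure R) f x - poly_proj s (closure Q) f x) \<le> T * \<tau>"
      if R: "R \<in> F" and x: "x \<in> R" for R x
    proof -
      obtain c r c' where P: "0 < r" "R = hcube c r" "hcube c r \<subseteq> hcube c' (2 * r)" "hcube c' (2 * r) \<subseteq> hcube c0 r0"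
          "\<not> bad (hcube c' (2 * r))"
        using stopping_cells_parent[OF r0 R[unfolded F_def] not_bad_Q] by blast
      let ?d = "norm (poly_proj s (closure R) f x - poly_proj s (closure Q) f x)"
      have xR: "x \<in> ccube c r" using x P hcube_sub_ccube by blast
      have "ennreal ?d * ennreal (r ^ CARD('n))
          \<le> ennreal KP * (\<integral>\<^sup>+z\<in>hcube c r. ennreal (osc s f Q z) \<partial>lebesgue)"
        using poly_proj_diff_bound[OF P(1) f poly_proj_polys[OF r0 f] xR, of s c0]
        by (simp add: P(2) Q closure_hcube[OF P(1)] closure_hcube[OF r0] KP_def osc_def)
      also have "(\<integral>\<^sup>+z\<in>hcube c r. ennreal (osc s f Q z) \<partial>lebesgue) \<le> (\<integral>\<^sup>+z\<in>hcube c' (2 * r). ennreal (osc s f Q z) \<partial>lebesgue)"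
        by (rule nn_set_integral_mono[OF P(3)])
      also have "\<dots> \<le> (\<integral>\<^sup>+z\<in>hcube c' (2 * r). ennreal \<tau> \<partial>lebesgue)" using P(5) by (simp add: bad_def not_less)
      also have "\<dots> = ennreal (\<tau> * (2 * r) ^ CARD('n))"
        using P(1) \<tau>(1) by (subst nn_integral_const_set) (simp_all add: emeasure_hcube ennreal_mult)
      finally have "ennreal (?d * r ^ CARD('n)) \<le> ennreal (KP * (\<tau> * (2 * r) ^ CARD('n)))"
        using P(1) \<tau>(1) KP by (simp add: ennreal_mult mult_left_mono)
      then have "?d * r ^ CARD('n) \<le> KP * (\<tau> * (2 * r) ^ CARD('n))"
        using P(1) \<tau>(1) KP by (subst (asm) ennreal_le_iff) simp_all
      also have "\<dots> = T * \<tau> * r ^ CARD('n)" by (simp add: T_def power_mult_distrib mult_ac)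
      finally show ?thesis using P(1) by simp
    qed
    define H where "H = \<kappa>' * (T * \<tau>) powr q"
    have H0: "0 \<le> H" using \<kappa>' by (simp add: H_def)
    define h where "h x = ennreal (H * \<omega> x powr (1 - q))" for x
    show "\<exists>F h. countable F \<and> disjoint F \<and> F \<subseteq> {hcube c r | c r. 0 < r \<and> hcube c r \<subseteq> hcube a l} \<and> \<Union>F \<subseteq> Q
        \<and> emeasure lebesgue (\<Union>F) \<le> emeasure lebesgue Q / 2 \<and> h \<in> borel_measurable lebesgue
        \<and> (AE x in lebesgue. x \<in> Q - \<Union>F \<longrightarrow> ennreal (osc s f Q x powr q * \<omega> x powr (1 - q)) \<le> h x)
        \<and> (\<forall>R\<in>F. AE x in lebesgue. x \<in> R \<longrightarrow> ennreal (osc s f Q x powr q * \<omega> x powr (1 - q))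
              \<le> ennreal \<kappa> * ennreal (osc s f R x powr q * \<omega> x powr (1 - q)) + h x)
        \<and> (\<integral>\<^sup>+x\<in>Q. h x \<partial>lebesgue) \<le> ennreal M * ennreal (K powr q * w Q)
        \<and> ennreal \<kappa> * (\<integral>\<^sup>+R. ennreal (K powr q * w R) \<partial>count_space F) \<le> ennreal (sqrt \<delta>) * ennreal (K powr q * w Q)"
    proof (intro exI[of _ F] exI[of _ h] conjI F(1,2,4) F\<Q> small ballI)
      show "h \<in> borel_measurable lebesgue" unfolding h_def by measurable
      show "AE x in lebesgue. x \<in> Q - \<Union>F \<longrightarrow> ennreal (osc s f Q x powr q * \<omega> x powr (1 - q)) \<le> h x"
        using out
      proof eventually_elim
        fix x assume *: "x \<in> Q - \<Union>F \<longrightarrow> ennreal (osc s f Q x) \<le> ennreal \<tau>"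
        show "x \<in> Q - \<Union>F \<longrightarrow> ennreal (osc s f Q x powr q * \<omega> x powr (1 - q)) \<le> h x"
        proof
          assume "x \<in> Q - \<Union>F"
          then have "osc s f Q x \<le> \<tau>" using * \<tau>(1) by simp
          also have "\<tau> \<le> T * \<tau>" using T \<tau>(1) by simp
          finally have "osc s f Q x powr q \<le> (T * \<tau>) powr q" using q by (intro powr_mono2) simp_all
          also have "\<dots> \<le> H" unfolding H_def using \<kappa>' by (simp add: mult_le_cancel_right1)
          finally show "ennreal (osc s f Q x powr q * \<omega> x powr (1 - q)) \<le> h x"
            unfolding h_def by (intro ennreal_leI mult_right_mono) simp_all
        qed
      qed
    next
      fix R assume R: "R \<in> F"
      show "AE x in lebesgue. x \<in> R \<longrightarrow> ennreal (osc s f Q x powr q * \<omega> x powr (1 - q))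
              \<le> ennreal \<kappa> * ennreal (osc s f R x powr q * \<omega> x powr (1 - q)) + h x"
      proof (intro AE_I2 impI)
        fix x assume x: "x \<in> R"
        have "f x - poly_proj s (closure Q) f x
            = (poly_proj s (closure R) f x - poly_proj s (closure Q) f x) + (f x - poly_proj s (closure R) f x)" by simp
        then have "osc s f Q x \<le> norm (poly_proj s (closure R) f x - poly_proj s (closure Q) f x) + osc s f R x"
          unfolding osc_def by (metis norm_triangle_ineq)
        also have "\<dots> \<le> T * \<tau> + osc s f R x" using diff[OF R x] by simp
        finally have "osc s f Q x powr q \<le> (T * \<tau> + osc s f R x) powr q" using q by (intro powr_mono2) simp_all
        also have "\<dots> \<le> \<kappa>' * (T * \<tau>) powr q + \<kappa> * osc s f R x powr q"
          unfolding \<kappa>'_def \<eta>(2)[symmetric] using T \<tau>(1) \<eta>(1) q by (intro powr_add_le) simp_all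
        finally have "osc s f Q x powr q \<le> H + \<kappa> * osc s f R x powr q" by (simp add: H_def)
        then have "osc s f Q x powr q * \<omega> x powr (1 - q) \<le> (H + \<kappa> * osc s f R x powr q) * \<omega> x powr (1 - q)"
          by (rule mult_right_mono) simp
        also have "\<dots> = \<kappa> * (osc s f R x powr q * \<omega> x powr (1 - q)) + H * \<omega> x powr (1 - q)"
          by (simp add: algebra_simps)
        finally have "ennreal (osc s f Q x powr q * \<omega> x powr (1 - q))
            \<le> ennreal (\<kappa> * (osc s f R x powr q * \<omega> x powr (1 - q)) + H * \<omega> x powr (1 - q))" by (rule ennreal_leI)
        also have "\<dots> = ennreal \<kappa> * ennreal (osc s f R x powr q * \<omega> x powr (1 - q)) + h x"
          unfolding h_def using \<kappa>(1) H0
          by (subst ennreal_plus) (simp_all add: ennreal_mult' del: ennreal_mult'')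
        finally show "ennreal (osc s f Q x powr q * \<omega> x powr (1 - q))
              \<le> ennreal \<kappa> * ennreal (osc s f R x powr q * \<omega> x powr (1 - q)) + h x" .
      qed
    next
      have "(\<integral>\<^sup>+x\<in>Q. h x \<partial>lebesgue) = ennreal H * (\<integral>\<^sup>+x\<in>Q. ennreal (\<omega> x powr (1 - q)) \<partial>lebesgue)"
        unfolding h_def using H0 by (simp add: ennreal_mult nn_integral_cmult mult.assoc)
      also have "\<dots> = ennreal \<kappa>' * (ennreal ((2 * T * K * (w Q / v)) powr q) * (\<integral>\<^sup>+x\<in>Q. ennreal (\<omega> x powr (1 - q)) \<partial>lebesgue))"
        using \<kappa>' by (simp add: H_def \<tau>_def ennreal_mult' mult_ac)
      also have "\<dots> \<le> ennreal \<kappa>' * ennreal (C0 * (2 * T * K) powr q * w Q)"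
        unfolding Q v_def using C0 r0 r1 T K by (intro mult_left_mono power_bound_mean) simp_all
      also have "\<dots> = ennreal (\<kappa>' * (C0 * (2 * T * K) powr q * w Q))"
        using \<kappa>' by (simp add: ennreal_mult')
      also have "\<kappa>' * (C0 * (2 * T * K) powr q * w Q) = M * (K powr q * w Q)"
        using T K powr_mult[of "2 * T" K q] powr_mult[of 2 T q] by (simp add: M_def mult_ac)
      also have "ennreal (M * (K powr q * w Q)) = ennreal M * ennreal (K powr q * w Q)"
        using M by (simp add: ennreal_mult')
      finally show "(\<integral>\<^sup>+x\<in>Q. h x \<partial>lebesgue) \<le> ennreal M * ennreal (K powr q * w Q)" .
    next
      have "(\<integral>\<^sup>+R. ennreal (K powr q * w R) \<partial>count_space F) = (\<integral>\<^sup>+R. ennreal (K powr q) * (\<integral>\<^sup>+x\<in>R. ennreal (\<omega> x) \<partial>lebesgue) \<partial>count_space F)"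
      proof (rule nn_integral_cong)
        fix R assume "R \<in> space (count_space F)"
        then have "R \<subseteq> hcube a l" using F(4) Qsub by auto
        then have "ennreal (w R) = (\<integral>\<^sup>+x\<in>R. ennreal (\<omega> x) \<partial>lebesgue)" using wmeas_eq_w[of R a l] by (simp add: wmeas_def)
        then show "ennreal (K powr q * w R) = ennreal (K powr q) * (\<integral>\<^sup>+x\<in>R. ennreal (\<omega> x) \<partial>lebesgue)"
          by (simp add: ennreal_mult)
      qed
      also have "\<dots> = ennreal (K powr q) * wmeas \<omega> (\<Union>F)"
        using nn_integral_countable_family_eq[OF F(1) dF, of lebesgue "\<lambda>x. ennreal (\<omega> x)"] F(3)
        by (simp add: nn_integral_cmult subset_iff wmeas_def)
      also have "wmeas \<omega> (\<Union>F) = ennreal (w (\<Union>F))" using F(4) unfolding Q by (rule wmeas_eq_w)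
      also have "ennreal (K powr q) * ennreal (w (\<Union>F)) \<le> ennreal (K powr q) * ennreal (\<delta> * w Q)"
        using \<delta>(3)[OF r0 r1 UF] F(4) small unfolding Q by (intro mult_left_mono ennreal_leI) simp_all
      finally have "ennreal \<kappa> * (\<integral>\<^sup>+R. ennreal (K powr q * w R) \<partial>count_space F)
          \<le> ennreal \<kappa> * (ennreal (K powr q) * ennreal (\<delta> * w Q))" by (intro mult_left_mono) simp_all
      also have "\<dots> = ennreal (\<kappa> * (K powr q * (\<delta> * w Q)))"
        using \<kappa>(1) \<delta>(1) by (simp add: ennreal_mult)
      also have "\<kappa> * (K powr q * (\<delta> * w Q)) = sqrt \<delta> * (K powr q * w Q)"
        unfolding \<kappa>(2)[symmetric] by simp
      also have "ennreal \<dots> = ennreal (sqrt \<delta>) * ennreal (K powr q * w Q)"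
        using \<delta>(1) by (simp add: ennreal_mult)
      finally show "ennreal \<kappa> * (\<integral>\<^sup>+R. ennreal (K powr q * w R) \<partial>count_space F)
          \<le> ennreal (sqrt \<delta>) * ennreal (K powr q * w Q)" .
    qed
  next
    show "ennreal M + ennreal (sqrt \<delta>) * ennreal B \<le> ennreal B"
      using B M \<delta>(1) by (simp add: ennreal_mult[symmetric] ennreal_plus[symmetric] del: ennreal_plus)
  next
    fix Q assume "Q \<in> {hcube c r | c r. 0 < r \<and> hcube c r \<subseteq> hcube a l}"
    then obtain c r where Q: "Q = hcube c r" "0 < r" by blast
    show "Q \<in> sets lebesgue" "emeasure lebesgue Q < \<infinity>" using Q by (simp_all add: emeasure_hcube)
    have [measurable]: "osc s f Q \<in> borel_measurable lebesgue" unfolding Q(1) by (rule osc_measurable[OF Q(2) f])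
    show "(\<lambda>x. ennreal (osc s f Q x powr q * \<omega> x powr (1 - q))) \<in> borel_measurable lebesgue" by measurable
  qed (use l0 in blast)
  show ?thesis
  proof (intro exI[of _ B] conjI allI impI)
    fix f :: "real ^ 'n \<Rightarrow> 'a" and K a l
    assume *: "locally_integrable f" "0 < K" "0 < l" "l \<le> 1" "osc_bound s f K (hcube a l)"
    show "(\<integral>\<^sup>+x\<in>hcube a l. ennreal (osc s f (hcube a l) x powr q * \<omega> x powr (1 - q)) \<partial>lebesgue)
      \<le> ennreal (B * K powr q * w (hcube a l))"
      using main[OF *] B(1) by (simp add: ennreal_mult' mult.assoc)
  qed (rule B(1))
qed

end

section \<open>The growth function\<close>

text \<open>Strictly lower type \<open>p > 0\<close> forces \<open>\<Phi>(t) \<rightarrow> 0\<close> for \<open>t \<rightarrow> 0\<close> and \<open>\<Phi>(1/t) \<ge> t\<^sup>-\<^sup>p \<Phi>(1) \<rightarrow> \<infinity>\<close>; the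
  intermediate value theorem does the rest.\<close>

lemma assumption_A_surj:
  assumes A: "assumption_A \<Phi>" and u: "0 < u"
  shows "\<exists>y>0. \<Phi> y = u"
proof -
  have pos: "0 < \<Phi> t" if "0 < t" for t using A that by (simp add: assumption_A_def)
  obtain p where p: "0 < p" "strictly_lower_type p \<Phi>" using A unfolding assumption_A_def by blast
  have lt: "\<Phi> (s * t) \<le> t powr p * \<Phi> s" if "0 < t" "t < 1" "0 < s" for s t
    using p(2) that by (simp add: strictly_lower_type_def)
  have small: "\<exists>t. 0 < t \<and> t < 1 \<and> t powr p \<le> e" if "0 < e" for e :: real
  proof (intro exI conjI)
    show "0 < min (1 / 2) (e powr (1 / p))" "min (1 / 2) (e powr (1 / p)) < 1" using that by simp_all
    have "min (1 / 2) (e powr (1 / p)) powr p \<le> (e powr (1 / p)) powr p"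
      using that p(1) by (intro powr_mono2) simp_all
    also have "\<dots> = e" using that p(1) by (simp add: powr_powr)
    finally show "min (1 / 2) (e powr (1 / p)) powr p \<le> e" .
  qed
  obtain t where t: "0 < t" "t < 1" "t powr p \<le> u / \<Phi> 1" using small[of "u / \<Phi> 1"] u pos[of 1] by auto
  have lo: "\<Phi> t \<le> u"
    using lt[OF t(1,2), of 1] mult_right_mono[OF t(3), of "\<Phi> 1"] pos[of 1] by simp
  obtain r where r: "0 < r" "r < 1" "r powr p \<le> \<Phi> 1 / u" using small[of "\<Phi> 1 / u"] u pos[of 1] by auto
  have "\<Phi> 1 \<le> r powr p * \<Phi> (1 / r)" using lt[OF r(1,2), of "1 / r"] r(1) by simp
  also have "\<dots> \<le> \<Phi> 1 / u * \<Phi> (1 / r)" using pos[of "1 / r"] r by (intro mult_right_mono) simp_all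
  finally have hi: "u \<le> \<Phi> (1 / r)" using u pos[of 1] by (simp add: field_simps)
  have "1 \<le> 1 / r" using r by simp
  then have "t \<le> 1 / r" using t(2) by linarith
  moreover have "continuous_on {t..1 / r} \<Phi>"
  proof (rule continuous_on_subset)
    show "continuous_on {0<..} \<Phi>" using A by (simp add: assumption_A_def)
    show "{t..1 / r} \<subseteq> {0<..}" using t(1) by auto
  qed
  ultimately obtain y where "t \<le> y" "\<Phi> y = u" using IVT'[of \<Phi> t u "1 / r"] lo hi by blast
  then show ?thesis using t(1) by (intro exI[of _ y]) simp
qed

text \<open>For a positive concave \<open>\<Phi>\<close> the ratio \<open>\<Phi>(y) / y\<close> is nonincreasing: compare with the chord from \<open>(e, \<Phi>(e))\<close> for small
  \<open>e > 0\<close> and drop the positive term \<open>\<Phi>(e)\<close>. The value of \<open>e\<close> in the proof is a quantitative choice of \<open>e \<rightarrow> 0\<close>.\<close>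

lemma concave_ratio_antimono:
  fixes \<Phi> :: "real \<Rightarrow> real"
  assumes c: "concave_on {0<..} \<Phi>" and pos: "\<And>t. 0 < t \<Longrightarrow> 0 < \<Phi> t" and xy: "0 < x" "x \<le> y"
  shows "x * \<Phi> y \<le> y * \<Phi> x"
proof (rule ccontr)
  assume n: "\<not> ?thesis"
  then have "x < y" using xy by (cases "x = y") auto
  have y: "0 < \<Phi> y" "0 < \<Phi> x" using pos xy by simp_all
  define e where "e = (x * \<Phi> y - y * \<Phi> x) / (2 * \<Phi> y)"
  have e: "0 < e" "2 * (e * \<Phi> y) = x * \<Phi> y - y * \<Phi> x" using n y by (simp_all add: e_def)
  have "0 < y * \<Phi> x" using y xy by simp
  then have "2 * (e * \<Phi> y) < x * \<Phi> y" using e by simp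
  then have "2 * e < x" using y(1) by (simp add: mult.assoc[symmetric])
  then have ex: "e < x" using e(1) by simp
  define t where "t = (x - e) / (y - e)"
  have t: "0 \<le> t" "t \<le> 1" "t * (y - e) = x - e" using ex \<open>x < y\<close> by (simp_all add: t_def)
  have "(1 - t) * \<Phi> e + t * \<Phi> y \<le> \<Phi> ((1 - t) *\<^sub>R e + t *\<^sub>R y)"
    using t e(1) xy by (intro concave_onD[OF c]) simp_all
  also have "(1 - t) *\<^sub>R e + t *\<^sub>R y = x" using t(3) by (simp add: algebra_simps)
  finally have "t * \<Phi> y \<le> \<Phi> x" using t(2) pos[OF e(1)] by (smt (verit) mult_nonneg_nonneg)
  then have "t * \<Phi> y * (y - e) \<le> \<Phi> x * (y - e)" using ex \<open>x < y\<close> by (intro mult_right_mono) simp_all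
  moreover have "t * \<Phi> y * (y - e) = (x - e) * \<Phi> y" unfolding t(3)[symmetric] by simp
  ultimately have "(x - e) * \<Phi> y \<le> \<Phi> x * (y - e)" by simp
  also have "\<dots> \<le> \<Phi> x * y" using y(2) e(1) by simp
  finally have "x * \<Phi> y - y * \<Phi> x \<le> e * \<Phi> y" by (simp add: algebra_simps)
  moreover have "0 < e * \<Phi> y" using e(1) y(1) by simp
  ultimately show False using e(2) by linarith
qed

text \<open>\<open>\<rho>(t) = \<Phi>(y) / y\<close> for the \<open>y\<close> with \<open>\<Phi>(y) = 1/t\<close>, and \<open>y\<close> decreases as \<open>t\<close> grows.\<close>

lemma rho_pos_mono:
  assumes A: "assumption_A \<Phi>"
  shows "0 < t \<Longrightarrow> 0 < rho \<Phi> t" and "0 < r \<Longrightarrow> r \<le> t \<Longrightarrow> rho \<Phi> r \<le> rho \<Phi> t"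
proof -
  have pos: "0 < \<Phi> t" if "0 < t" for t using A that by (simp add: assumption_A_def)
  have conc: "concave_on {0<..} \<Phi>" using A by (simp add: assumption_A_def)
  have mono: "strict_mono_on {0<..} \<Phi>" using A by (simp add: assumption_A_def)
  then have inj: "inj_on \<Phi> {0<..}" by (rule strict_mono_on_imp_inj_on)
  have ex: "\<exists>y>0. \<Phi> y = inverse t \<and> rho \<Phi> t = \<Phi> y / y" if t: "0 < t" for t
  proof -
    obtain y where y: "0 < y" "\<Phi> y = inverse t" using assumption_A_surj[OF A, of "inverse t"] t by auto
    have "the_inv_into {0<..} \<Phi> (\<Phi> y) = y" by (rule the_inv_into_f_f[OF inj]) (simp add: y(1))
    then show ?thesis using y by (intro exI[of _ y]) (simp add: rho_def)
  qed
  show "0 < rho \<Phi> t" if "0 < t" using ex[OF that] pos by (metis divide_pos_pos)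
  show "rho \<Phi> r \<le> rho \<Phi> t" if rt: "0 < r" "r \<le> t"
  proof -
    obtain x where x: "0 < x" "\<Phi> x = inverse r" "rho \<Phi> r = \<Phi> x / x" using ex[OF rt(1)] by blast
    obtain y where y: "0 < y" "\<Phi> y = inverse t" "rho \<Phi> t = \<Phi> y / y" using ex[of t] rt by auto
    have "\<Phi> y \<le> \<Phi> x" using rt x y by (simp add: le_imp_inverse_le)
    then have "y \<le> x" using mono x(1) y(1) by (meson greaterThan_iff leD not_le strict_mono_onD)
    from concave_ratio_antimono[OF conc pos y(1) this] show ?thesis
      unfolding x(3) y(3) using x(1) y(1) by (simp add: divide_simps mult.commute)
  qed
qed

section \<open>Comparison of the norms\<close>

lemma wmean_le_iff:
  assumes q: "1 \<le> q" and t: "0 < t" and W: "wmeas \<omega> E = ennreal W" "0 < W" and \<rho>: "0 < \<rho> W"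
  shows "wmean \<rho> \<omega> q E g \<le> ennreal t \<longleftrightarrow>
    (\<integral>\<^sup>+x\<in>E. ennreal (norm (g x) powr q) * epow (ennreal (\<omega> x)) (1 - q) \<partial>lebesgue) \<le> ennreal ((t * \<rho> W) powr q * W)"
    (is "_ \<longleftrightarrow> ?I \<le> _")
proof -
  have inv: "1 / ennreal W = ennreal (1 / W)" using W(2) divide_ennreal[of 1 W] by simp
  have "wmean \<rho> \<omega> q E g \<le> ennreal t \<longleftrightarrow> ennreal (1 / \<rho> W) * epow (ennreal (1 / W) * ?I) (1 / q) \<le> ennreal t"
    unfolding wmean_def W(1) inv using W(2) by simp
  also have "\<dots> \<longleftrightarrow> epow (ennreal (1 / W) * ?I) (1 / q) \<le> ennreal (t * \<rho> W)"
    using t \<rho> by (subst ennreal_mult_le_iff_divide) simp_all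
  also have "\<dots> \<longleftrightarrow> ennreal (1 / W) * ?I \<le> ennreal ((t * \<rho> W) powr q)"
    using t \<rho> q by (subst epow_le_iff) simp_all
  also have "\<dots> \<longleftrightarrow> ?I \<le> ennreal ((t * \<rho> W) powr q * W)"
    using W(2) by (subst ennreal_mult_le_iff_divide) simp_all
  finally show ?thesis .
qed

lemma wmean_one_le_iff:
  assumes t: "0 < t" and W: "wmeas \<omega> E = ennreal W" "0 < W" and \<rho>: "0 < \<rho> W"
  shows "wmean \<rho> \<omega> 1 E g \<le> ennreal t \<longleftrightarrow> (\<integral>\<^sup>+x\<in>E. ennreal (norm (g x)) \<partial>lebesgue) \<le> ennreal (t * \<rho> W * W)"
  using wmean_le_iff[of 1, OF order_refl t W, of \<rho> g] t \<rho> by (simp add: epow_def)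

text \<open>Bounds on the norms are proved for real \<open>t > 0\<close> with the norm at most \<open>t\<close>, because the stopping
  thresholds must be positive while the norm may vanish.\<close>

lemma ennreal_le_mult_of_real_bounds:
  fixes X Y :: ennreal
  assumes D: "0 < D" and le: "\<And>t. 0 < t \<Longrightarrow> X \<le> ennreal t \<Longrightarrow> Y \<le> ennreal (D * t)"
  shows "Y \<le> ennreal D * X"
proof (cases X)
  case (real x)
  show ?thesis
  proof (rule ennreal_le_epsilon)
    fix e :: real assume e: "0 < e"
    have "Y \<le> ennreal (D * (x + e / D))"
      using e D real by (intro le) (simp_all add: add_nonneg_pos ennreal_leI)
    also have "D * (x + e / D) = D * x + e" using D by (simp add: distrib_left)
    also have "ennreal (D * x + e) = ennreal D * X + ennreal e"
      using e D real by (simp add: ennreal_mult)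
    finally show "Y \<le> ennreal D * X + ennreal e" .
  qed
next
  case top
  then show ?thesis using D by (simp add: ennreal_mult_top)
qed

text \<open>Each of the three parts of the norm is at most \<open>t\<close>; up to the factor \<open>3\<close> this says that the norm is at
  most \<open>t\<close>.\<close>

definition bmo_le ::
    "nat \<Rightarrow> (real \<Rightarrow> real) \<Rightarrow> (real ^ 'n \<Rightarrow> real) \<Rightarrow> real \<Rightarrow> (real ^ 'n \<Rightarrow> 'a::{real_normed_field, euclidean_space}) \<Rightarrow> real \<Rightarrow> bool"
  where "bmo_le s \<rho> \<omega> q f t \<longleftrightarrow>
    (\<forall>a l. 0 < l \<longrightarrow> l < 1 \<longrightarrow> wmean \<rho> \<omega> q (ccube a l) (\<lambda>x. f x - poly_proj s (ccube a l) f x) \<le> ennreal t) \<and>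
    (\<forall>a l. 1 \<le> l \<longrightarrow> wmean \<rho> \<omega> q (ccube a l) f \<le> ennreal t) \<and>
    (wmeas \<omega> UNIV < \<infinity> \<longrightarrow> wmean \<rho> \<omega> q UNIV f \<le> ennreal t)"

lemma ccube_small_iff:
  fixes a :: "real ^ 'n"
  assumes "0 < l" shows "emeasure lebesgue (ccube a l) < 1 \<longleftrightarrow> l < 1"
proof -
  have "emeasure lebesgue (ccube a l) < 1 \<longleftrightarrow> l ^ CARD('n) < 1"
    using assms by (simp add: emeasure_ccube ennreal_less_one_iff)
  also have "\<dots> \<longleftrightarrow> l < 1" using assms by (simp add: power_less_one_iff)
  finally show ?thesis .
qed

lemma bmo_norm_imp_bmo_le:
  fixes f :: "real ^ 'n \<Rightarrow> 'a::{real_normed_field, euclidean_space}"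
  assumes "bmo_norm s \<rho> \<omega> q f \<le> ennreal t"
  shows "bmo_le s \<rho> \<omega> q f t"
proof -
  define X where "X = (SUP Q \<in> {Q \<in> cubes. emeasure lebesgue Q < 1}. wmean \<rho> \<omega> q Q (\<lambda>x. f x - poly_proj s Q f x))"
  define Y where "Y = (SUP Q \<in> {Q \<in> cubes. emeasure lebesgue Q \<ge> 1}. wmean \<rho> \<omega> q Q f)"
  define Z where "Z = (if wmeas \<omega> UNIV < \<infinity> then wmean \<rho> \<omega> q UNIV f else 0)"
  have sum: "X + Y + Z \<le> ennreal t" using assms by (simp only: bmo_norm_def X_def Y_def Z_def)
  have "X \<le> X + Y + Z" "Y \<le> X + Y + Z" "Z \<le> X + Y + Z"
    by (simp_all add: add_increasing add_increasing2)
  then have *: "X \<le> ennreal t" "Y \<le> ennreal t" "Z \<le> ennreal t" using sum by (meson order_trans)+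
  show ?thesis unfolding bmo_le_def
  proof (intro conjI allI impI)
    fix a :: "real ^ 'n" and l :: real assume "0 < l" "l < 1"
    then have "ccube a l \<in> {Q \<in> cubes. emeasure lebesgue Q < 1}"
      by (simp add: ccube_in_cubes ccube_small_iff)
    then show "wmean \<rho> \<omega> q (ccube a l) (\<lambda>x. f x - poly_proj s (ccube a l) f x) \<le> ennreal t"
      using *(1) unfolding X_def SUP_le_iff by blast
  next
    fix a :: "real ^ 'n" and l :: real assume "1 \<le> l"
    then have "ccube a l \<in> {Q \<in> cubes. emeasure lebesgue Q \<ge> 1}"
      using ccube_small_iff[of l a] by (simp add: ccube_in_cubes not_less[symmetric])
    then show "wmean \<rho> \<omega> q (ccube a l) f \<le> ennreal t"
      using *(2) unfolding Y_def SUP_le_iff by blast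
  next
    assume "wmeas \<omega> UNIV < \<infinity>"
    then show "wmean \<rho> \<omega> q UNIV f \<le> ennreal t" using *(3) by (simp add: Z_def)
  qed
qed

lemma bmo_le_imp_bmo_norm:
  assumes "bmo_le s \<rho> \<omega> q f t" "0 \<le> t"
  shows "bmo_norm s \<rho> \<omega> q f \<le> ennreal (3 * t)"
proof -
  have 1: "(SUP Q \<in> {Q \<in> cubes. emeasure lebesgue Q < 1}. wmean \<rho> \<omega> q Q (\<lambda>x. f x - poly_proj s Q f x)) \<le> ennreal t"
    using assms(1) unfolding bmo_le_def by (intro SUP_least) (auto simp: cubes_eq ccube_small_iff)
  have 2: "(SUP Q \<in> {Q \<in> cubes. emeasure lebesgue Q \<ge> 1}. wmean \<rho> \<omega> q Q f) \<le> ennreal t"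
    using assms(1) unfolding bmo_le_def
    by (intro SUP_least) (auto simp: cubes_eq ccube_small_iff not_less[symmetric])
  have 3: "(if wmeas \<omega> UNIV < \<infinity> then wmean \<rho> \<omega> q UNIV f else 0) \<le> ennreal t"
    using assms(1) unfolding bmo_le_def by simp
  have "bmo_norm s \<rho> \<omega> q f \<le> ennreal t + ennreal t + ennreal t"
    unfolding bmo_norm_def by (intro add_mono 1 2 3)
  also have "\<dots> = ennreal (3 * t)" using assms(2) by (simp add: ennreal_plus[symmetric] del: ennreal_plus)
  finally show ?thesis .
qed

context A_inf_weight begin

lemma w_UNIV:
  assumes "wmeas \<omega> UNIV < \<infinity>"
  shows "wmeas \<omega> UNIV = ennreal (w UNIV)" "0 < w UNIV" "w R \<le> w UNIV"
proof -
  show e: "wmeas \<omega> UNIV = ennreal (w UNIV)" using assms by (simp add: w_def)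
  have le: "wmeas \<omega> R \<le> wmeas \<omega> UNIV" for R by (rule wmeas_mono) simp
  show "0 < w UNIV" using less_le_trans[OF wmeas_pos[of 1 0] le] unfolding e by simp
  show "w R \<le> w UNIV" unfolding w_def by (rule enn2real_mono[OF le]) (use assms in simp)
qed

text \<open>Hoelder's inequality in the form of the pointwise bound
  \<open>g \<le> \<tau> \<omega> + \<tau>\<^sup>1\<^sup>-\<^sup>q g\<^sup>q \<omega>\<^sup>1\<^sup>-\<^sup>q\<close>. The hypothesis makes both terms integrate to at most \<open>\<tau> W\<close>.\<close>

lemma mean_le_dual_mean:
  fixes g :: "real ^ 'n \<Rightarrow> real"
  assumes q: "1 < q" and \<tau>: "0 < \<tau>" and E: "E \<in> sets lebesgue" and W: "wmeas \<omega> E = ennreal W" "0 \<le> W"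
    and g: "g \<in> borel_measurable lebesgue" "\<And>x. 0 \<le> g x"
    and le: "(\<integral>\<^sup>+x\<in>E. ennreal (g x powr q * \<omega> x powr (1 - q)) \<partial>lebesgue) \<le> ennreal (\<tau> powr q * W)"
  shows "(\<integral>\<^sup>+x\<in>E. ennreal (g x) \<partial>lebesgue) \<le> ennreal (2 * \<tau> * W)"
proof -
  note [measurable] = E g(1)
  have pt: "g x \<le> \<tau> * \<omega> x + \<tau> powr (1 - q) * (g x powr q * \<omega> x powr (1 - q))" if "0 < \<omega> x" for x
  proof (cases "g x \<le> \<tau> * \<omega> x")
    case False
    then have gx: "0 < g x" using that \<tau> by (smt (verit) mult_pos_pos)
    have "g x = g x powr q * g x powr (1 - q)" using gx by (simp add: powr_add[symmetric])
    also have "\<dots> \<le> g x powr q * (\<tau> * \<omega> x) powr (1 - q)"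
      using False that \<tau> q by (intro mult_left_mono powr_mono2') simp_all
    also have "\<dots> = \<tau> powr (1 - q) * (g x powr q * \<omega> x powr (1 - q))"
      using that \<tau> by (simp add: powr_mult)
    finally show ?thesis using \<tau> that by (simp add: add_increasing)
  qed (simp add: add_increasing2)
  have "(\<integral>\<^sup>+x\<in>E. ennreal (g x) \<partial>lebesgue)
      \<le> (\<integral>\<^sup>+x. ennreal \<tau> * (ennreal (\<omega> x) * indicator E x)
           + ennreal (\<tau> powr (1 - q)) * (ennreal (g x powr q * \<omega> x powr (1 - q)) * indicator E x) \<partial>lebesgue)"
  proof (rule nn_integral_mono_AE)
    show "AE x in lebesgue. ennreal (g x) * indicator E x \<le> ennreal \<tau> * (ennreal (\<omega> x) * indicator E x)
           + ennreal (\<tau> powr (1 - q)) * (ennreal (g x powr q * \<omega> x powr (1 - q)) * indicator E x)"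
      using AE_pos
    proof eventually_elim
      fix x assume "0 < \<omega> x"
      then have "ennreal (g x) \<le> ennreal (\<tau> * \<omega> x + \<tau> powr (1 - q) * (g x powr q * \<omega> x powr (1 - q)))"
        by (intro ennreal_leI pt)
      also have "\<dots> = ennreal \<tau> * ennreal (\<omega> x) + ennreal (\<tau> powr (1 - q)) * ennreal (g x powr q * \<omega> x powr (1 - q))"
        using \<tau> by (subst ennreal_plus) (simp_all add: ennreal_mult')
      finally show "ennreal (g x) * indicator E x \<le> ennreal \<tau> * (ennreal (\<omega> x) * indicator E x)
           + ennreal (\<tau> powr (1 - q)) * (ennreal (g x powr q * \<omega> x powr (1 - q)) * indicator E x)"
        by (simp add: indicator_def)
    qed
  qed
  also have "\<dots> = ennreal \<tau> * wmeas \<omega> E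
      + ennreal (\<tau> powr (1 - q)) * (\<integral>\<^sup>+x\<in>E. ennreal (g x powr q * \<omega> x powr (1 - q)) \<partial>lebesgue)"
    by (simp add: nn_integral_add nn_integral_cmult wmeas_def)
  also have "\<dots> \<le> ennreal \<tau> * ennreal W + ennreal (\<tau> powr (1 - q)) * ennreal (\<tau> powr q * W)"
    unfolding W(1) by (intro add_left_mono mult_left_mono le) simp
  also have "\<dots> = ennreal (\<tau> * W) + ennreal (\<tau> powr (1 - q) * (\<tau> powr q * W))"
    using \<tau> W(2) by (simp add: ennreal_mult')
  also have "\<tau> powr (1 - q) * (\<tau> powr q * W) = \<tau> * W"
    using \<tau> by (simp add: mult.assoc[symmetric] powr_add[symmetric])
  also have "ennreal (\<tau> * W) + ennreal (\<tau> * W) = ennreal (2 * \<tau> * W)"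
    using \<tau> W(2) by (simp add: ennreal_plus[symmetric] del: ennreal_plus)
  finally show ?thesis .
qed

lemma epow_dual_integral:
  "(\<integral>\<^sup>+x\<in>E. ennreal (g x powr q) * epow (ennreal (\<omega> x)) (1 - q) \<partial>lebesgue)
     = (\<integral>\<^sup>+x\<in>E. ennreal (g x powr q * \<omega> x powr (1 - q)) \<partial>lebesgue)"
proof (rule nn_integral_cong_AE)
  show "AE x in lebesgue. ennreal (g x powr q) * epow (ennreal (\<omega> x)) (1 - q) * indicator E x
      = ennreal (g x powr q * \<omega> x powr (1 - q)) * indicator E x"
    using AE_epow_weight[of "1 - q"] by eventually_elim (simp add: ennreal_mult)
qed

context
  fixes \<rho> :: "real \<Rightarrow> real"
  assumes \<rho>_pos: "\<And>t. 0 < t \<Longrightarrow> 0 < \<rho> t" and \<rho>_mono: "\<And>r t. 0 < r \<Longrightarrow> r \<le> t \<Longrightarrow> \<rho> r \<le> \<rho> t"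
begin

lemma wmean_one_le:
  fixes g :: "real ^ 'n \<Rightarrow> 'a::{real_normed_vector, second_countable_topology}"
  assumes q: "1 < q" and t: "0 < t" and E: "E \<in> sets lebesgue" and W: "wmeas \<omega> E = ennreal W" "0 < W"
    and g: "(\<lambda>x. norm (g x)) \<in> borel_measurable lebesgue" and le: "wmean \<rho> \<omega> q E g \<le> ennreal t"
  shows "wmean \<rho> \<omega> 1 E g \<le> ennreal (2 * t)"
proof -
  have "(\<integral>\<^sup>+x\<in>E. ennreal (norm (g x) powr q * \<omega> x powr (1 - q)) \<partial>lebesgue) \<le> ennreal ((t * \<rho> W) powr q * W)"
    using le wmean_le_iff[of q t \<omega> E W \<rho> g, OF _ t W \<rho>_pos[OF W(2)]] q unfolding epow_dual_integral by simp
  then have "(\<integral>\<^sup>+x\<in>E. ennreal (norm (g x)) \<partial>lebesgue) \<le> ennreal (2 * (t * \<rho> W) * W)"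
    using t W \<rho>_pos[OF W(2)] by (intro mean_le_dual_mean[OF q _ E W(1) _ g]) simp_all
  then show ?thesis
    using wmean_one_le_iff[of "2 * t" \<omega> E W \<rho> g, OF _ W \<rho>_pos[OF W(2)]] t by (simp add: mult.assoc)
qed

lemma bmo_le_dual_imp_one:
  fixes f :: "real ^ 'n \<Rightarrow> 'a::{real_normed_field, euclidean_space}"
  assumes q: "1 < q" and t: "0 < t" and f: "locally_integrable f" and le: "bmo_le s \<rho> \<omega> q f t"
  shows "bmo_le s \<rho> \<omega> 1 f (2 * t)"
  unfolding bmo_le_def
proof (intro conjI allI impI)
  fix a :: "real ^ 'n" and l :: real assume l: "0 < l" "l < 1"
  have "(\<lambda>x. norm (f x - poly_proj s (ccube a l) f x)) \<in> borel_measurable lebesgue"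
    using osc_measurable[OF l(1) f, of s a] unfolding osc_hcube[OF l(1), abs_def] .
  then show "wmean \<rho> \<omega> 1 (ccube a l) (\<lambda>x. f x - poly_proj s (ccube a l) f x) \<le> ennreal (2 * t)"
    using le l unfolding bmo_le_def
    by (intro wmean_one_le[OF q t ccube_measurable _ w_pos[OF l(1), of a]]) (simp_all add: wmeas_ccube wmeas_hcube)
next
  note [measurable] = locally_integrable_measurable[OF f]
  have fm: "(\<lambda>x. norm (f x)) \<in> borel_measurable lebesgue" by measurable
  {
    fix a :: "real ^ 'n" and l :: real assume l: "1 \<le> l"
    then have l0: "0 < l" by simp
    show "wmean \<rho> \<omega> 1 (ccube a l) f \<le> ennreal (2 * t)"
      using le l unfolding bmo_le_def
      by (intro wmean_one_le[OF q t ccube_measurable _ w_pos[OF l0, of a] fm]) (simp_all add: wmeas_ccube wmeas_hcube)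
  next
    assume fin: "wmeas \<omega> UNIV < \<infinity>"
    show "wmean \<rho> \<omega> 1 UNIV f \<le> ennreal (2 * t)"
      using le fin unfolding bmo_le_def
      by (intro wmean_one_le[OF q t _ w_UNIV(1,2)[OF fin] fm]) simp_all
  }
qed

text \<open>Subcubes have smaller \<open>\<omega>\<close>-mass, so by monotonicity of \<open>\<rho>\<close> one constant serves for all of them.\<close>

lemma bmo_one_osc_bound:
  fixes f :: "real ^ 'n \<Rightarrow> 'a::{real_normed_field, euclidean_space}"
  assumes t: "0 < t" and le: "bmo_le s \<rho> \<omega> 1 f t" and l: "0 < l" "l < 1" and W: "w (hcube a l) \<le> W"
  shows "osc_bound s f (t * \<rho> W) (hcube a l)"
  unfolding osc_bound_def
proof (intro allI impI)
  fix c r assume r: "0 < r" "hcube c r \<subseteq> hcube a l"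
  have r1: "r < 1" using hcube_side_mono[OF r] l by simp
  let ?R = "hcube c r"
  have wR: "0 < w ?R" by (rule w_pos[OF r(1)])
  have "wmean \<rho> \<omega> 1 (ccube c r) (\<lambda>x. f x - poly_proj s (ccube c r) f x) \<le> ennreal t"
    using le r(1) r1 unfolding bmo_le_def by blast
  then have "(\<integral>\<^sup>+x\<in>?R. ennreal (osc s f ?R x) \<partial>lebesgue) \<le> ennreal (t * \<rho> (w ?R) * w ?R)"
    using wmean_one_le_iff[of t \<omega> "ccube c r" "w ?R" \<rho> "\<lambda>x. f x - poly_proj s (ccube c r) f x", OF t _ wR \<rho>_pos[OF wR]]
    unfolding osc_hcube[OF r(1)] nn_integral_hcube_ccube wmeas_ccube wmeas_hcube by simp
  also have "\<rho> (w ?R) \<le> \<rho> W" using order_trans[OF w_mono[OF r(2) order_refl] W] by (rule \<rho>_mono[OF wR])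
  then have "ennreal (t * \<rho> (w ?R) * w ?R) \<le> ennreal (t * \<rho> W * w ?R)"
    using t wR by (intro ennreal_leI mult_right_mono mult_left_mono) simp_all
  finally show "(\<integral>\<^sup>+x\<in>?R. ennreal (osc s f ?R x) \<partial>lebesgue) \<le> ennreal (t * \<rho> W * w ?R)" .
qed

text \<open>A cube of side at least \<open>1\<close> is tiled by its maximal dyadic cells \<open>R\<close> of side less than \<open>1\<close>. The
  oscillation of \<open>f\<close> on \<open>R\<close> is controlled by the John-Nirenberg estimate, and the projection by the mean
  of \<open>|f|\<close> over a unit cube between \<open>R\<close> and the large cube, of comparable weight.\<close>

lemma large_cube_bound:
  assumes q: "1 < q" and C0: "0 < C0" "power_bound (q - 1) C0"
  shows "\<exists>B>0. \<forall>(f :: real ^ 'n \<Rightarrow> 'a::{real_normed_field, euclidean_space}) t a l.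
    locally_integrable f \<longrightarrow> 0 < t \<longrightarrow> bmo_le s \<rho> \<omega> 1 f t \<longrightarrow> 1 \<le> l \<longrightarrow>
    (\<integral>\<^sup>+x\<in>hcube a l. ennreal (norm (f x) powr q * \<omega> x powr (1 - q)) \<partial>lebesgue)
      \<le> ennreal (B * (t * \<rho> (w (hcube a l))) powr q * w (hcube a l))"
proof -
  obtain B where B: "0 < B" and jn: "\<forall>(f :: real ^ 'n \<Rightarrow> 'a) K a l.
    locally_integrable f \<longrightarrow> 0 < K \<longrightarrow> 0 < l \<longrightarrow> l \<le> 1 \<longrightarrow> osc_bound s f K (hcube a l) \<longrightarrow>
    (\<integral>\<^sup>+x\<in>hcube a l. ennreal (osc s f (hcube a l) x powr q * \<omega> x powr (1 - q)) \<partial>lebesgue)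
      \<le> ennreal (B * K powr q * w (hcube a l))" using john_nirenberg[OF q C0, where s = s and 'a = 'a] by (elim exE conjE) (rule that)
  obtain D where D: "1 < D" "\<And>c r c' r'. 0 < r \<Longrightarrow> hcube c r \<subseteq> hcube c' r' \<Longrightarrow> r' \<le> 2 * r \<Longrightarrow> r' \<le> 1 \<Longrightarrow>
       w (hcube c' r') \<le> D * w (hcube c r)"
    using doubling by metis
  define KP where "KP = (real (s + 1) ^ (s * CARD('n) + 2 * CARD('n)))\<^sup>2"
  have KP: "0 < KP" unfolding KP_def by simp
  define T where "T = KP * D"
  have T: "0 < T" using KP D(1) by (simp add: T_def)
  define B' where "B' = 2 powr q * (B + T powr q * C0)"
  have B': "0 < B'" using B C0(1) by (simp add: B'_def add_pos_nonneg)
  have main: "(\<integral>\<^sup>+x\<in>hcube a l. ennreal (norm (f x) powr q * \<omega> x powr (1 - q)) \<partial>lebesgue)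
      \<le> ennreal (B' * (t * \<rho> (w (hcube a l))) powr q * w (hcube a l))"
    if f: "locally_integrable f" and t: "0 < t" and le: "bmo_le s \<rho> \<omega> 1 f t" and l: "1 \<le> l"
    for f :: "real ^ 'n \<Rightarrow> 'a" and t a l
  proof -
    define Q where "Q = hcube a l"
    have l0: "0 < l" using l by simp
    have wQ: "0 < w Q" unfolding Q_def by (rule w_pos[OF l0])
    define K where "K = t * \<rho> (w Q)"
    have K: "0 < K" using t \<rho>_pos[OF wQ] by (simp add: K_def)
    note fm[measurable] = locally_integrable_measurable[OF f]
    define bad where "bad R \<longleftrightarrow> emeasure lebesgue R < 1" for R :: "(real ^ 'n) set"
    have bad_hcube: "bad (hcube c r) \<longleftrightarrow> r < 1" if "0 < r" for c r
      using that ccube_small_iff[OF that, of c] by (simp add: bad_def emeasure_ccube emeasure_hcube)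
    define F where "F = stopping_cells a l bad"
    have F: "countable F" "disjoint F" "F \<subseteq> sets lebesgue" "\<Union>F \<subseteq> Q"
      unfolding F_def Q_def by (rule stopping_cells_family[OF l0])+
    have cover: "Q \<subseteq> \<Union>F"
    proof
      fix x assume x: "x \<in> Q"
      show "x \<in> \<Union>F"
      proof (rule ccontr)
        assume "x \<notin> \<Union>F"
        then have nb: "\<not> bad (cell a l k x)" for k
          using not_bad_outside_stopping[of x a l bad k] x unfolding F_def Q_def by simp
        obtain k where k: "l < 2 ^ k" using real_arch_pow[of 2 l] by auto
        obtain c where "cell a l k x = hcube c (l / 2 ^ k)" using cell_is_hcube[OF l0] by blast
        then show False using nb[of k] k l0 bad_hcube[of "l / 2 ^ k" c] by simp
      qed
    qed
    have "(\<integral>\<^sup>+x\<in>\<Union>F. ennreal (norm (f x) powr q * \<omega> x powr (1 - q)) \<partial>lebesgue)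
        \<le> (\<integral>\<^sup>+x\<in>\<Union>F. ennreal (B' * K powr q) * ennreal (\<omega> x) \<partial>lebesgue)"
    proof (rule nn_integral_disjoint_sets_le[OF F(1-3)])
      fix R assume R: "R \<in> F"
      have nbQ: "\<not> bad (hcube a l)" using bad_hcube[OF l0] l by simp
      obtain c r c' where P: "0 < r" "R = hcube c r" "hcube c r \<subseteq> hcube c' (2 * r)" "hcube c' (2 * r) \<subseteq> hcube a l"
          "\<not> bad (hcube c' (2 * r))"
        using stopping_cells_parent[OF l0 R[unfolded F_def] nbQ] by blast
      have "bad R" using stopping_cellsD(1)[OF l0] R F_def by blast
      then have r1: "r < 1" using bad_hcube[OF P(1)] P(2) by simp
      have r2: "1 \<le> 2 * r" using bad_hcube[of "2 * r" c'] P(1,5) by simp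
      have RQ: "hcube c r \<subseteq> hcube a l" using P by blast
      have wR: "0 < w R" unfolding P(2) by (rule w_pos[OF P(1)])
      have wRQ: "w R \<le> w Q" unfolding P(2) Q_def by (rule w_mono[OF RQ order_refl])
      define v where "v = r ^ CARD('n)"
      have v: "0 < v" using P(1) by (simp add: v_def)
      have ob: "osc_bound s f K R" unfolding P(2) K_def
        by (rule bmo_one_osc_bound[OF t le P(1) r1]) (use wRQ P(2) in simp)
      have I1: "(\<integral>\<^sup>+x\<in>R. ennreal (osc s f R x powr q * \<omega> x powr (1 - q)) \<partial>lebesgue) \<le> ennreal (B * K powr q * w R)"
        using jn[rule_format, OF f K P(1) less_imp_le[OF r1], of c] ob unfolding P(2) by simp
      \<comment> \<open>corner of a unit cube with \<open>R \<subseteq> hcube d 1 \<subseteq> Q\<close>; the parent of \<open>R\<close> would not do, since it may have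
        side greater than \<open>1\<close>, where doubling is not available\<close>
      define d :: "real ^ 'n" where "d = (\<chi> i. min (c $ i) (a $ i + l - 1))"
      have cal: "a $ i \<le> c $ i \<and> c $ i + r \<le> a $ i + l" for i using RQ hcube_sub_iff[OF P(1)] by blast
      have sub: "hcube c r \<subseteq> hcube d 1" "hcube d 1 \<subseteq> hcube a l"
      proof -
        have "d $ i \<le> c $ i \<and> c $ i + r \<le> d $ i + 1" for i using cal[of i] r1 by (simp add: d_def min_def)
        then show "hcube c r \<subseteq> hcube d 1" using hcube_sub_iff[OF P(1)] by blast
        have "a $ i \<le> d $ i \<and> d $ i + 1 \<le> a $ i + l" for i using cal[of i] l P(1) by (simp add: d_def min_def)
        then show "hcube d 1 \<subseteq> hcube a l" by (simp add: hcube_sub_iff)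
      qed
      have wd: "0 < w (hcube d 1)" by (rule w_pos) simp
      have "wmean \<rho> \<omega> 1 (ccube d 1) f \<le> ennreal t" using le unfolding bmo_le_def by simp
      then have "(\<integral>\<^sup>+x\<in>hcube d 1. ennreal (norm (f x)) \<partial>lebesgue) \<le> ennreal (t * \<rho> (w (hcube d 1)) * w (hcube d 1))"
        using wmean_one_le_iff[of t \<omega> "ccube d 1" "w (hcube d 1)" \<rho> f, OF t _ wd \<rho>_pos[OF wd]]
        by (simp add: wmeas_ccube wmeas_hcube nn_integral_hcube_ccube)
      also have "\<dots> \<le> ennreal (K * (D * w R))"
      proof (rule ennreal_leI, rule mult_mono)
        show "t * \<rho> (w (hcube d 1)) \<le> K" unfolding K_def Q_def
          using t by (intro mult_left_mono \<rho>_mono wd w_mono[OF sub(2) order_refl]) simp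
        show "w (hcube d 1) \<le> D * w R" unfolding P(2) using D(2)[OF P(1) sub(1)] r2 by simp
      qed (use K in simp_all)
      finally have If: "(\<integral>\<^sup>+x\<in>R. ennreal (norm (f x)) \<partial>lebesgue) \<le> ennreal (K * (D * w R))"
        using nn_set_integral_mono[OF sub(1), of lebesgue "\<lambda>x. ennreal (norm (f x))"] unfolding P(2) by (rule order_trans[rotated])
      have Pf: "norm (poly_proj s (closure R) f x) \<le> T * K * (w R / v)" if x: "x \<in> R" for x
      proof -
        have xR: "x \<in> ccube c r" using x P hcube_sub_ccube by blast
        have "ennreal (norm (poly_proj s (closure R) f x)) * ennreal v \<le> ennreal KP * (\<integral>\<^sup>+z\<in>R. ennreal (norm (f z)) \<partial>lebesgue)"
          using poly_proj_diff_bound[OF P(1) f polys_zero xR, of s]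
          by (simp add: P(2) closure_hcube[OF P(1)] KP_def v_def)
        also have "\<dots> \<le> ennreal KP * ennreal (K * (D * w R))" by (intro mult_left_mono If) simp
        finally have "ennreal (norm (poly_proj s (closure R) f x) * v) \<le> ennreal (KP * (K * (D * w R)))"
          using KP K D(1) v by (simp add: ennreal_mult)
        then have "norm (poly_proj s (closure R) f x) * v \<le> KP * (K * (D * w R))"
          using KP K D(1) by (subst (asm) ennreal_le_iff) simp_all
        then show ?thesis using v by (simp add: T_def field_simps)
      qed
      define H where "H = (T * K * (w R / v)) powr q"
      have [measurable]: "osc s f R \<in> borel_measurable lebesgue" unfolding P(2) by (rule osc_measurable[OF P(1) f])
      have [measurable]: "R \<in> sets lebesgue" by (simp add: P(2))
      have pt: "norm (f x) powr q * \<omega> x powr (1 - q)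
          \<le> 2 powr q * (osc s f R x powr q * \<omega> x powr (1 - q)) + 2 powr q * H * \<omega> x powr (1 - q)" if x: "x \<in> R" for x
      proof -
        have "norm (f x) \<le> osc s f R x + norm (poly_proj s (closure R) f x)"
          unfolding osc_def using norm_triangle_ineq[of "f x - poly_proj s (closure R) f x" "poly_proj s (closure R) f x"] by simp
        also have "\<dots> \<le> osc s f R x + T * K * (w R / v)" using Pf[OF x] by simp
        finally have "norm (f x) powr q \<le> (osc s f R x + T * K * (w R / v)) powr q" using q by (intro powr_mono2) simp_all
        also have "\<dots> \<le> 2 powr q * osc s f R x powr q + 2 powr q * H"
          unfolding H_def using powr_add_le[of "osc s f R x" "T * K * (w R / v)" 1 q] q T K wR v by simp
        finally have "norm (f x) powr q * \<omega> x powr (1 - q)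
            \<le> (2 powr q * osc s f R x powr q + 2 powr q * H) * \<omega> x powr (1 - q)" by (rule mult_right_mono) simp
        then show ?thesis by (simp add: algebra_simps)
      qed
      have H0: "0 \<le> H" by (simp add: H_def)
      have "(\<integral>\<^sup>+x\<in>R. ennreal (norm (f x) powr q * \<omega> x powr (1 - q)) \<partial>lebesgue)
          \<le> (\<integral>\<^sup>+x. ennreal (2 powr q) * (ennreal (osc s f R x powr q * \<omega> x powr (1 - q)) * indicator R x)
               + ennreal (2 powr q * H) * (ennreal (\<omega> x powr (1 - q)) * indicator R x) \<partial>lebesgue)"
      proof (rule nn_integral_mono)
        fix x
        show "ennreal (norm (f x) powr q * \<omega> x powr (1 - q)) * indicator R x
            \<le> ennreal (2 powr q) * (ennreal (osc s f R x powr q * \<omega> x powr (1 - q)) * indicator R x)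
               + ennreal (2 powr q * H) * (ennreal (\<omega> x powr (1 - q)) * indicator R x)"
        proof (cases "x \<in> R")
          case True
          from ennreal_leI[OF pt[OF True]]
          have "ennreal (norm (f x) powr q * \<omega> x powr (1 - q))
              \<le> ennreal (2 powr q) * ennreal (osc s f R x powr q * \<omega> x powr (1 - q)) + ennreal (2 powr q * H) * ennreal (\<omega> x powr (1 - q))"
            using H0 by (subst (asm) ennreal_plus) (simp_all add: ennreal_mult)
          then show ?thesis using True by simp
        qed simp
      qed
      also have "\<dots> = ennreal (2 powr q) * (\<integral>\<^sup>+x\<in>R. ennreal (osc s f R x powr q * \<omega> x powr (1 - q)) \<partial>lebesgue)
          + ennreal (2 powr q * H) * (\<integral>\<^sup>+x\<in>R. ennreal (\<omega> x powr (1 - q)) \<partial>lebesgue)"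
        by (simp add: nn_integral_add nn_integral_cmult)
      also have "ennreal (2 powr q * H) * (\<integral>\<^sup>+x\<in>R. ennreal (\<omega> x powr (1 - q)) \<partial>lebesgue)
          = ennreal (2 powr q) * (ennreal H * (\<integral>\<^sup>+x\<in>R. ennreal (\<omega> x powr (1 - q)) \<partial>lebesgue))"
        using H0 by (simp add: ennreal_mult mult.assoc)
      also have "ennreal (2 powr q) * (\<integral>\<^sup>+x\<in>R. ennreal (osc s f R x powr q * \<omega> x powr (1 - q)) \<partial>lebesgue) + \<dots>
          \<le> ennreal (2 powr q) * ennreal (B * K powr q * w R) + ennreal (2 powr q) * ennreal (C0 * (T * K) powr q * w R)"
        using power_bound_mean[OF C0(2) P(1) less_imp_le[OF r1], of "T * K" c] C0(1) T K
        by (intro add_mono mult_left_mono I1) (simp_all add: P(2) v_def H_def)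
      also have "\<dots> = ennreal (2 powr q * (B * K powr q * w R) + 2 powr q * (C0 * (T * K) powr q * w R))"
        using B C0(1) wR by (subst ennreal_plus) (simp_all add: ennreal_mult')
      also have "2 powr q * (B * K powr q * w R) + 2 powr q * (C0 * (T * K) powr q * w R) = B' * K powr q * w R"
        using T K powr_mult[of T K q] by (simp add: B'_def algebra_simps)
      also have "ennreal (B' * K powr q * w R) = (\<integral>\<^sup>+x\<in>R. ennreal (B' * K powr q) * ennreal (\<omega> x) \<partial>lebesgue)"
        using B' wmeas_hcube[of c r] unfolding P(2)[symmetric]
        by (simp add: ennreal_mult' nn_integral_cmult mult.assoc wmeas_def)
      finally show "(\<integral>\<^sup>+x\<in>R. ennreal (norm (f x) powr q * \<omega> x powr (1 - q)) \<partial>lebesgue)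
          \<le> (\<integral>\<^sup>+x\<in>R. ennreal (B' * K powr q) * ennreal (\<omega> x) \<partial>lebesgue)" .
    qed simp_all
    also have "\<dots> \<le> (\<integral>\<^sup>+x\<in>Q. ennreal (B' * K powr q) * ennreal (\<omega> x) \<partial>lebesgue)"
      by (rule nn_set_integral_mono[OF F(4)])
    also have "\<dots> = ennreal (B' * K powr q * w Q)"
      using B' wmeas_hcube[of a l] unfolding Q_def[symmetric]
      by (simp add: ennreal_mult' nn_integral_cmult mult.assoc wmeas_def Q_def)
    finally show ?thesis using cover F(4) by (simp add: Q_def K_def subset_antisym)
  qed
  show ?thesis by (intro exI[of _ B'] conjI allI impI B') (rule main)
qed

lemma bmo_le_one_imp_dual:
  assumes q: "1 < q" and C0: "0 < C0" "power_bound (q - 1) C0"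
  shows "\<exists>D>0. \<forall>(f :: real ^ 'n \<Rightarrow> 'a::{real_normed_field, euclidean_space}) t.
    locally_integrable f \<longrightarrow> 0 < t \<longrightarrow> bmo_le s \<rho> \<omega> 1 f t \<longrightarrow> bmo_le s \<rho> \<omega> q f (D * t)"
proof -
  obtain B where B: "0 < B" and jn: "\<forall>(f :: real ^ 'n \<Rightarrow> 'a) K a l.
    locally_integrable f \<longrightarrow> 0 < K \<longrightarrow> 0 < l \<longrightarrow> l \<le> 1 \<longrightarrow> osc_bound s f K (hcube a l) \<longrightarrow>
    (\<integral>\<^sup>+x\<in>hcube a l. ennreal (osc s f (hcube a l) x powr q * \<omega> x powr (1 - q)) \<partial>lebesgue)
      \<le> ennreal (B * K powr q * w (hcube a l))"
    using john_nirenberg[OF q C0, where s = s and 'a = 'a] by (elim exE conjE) (rule that)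
  obtain B' where B': "0 < B'" and large: "\<forall>(f :: real ^ 'n \<Rightarrow> 'a) t a l.
    locally_integrable f \<longrightarrow> 0 < t \<longrightarrow> bmo_le s \<rho> \<omega> 1 f t \<longrightarrow> 1 \<le> l \<longrightarrow>
    (\<integral>\<^sup>+x\<in>hcube a l. ennreal (norm (f x) powr q * \<omega> x powr (1 - q)) \<partial>lebesgue)
      \<le> ennreal (B' * (t * \<rho> (w (hcube a l))) powr q * w (hcube a l))"
    using large_cube_bound[OF q C0, where s = s and 'a = 'a] by (elim exE conjE) (rule that)
  define D where "D = (B + B') powr (1 / q)"
  have D: "0 < D" "D powr q = B + B'" using B B' q by (simp_all add: D_def powr_powr)
  have wm: "wmean \<rho> \<omega> q E g \<le> ennreal (D * t)"
    if t: "0 < t" and W: "wmeas \<omega> E = ennreal W" "0 < W" and b: "b \<le> B + B'"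
      and le: "(\<integral>\<^sup>+x\<in>E. ennreal (norm (g x) powr q * \<omega> x powr (1 - q)) \<partial>lebesgue) \<le> ennreal (b * (t * \<rho> W) powr q * W)"
    for E W b t and g :: "real ^ 'n \<Rightarrow> 'a"
  proof -
    have "b * (t * \<rho> W) powr q * W \<le> (D * t * \<rho> W) powr q * W"
      using b D W(2) t \<rho>_pos[OF W(2)] powr_mult[of D "t * \<rho> W" q]
      by (simp add: mult.assoc mult_right_mono)
    then have "(\<integral>\<^sup>+x\<in>E. ennreal (norm (g x) powr q * \<omega> x powr (1 - q)) \<partial>lebesgue) \<le> ennreal ((D * t * \<rho> W) powr q * W)"
      using le by (meson ennreal_leI order_trans)
    then show ?thesis
      using wmean_le_iff[of q "D * t" \<omega> E W \<rho> g, OF _ _ W \<rho>_pos[OF W(2)]] q D t unfolding epow_dual_integral by simp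
  qed
  have "bmo_le s \<rho> \<omega> q f (D * t)"
    if f: "locally_integrable f" and t: "0 < t" and le: "bmo_le s \<rho> \<omega> 1 f t" for f :: "real ^ 'n \<Rightarrow> 'a" and t
    unfolding bmo_le_def
  proof (intro conjI allI impI)
    fix a :: "real ^ 'n" and l :: real assume l: "0 < l" "l < 1"
    have wp: "0 < w (hcube a l)" by (rule w_pos[OF l(1)])
    have "osc_bound s f (t * \<rho> (w (hcube a l))) (hcube a l)"
      by (rule bmo_one_osc_bound[OF t le l order_refl])
    then have "(\<integral>\<^sup>+x\<in>hcube a l. ennreal (osc s f (hcube a l) x powr q * \<omega> x powr (1 - q)) \<partial>lebesgue)
      \<le> ennreal (B * (t * \<rho> (w (hcube a l))) powr q * w (hcube a l))"
      using jn f t \<rho>_pos[OF wp] l by simp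
    then show "wmean \<rho> \<omega> q (ccube a l) (\<lambda>x. f x - poly_proj s (ccube a l) f x) \<le> ennreal (D * t)"
      unfolding osc_hcube[OF l(1)] nn_integral_hcube_ccube using B'
      by (intro wm[of t _ _ B, OF t _ wp]) (simp_all add: wmeas_ccube wmeas_hcube)
  next
    fix a :: "real ^ 'n" and l :: real assume l: "1 \<le> l"
    then have wp: "0 < w (hcube a l)" by (intro w_pos) simp
    have "(\<integral>\<^sup>+x\<in>hcube a l. ennreal (norm (f x) powr q * \<omega> x powr (1 - q)) \<partial>lebesgue)
      \<le> ennreal (B' * (t * \<rho> (w (hcube a l))) powr q * w (hcube a l))"
      using large f t le l by blast
    then show "wmean \<rho> \<omega> q (ccube a l) f \<le> ennreal (D * t)"
      unfolding nn_integral_hcube_ccube using B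
      by (intro wm[of t _ _ B', OF t _ wp]) (simp_all add: wmeas_ccube wmeas_hcube)
  next
    assume fin: "wmeas \<omega> UNIV < \<infinity>"
    let ?W = "w UNIV"
    let ?g = "\<lambda>x. ennreal (norm (f x) powr q * \<omega> x powr (1 - q))"
    note [measurable] = locally_integrable_measurable[OF f]
    \<comment> \<open>cubes of side at least \<open>1\<close> exhausting the space; the bounds for them are uniform\<close>
    define E :: "nat \<Rightarrow> (real ^ 'n) set" where "E m = hcube (\<chi> i. - real (Suc m)) (2 * real (Suc m))" for m
    have [measurable]: "E m \<in> sets lebesgue" for m by (simp add: E_def)
    have inc: "incseq E"
      by (rule incseq_SucI) (auto simp: E_def hcube_sub_iff)
    have UN: "(\<Union>m. E m) = UNIV"
    proof (intro equalityI subsetI UNIV_I)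
      fix x :: "real ^ 'n"
      obtain m where m: "norm x < real m" using reals_Archimedean2 by blast
      have "- real (Suc m) \<le> x $ i \<and> x $ i < - real (Suc m) + 2 * real (Suc m)" for i
        using component_le_norm_cart[of x i] m by auto
      then have "x \<in> E m" by (simp add: E_def hcube_def)
      then show "x \<in> (\<Union>m. E m)" by blast
    qed
    have bound: "(\<integral>\<^sup>+x\<in>E m. ?g x \<partial>lebesgue) \<le> ennreal (B' * (t * \<rho> ?W) powr q * ?W)" for m
    proof -
      have wp: "0 < w (E m)" unfolding E_def by (rule w_pos) simp
      have "(\<integral>\<^sup>+x\<in>E m. ?g x \<partial>lebesgue) \<le> ennreal (B' * (t * \<rho> (w (E m))) powr q * w (E m))"
        unfolding E_def using large f t le by simp
      also have "\<dots> \<le> ennreal (B' * (t * \<rho> ?W) powr q * ?W)"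
        using B' t q wp \<rho>_pos[OF wp] \<rho>_mono[OF wp w_UNIV(3)[OF fin]] w_UNIV(3)[OF fin, of "E m"]
        by (intro ennreal_leI mult_mono mult_left_mono powr_mono2) simp_all
      finally show ?thesis .
    qed
    have "(\<integral>\<^sup>+x\<in>UNIV. ?g x \<partial>lebesgue) = emeasure (density lebesgue ?g) (\<Union>m. E m)"
      unfolding UN by (subst emeasure_density) simp_all
    also have "\<dots> = (SUP m. emeasure (density lebesgue ?g) (E m))"
      using inc by (intro SUP_emeasure_incseq[symmetric]) auto
    also have "\<dots> \<le> ennreal (B' * (t * \<rho> ?W) powr q * ?W)"
      using bound by (intro SUP_least) (simp add: emeasure_density)
    finally show "wmean \<rho> \<omega> q UNIV f \<le> ennreal (D * t)"
      using B w_UNIV(1,2)[OF fin] by (intro wm[of t _ ?W B', OF t]) simp_all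
  qed
  then show ?thesis using D(1) by blast
qed

lemma bmo_norm_equivalence:
  assumes q: "1 < q" and C0: "0 < C0" "power_bound (q - 1) C0"
  shows "\<exists>C>0. \<forall>f :: real ^ 'n \<Rightarrow> 'a::{real_normed_field, euclidean_space}. locally_integrable f \<longrightarrow>
    bmo_norm s \<rho> \<omega> 1 f \<le> ennreal 6 * bmo_norm s \<rho> \<omega> q f \<and>
    bmo_norm s \<rho> \<omega> q f \<le> ennreal C * bmo_norm s \<rho> \<omega> 1 f"
proof -
  obtain D where D: "0 < D" and up: "\<forall>(f :: real ^ 'n \<Rightarrow> 'a) t.
    locally_integrable f \<longrightarrow> 0 < t \<longrightarrow> bmo_le s \<rho> \<omega> 1 f t \<longrightarrow> bmo_le s \<rho> \<omega> q f (D * t)"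
    using bmo_le_one_imp_dual[OF q C0, where s = s and 'a = 'a] by (elim exE conjE) (rule that)
  show ?thesis
  proof (intro exI[of _ "3 * D"] conjI allI impI)
    fix f :: "real ^ 'n \<Rightarrow> 'a" assume f: "locally_integrable f"
    show "bmo_norm s \<rho> \<omega> 1 f \<le> ennreal 6 * bmo_norm s \<rho> \<omega> q f"
    proof (rule ennreal_le_mult_of_real_bounds)
      fix t :: real assume t: "0 < t" "bmo_norm s \<rho> \<omega> q f \<le> ennreal t"
      have "bmo_le s \<rho> \<omega> 1 f (2 * t)"
        by (rule bmo_le_dual_imp_one[OF q t(1) f bmo_norm_imp_bmo_le[OF t(2)]])
      from bmo_le_imp_bmo_norm[OF this] show "bmo_norm s \<rho> \<omega> 1 f \<le> ennreal (6 * t)" using t(1) by simp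
    qed simp
    show "bmo_norm s \<rho> \<omega> q f \<le> ennreal (3 * D) * bmo_norm s \<rho> \<omega> 1 f"
    proof (rule ennreal_le_mult_of_real_bounds)
      fix t :: real assume t: "0 < t" "bmo_norm s \<rho> \<omega> 1 f \<le> ennreal t"
      have "bmo_le s \<rho> \<omega> q f (D * t)" using up f t(1) bmo_norm_imp_bmo_le[OF t(2)] by blast
      from bmo_le_imp_bmo_norm[OF this] show "bmo_norm s \<rho> \<omega> q f \<le> ennreal (3 * D * t)"
        using t(1) D by (simp add: mult.assoc)
    qed (use D in simp)
  qed (use D in simp)
qed

end

end

theorem corollary7p6:
  fixes \<Phi> :: "real \<Rightarrow> real"
    and \<omega> :: "real ^ 'n \<Rightarrow> real"
    and s :: nat
    and q :: real
  assumes "assumption_A \<Phi>"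
    and "\<omega> \<in> A_loc_inf"
    and "int s \<ge> \<lfloor>real CARD('n) * (crit_index \<omega> / lower_index \<Phi> - 1)\<rfloor>"
    and "1 \<le> q" and "ereal q < crit_conj \<omega>"
  shows "(bmo s (rho \<Phi>) \<omega> q :: (real ^ 'n \<Rightarrow> 'a::{real_normed_field, euclidean_space}) set)
           = bmo s (rho \<Phi>) \<omega> 1
       \<and> (\<exists>c C. 0 < c \<and> 0 < C \<and>
            (\<forall>f \<in> (bmo s (rho \<Phi>) \<omega> 1 :: (real ^ 'n \<Rightarrow> 'a) set).
               ennreal c * bmo_norm s (rho \<Phi>) \<omega> 1 f \<le> bmo_norm s (rho \<Phi>) \<omega> q f \<and>
               bmo_norm s (rho \<Phi>) \<omega> q f \<le> ennreal C * bmo_norm s (rho \<Phi>) \<omega> 1 f))"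
proof (cases "q = 1")
  case True
  then show ?thesis by (intro conjI exI[of _ 1]) simp_all
next
  case False
  then have q: "1 < q" using assms(4) by simp
  interpret A_inf_weight \<omega> by unfold_locales (rule assms(2))
  obtain C0 where C0: "0 < C0" "power_bound (q - 1) C0"
    using dual_weight_bound_below_crit[OF q assms(5)] by metis
  obtain C where C: "0 < C" and eq: "\<forall>f :: real ^ 'n \<Rightarrow> 'a. locally_integrable f \<longrightarrow>
    bmo_norm s (rho \<Phi>) \<omega> 1 f \<le> ennreal 6 * bmo_norm s (rho \<Phi>) \<omega> q f \<and>
    bmo_norm s (rho \<Phi>) \<omega> q f \<le> ennreal C * bmo_norm s (rho \<Phi>) \<omega> 1 f"
  proof -
    have "\<exists>C>0. \<forall>f :: real ^ 'n \<Rightarrow> 'a. locally_integrable f \<longrightarrow>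
      bmo_norm s (rho \<Phi>) \<omega> 1 f \<le> ennreal 6 * bmo_norm s (rho \<Phi>) \<omega> q f \<and>
      bmo_norm s (rho \<Phi>) \<omega> q f \<le> ennreal C * bmo_norm s (rho \<Phi>) \<omega> 1 f"
      by (rule bmo_norm_equivalence[OF _ _ q C0])
         (erule rho_pos_mono(1)[OF assms(1)], erule (1) rho_pos_mono(2)[OF assms(1)])
    then show thesis by (elim exE conjE) (rule that)
  qed
  have "f \<in> bmo s (rho \<Phi>) \<omega> q \<longleftrightarrow> f \<in> bmo s (rho \<Phi>) \<omega> 1" for f :: "real ^ 'n \<Rightarrow> 'a"
  proof (cases "locally_integrable f")
    case True
    have "bmo_norm s (rho \<Phi>) \<omega> q f < \<infinity> \<longleftrightarrow> bmo_norm s (rho \<Phi>) \<omega> 1 f < \<infinity>"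
    proof
      assume "bmo_norm s (rho \<Phi>) \<omega> q f < \<infinity>"
      then have "ennreal 6 * bmo_norm s (rho \<Phi>) \<omega> q f < \<infinity>" by (simp add: ennreal_mult_less_top)
      then show "bmo_norm s (rho \<Phi>) \<omega> 1 f < \<infinity>" using eq True by (metis le_less_trans)
    next
      assume "bmo_norm s (rho \<Phi>) \<omega> 1 f < \<infinity>"
      then have "ennreal C * bmo_norm s (rho \<Phi>) \<omega> 1 f < \<infinity>" by (simp add: ennreal_mult_less_top)
      then show "bmo_norm s (rho \<Phi>) \<omega> q f < \<infinity>" using eq True by (metis le_less_trans)
    qed
    then show ?thesis by (simp add: bmo_def)
  qed (simp add: bmo_def)
  moreover have "ennreal (1 / 6) * bmo_norm s (rho \<Phi>) \<omega> 1 f \<le> bmo_norm s (rho \<Phi>) \<omega> q f \<and>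
      bmo_norm s (rho \<Phi>) \<omega> q f \<le> ennreal C * bmo_norm s (rho \<Phi>) \<omega> 1 f"
    if "f \<in> bmo s (rho \<Phi>) \<omega> 1" for f :: "real ^ 'n \<Rightarrow> 'a"
  proof
    have f: "locally_integrable f" using that by (simp add: bmo_def)
    have "ennreal (1 / 6) * bmo_norm s (rho \<Phi>) \<omega> 1 f \<le> ennreal (1 / 6) * (ennreal 6 * bmo_norm s (rho \<Phi>) \<omega> q f)"
      using eq f by (intro mult_left_mono) simp_all
    also have "\<dots> = ennreal (1 / 6 * 6) * bmo_norm s (rho \<Phi>) \<omega> q f"
      by (subst ennreal_mult) (simp_all add: mult.assoc)
    finally show "ennreal (1 / 6) * bmo_norm s (rho \<Phi>) \<omega> 1 f \<le> bmo_norm s (rho \<Phi>) \<omega> q f" by simp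
    show "bmo_norm s (rho \<Phi>) \<omega> q f \<le> ennreal C * bmo_norm s (rho \<Phi>) \<omega> 1 f" using eq f by blast
  qed
  ultimately show ?thesis using C by (intro conjI exI[of _ "1 / 6"] exI[of _ C]) auto
qed

end
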